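(* Let $(M,\mathcal T)$ be a closed pseudo 3-manifold with edge set $E$. There exists a zero-curvature hyper-ideal metric on $(M,\mathcal T)$ if and only if the extended Ricci flow $$\frac{d}{dt}l_e(t)=\widetilde K_e(l(t))\,l_e(t)\quad(e\in E,\ t\ge0),\qquad l(0)=l_0,$$ converges to a hyper-ideal metric for some initial data $l_0\in\mathbb R^E_{>0}$. In this case, for any initial data in $\mathbb R^E_{>0}$, the extended Ricci flow converges to a hyper-ideal metric exponentially fast.
   Context: Closed pseudo 3-manifold. Let $T_1,\dots,T_t$ be finitely many combinatorial tetrahedra with disjoint union $\mathscr T$. A closed pseudo 3-manifold $(M,\mathcal T)$ is the quotient of $\mathscr T$ by a family of affine isomorphisms pairing faces of the tetrahedra, such that each codimension-1 face is identified with another codimension-1 face. Its edge set $E$ is the set of equivalence classes of edges of $T_1,\dots,T_t$ under the gluing; $P_E$ is the projection from the edges of $\mathscr T$ to $E$. $\mathbb R^E_{>0}$ is the set of positive functions on $E$. Extended dihedral angles. For $l=(l_{12},l_{13},l_{14},l_{23},l_{24},l_{34})\in\mathbb R^6_{\ge0}$, with $l_{ij}=l_{ji}$, $c_{ij}=\cosh l_{ij}$, $s_{ij}=\sinh l_{ij}$ and $\{i,j,k,h\}=\{1,2,3,4\}$, set $$\phi_{ij}(l)=\frac{c_{ik}c_{ih}+c_{jk}c_{jh}+c_{ij}c_{ik}c_{jh}+c_{ij}c_{ih}c_{jk}-s_{ij}^2c_{kh}}{\sqrt{2c_{ij}c_{ik}c_{jk}+c_{ij}^2+c_{ik}^2+c_{jk}^2-1}\,\sqrt{2c_{ij}c_{ih}c_{jh}+c_{ij}^2+c_{ih}^2+c_{jh}^2-1}},$$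 and let the extended dihedral angle at edge $\{i,j\}$ be $\alpha_{ij}(l)=\arccos\big(\max(-1,\min(\phi_{ij}(l),1))\big)$. Generalized Ricci curvature. Given $l\in\mathbb R^E_{>0}$, give each edge $\hat e$ of each tetrahedron $T_j$ the length $\hat l(\hat e)=l(P_E(\hat e))$, and let $\alpha(\hat e)$ be the extended dihedral angle at $\hat e$ in the tetrahedron $T_j$ containing it, computed from the six lengths of $T_j$. Then $\widetilde K_e(l)=2\pi-\sum_{\hat e\in P_E^{-1}(e)}\alpha(\hat e)$. Hyper-ideal metrics. A hyper-ideal tetrahedron is a compact convex polyhedron in $\mathbb H^3$ diffeomorphic to a truncated Euclidean tetrahedron whose four hexagonal faces are right-angled hyperbolic hexagons and whose four triangular faces are hyperbolic triangles meeting the hexagonal faces at angle $\pi/2$; its six edges are the intersections of pairs of hexagonal faces. $\mathcal L\subset\mathbb R^6_{>0}$ is the set of edge length vectors of hyper-ideal tetrahedra; by a known result of Luo and Yang, $\mathcal L=\{l\in\mathbb R^6_{\ge0}:\phi_{ij}(l)\in(-1,1)\text{ for all }\{i,j\}\}$. $\mathcal L(M,\mathcal T)\subset\mathbb R^E_{>0}$, the set of hyper-ideal metrics, is the set of $l$ such that for every $T_j$ the six lengths given by $\hat l$ lie in $\mathcal L$; on it, extended dihedral angles are the actual dihedral angles and $\widetilde K=K$ is the Ricci curvature. A zero-curvature hyper-ideal metric is $l\in\mathcal L(M,\mathcal T)$ with $K_e(l)=0$ for all $e\in E$. Convergence. For every $l_0\in\mathbb R^E_{>0}$ the flow has a unique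 solution $l(t)\in\mathbb R^E_{>0}$ on $[0,\infty)$. The flow converges to $l_\infty\in\mathbb R^E_{>0}$ if $l(t)\to l_\infty$ as $t\to\infty$; exponentially fast means $|l(t)-l_\infty|\le Ae^{-\lambda t}$ for all $t\ge0$ and some $A,\lambda>0$. *)

theory Defs
  imports "HOL-Analysis.Analysis"
begin

section \<open>Closed pseudo 3-manifolds\<close>

text \<open>
  The vertices of every tetrahedron are labelled by the four-element type \<^typ>\<open>4\<close>, and \<open>(T, i)\<close> is
  the face of the tetrahedron \<open>T\<close> opposite to its vertex \<open>i\<close>. An affine isomorphism between two
  faces is determined by a bijection of their vertices, which we extend to a permutation \<open>\<sigma>\<close> of all
  four labels by matching the two opposite vertices: \<open>G (T, i) = (T', \<sigma>)\<close> means that the face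
  \<open>(T, i)\<close> is glued to the face \<open>(T', \<sigma> i)\<close>, the vertex \<open>j \<noteq> i\<close> of \<open>T\<close> going to the
  vertex \<open>\<sigma> j\<close> of \<open>T'\<close>. The two faces of a pair are distinct, but they may belong to the same
  tetrahedron.
\<close>

type_synonym 't gluing = "'t \<times> 4 \<Rightarrow> 't \<times> (4 \<Rightarrow> 4)"

definition closed_pseudo_manifold :: "('t::finite) gluing \<Rightarrow> bool" where
  "closed_pseudo_manifold G \<longleftrightarrow>
     (\<forall>T i T' \<sigma>. G (T, i) = (T', \<sigma>) \<longrightarrow>
        bij \<sigma> \<and> (T', \<sigma> i) \<noteq> (T, i) \<and> G (T', \<sigma> i) = (T, inv \<sigma>))"

text \<open>An edge of a tetrahedron is the two-element set of its end points.\<close>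

definition tet_edges :: "('t \<times> 4 set) set" where
  "tet_edges = {(T, \<epsilon>). card \<epsilon> = 2}"

definition edge_gluing :: "'t gluing \<Rightarrow> (('t \<times> 4 set) \<times> ('t \<times> 4 set)) set" where
  "edge_gluing G = {((T, \<epsilon>), (T', \<sigma> ` \<epsilon>)) | T \<epsilon> T' \<sigma>.
     card \<epsilon> = 2 \<and> (\<exists>i. i \<notin> \<epsilon> \<and> G (T, i) = (T', \<sigma>))}"

definition edge_equiv :: "'t gluing \<Rightarrow> (('t \<times> 4 set) \<times> ('t \<times> 4 set)) set" where
  "edge_equiv G = (edge_gluing G \<union> (edge_gluing G)\<inverse>)\<^sup>*"

definition edge_proj :: "'t gluing \<Rightarrow> 't \<times> 4 set \<Rightarrow> ('t \<times> 4 set) set" where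
  "edge_proj G x = edge_equiv G `` {x}"

definition edges :: "'t gluing \<Rightarrow> ('t \<times> 4 set) set set" where
  "edges G = tet_edges // edge_equiv G"

text \<open>
  An element of \<open>\<real>\<^sup>E\<close> is a function on the sets of edges of tetrahedra; only its values on
  \<open>edges G\<close> matter.
\<close>

definition pos_on_edges :: "'t gluing \<Rightarrow> (('t \<times> 4 set) set \<Rightarrow> real) \<Rightarrow> bool" where
  "pos_on_edges G l \<longleftrightarrow> (\<forall>e\<in>edges G. l e > 0)"

definition tet_lengths ::
    "'t gluing \<Rightarrow> (('t \<times> 4 set) set \<Rightarrow> real) \<Rightarrow> 't \<Rightarrow> 4 set \<Rightarrow> real" where
  "tet_lengths G l T \<epsilon> = l (edge_proj G (T, \<epsilon>))"

section \<open>Hyperbolic geometry in the Klein model\<close>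

text \<open>
  \<open>\<bbbH>\<^sup>3\<close> is the open unit ball of \<^typ>\<open>real^3\<close>, and its geodesics are the Euclidean straight
  segments. Hence convexity, convex hulls and faces are the Euclidean ones, and the compact convex
  polyhedra of \<open>\<bbbH>\<^sup>3\<close> are the Euclidean polytopes contained in the open unit ball.
\<close>

definition hyp_dist :: "real^3 \<Rightarrow> real^3 \<Rightarrow> real" where
  "hyp_dist x y = arcosh ((1 - x \<bullet> y) / (sqrt (1 - x \<bullet> x) * sqrt (1 - y \<bullet> y)))"

text \<open>The Riemannian metric of the Klein model at the point \<open>x\<close>.\<close>

definition klein_metric :: "real^3 \<Rightarrow> real^3 \<Rightarrow> real^3 \<Rightarrow> real" where
  "klein_metric x u v = (u \<bullet> v) / (1 - x \<bullet> x) + (x \<bullet> u) * (x \<bullet> v) / (1 - x \<bullet> x)\<^sup>2"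

definition tangent_angle :: "real^3 \<Rightarrow> real^3 \<Rightarrow> real^3 \<Rightarrow> real" where
  "tangent_angle x u v =
     arccos (klein_metric x u v / (sqrt (klein_metric x u u) * sqrt (klein_metric x v v)))"

text \<open>The angle at \<open>x\<close> between the geodesic segments from \<open>x\<close> to \<open>y\<close> and to \<open>z\<close>.\<close>

definition hyp_angle :: "real^3 \<Rightarrow> real^3 \<Rightarrow> real^3 \<Rightarrow> real" where
  "hyp_angle x y z = tangent_angle x (y - x) (z - x)"

text \<open>
  The dihedral angle along the geodesic \<open>xy\<close> between the half-planes through \<open>z\<close> and through \<open>w\<close>,
  measured at \<open>x\<close> in the plane orthogonal to the geodesic.
\<close>

definition normal_part :: "real^3 \<Rightarrow> real^3 \<Rightarrow> real^3 \<Rightarrow> real^3" where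
  "normal_part x u v = v - (klein_metric x u v / klein_metric x u u) *\<^sub>R u"

definition hyp_dihedral :: "real^3 \<Rightarrow> real^3 \<Rightarrow> real^3 \<Rightarrow> real^3 \<Rightarrow> real" where
  "hyp_dihedral x y z w =
     tangent_angle x (normal_part x (y - x) (z - x)) (normal_part x (y - x) (w - x))"

section \<open>Hyper-ideal tetrahedra\<close>

text \<open>
  A truncated tetrahedron has twelve vertices: \<open>p i j\<close>, for \<open>i \<noteq> j\<close>, is the vertex on the edge
  \<open>{i, j}\<close> at the end where the vertex \<open>i\<close> has been cut off. (The values \<open>p i i\<close> play no role.) The
  edge \<open>{i, j}\<close> is the segment from \<open>p i j\<close> to \<open>p j i\<close>.
\<close>

definition trunc_vertices :: "(4 \<Rightarrow> 4 \<Rightarrow> real^3) \<Rightarrow> (real^3) set" where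
  "trunc_vertices p = {p i j | i j. i \<noteq> j}"

definition trunc_polyhedron :: "(4 \<Rightarrow> 4 \<Rightarrow> real^3) \<Rightarrow> (real^3) set" where
  "trunc_polyhedron p = convex hull (trunc_vertices p)"

definition triangle_face :: "(4 \<Rightarrow> 4 \<Rightarrow> real^3) \<Rightarrow> 4 \<Rightarrow> (real^3) set" where
  "triangle_face p i = convex hull {p i j | j. j \<noteq> i}"

definition hexagon_face :: "(4 \<Rightarrow> 4 \<Rightarrow> real^3) \<Rightarrow> 4 \<Rightarrow> (real^3) set" where
  "hexagon_face p h = convex hull {p i j | i j. i \<noteq> j \<and> i \<noteq> h \<and> j \<noteq> h}"

text \<open>
  The vertices and the facets of a polytope determine its face lattice, so the conditions on them
  say that the polyhedron has the combinatorial type of a truncated tetrahedron. The last two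
  conditions are the right angles of the hexagons, and the right angles between a triangle and a
  hexagon along their common edge from \<open>p i j\<close> to \<open>p i k\<close>.
\<close>

definition hyper_ideal_tetrahedron :: "(4 \<Rightarrow> 4 \<Rightarrow> real^3) \<Rightarrow> bool" where
  "hyper_ideal_tetrahedron p \<longleftrightarrow>
     trunc_polyhedron p \<subseteq> ball 0 1 \<and>
     aff_dim (trunc_polyhedron p) = 3 \<and>
     inj_on (\<lambda>(i, j). p i j) {(i, j). i \<noteq> j} \<and>
     {x. x extreme_point_of trunc_polyhedron p} = trunc_vertices p \<and>
     {F. F facet_of trunc_polyhedron p} = range (triangle_face p) \<union> range (hexagon_face p) \<and>
     (\<forall>i j k. i \<noteq> j \<and> i \<noteq> k \<and> j \<noteq> k \<longrightarrow> hyp_angle (p i j) (p j i) (p i k) = pi / 2) \<and>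
     (\<forall>i j k h. {i, j, k, h} = UNIV \<longrightarrow>
        hyp_dihedral (p i j) (p i k) (p i h) (p j i) = pi / 2)"

text \<open>
  The six lengths of a tetrahedron are the values on two-element sets of a function on \<^typ>\<open>4 set\<close>.
\<close>

definition has_edge_lengths :: "(4 \<Rightarrow> 4 \<Rightarrow> real^3) \<Rightarrow> (4 set \<Rightarrow> real) \<Rightarrow> bool" where
  "has_edge_lengths p l \<longleftrightarrow> (\<forall>i j. i \<noteq> j \<longrightarrow> l {i, j} = hyp_dist (p i j) (p j i))"

definition hyper_ideal_lengths :: "(4 set \<Rightarrow> real) set" where
  "hyper_ideal_lengths = {l. \<exists>p. hyper_ideal_tetrahedron p \<and> has_edge_lengths p l}"

text \<open>
  A hyper-ideal tetrahedron is determined by its edge lengths up to isometry, so the description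
  below of the dihedral angle at an edge has a unique solution for \<open>l \<in> hyper_ideal_lengths\<close>.
\<close>

definition dihedral_angle :: "(4 set \<Rightarrow> real) \<Rightarrow> 4 set \<Rightarrow> real" where
  "dihedral_angle l \<epsilon> = (THE a. \<exists>p i j k h.
     hyper_ideal_tetrahedron p \<and> has_edge_lengths p l \<and>
     \<epsilon> = {i, j} \<and> {i, j, k, h} = UNIV \<and> a = hyp_dihedral (p i j) (p j i) (p i k) (p i h))"

section \<open>Extended dihedral angles\<close>

definition phi :: "(4 set \<Rightarrow> real) \<Rightarrow> 4 \<Rightarrow> 4 \<Rightarrow> 4 \<Rightarrow> 4 \<Rightarrow> real" where
  "phi l i j k h =
     (let c = (\<lambda>a b. cosh (l {a, b})); s = (\<lambda>a b. sinh (l {a, b})) in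
      (c i k * c i h + c j k * c j h + c i j * c i k * c j h + c i j * c i h * c j k
         - (s i j)\<^sup>2 * c k h) /
      (sqrt (2 * c i j * c i k * c j k + (c i j)\<^sup>2 + (c i k)\<^sup>2 + (c j k)\<^sup>2 - 1) *
       sqrt (2 * c i j * c i h * c j h + (c i j)\<^sup>2 + (c i h)\<^sup>2 + (c j h)\<^sup>2 - 1)))"

definition ext_dihedral_angle :: "(4 set \<Rightarrow> real) \<Rightarrow> 4 set \<Rightarrow> real" where
  "ext_dihedral_angle l \<epsilon> = (THE a. \<exists>i j k h.
     \<epsilon> = {i, j} \<and> {i, j, k, h} = UNIV \<and> a = arccos (max (-1) (min (phi l i j k h) 1)))"

text \<open>
  The description is unambiguous, as \<open>phi\<close> is symmetric in \<open>i, j\<close> and in \<open>k, h\<close>.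
\<close>

lemma phi_swap: "phi l j i k h = phi l i j k h" "phi l i j h k = phi l i j k h"
proof -
  have c: "cosh (l {b, a}) = cosh (l {a, b})" "sinh (l {b, a}) = sinh (l {a, b})" for a b
    by (simp_all only: insert_commute[of b a "{}"])
  show "phi l j i k h = phi l i j k h"
    unfolding phi_def Let_def c[of j i] by (simp only: ac_simps)
  show "phi l i j h k = phi l i j k h"
    unfolding phi_def Let_def c[of h k] by (simp only: ac_simps)
qed

lemma ext_dihedral_angle_eq:
  assumes "{i, j, k, h} = (UNIV :: 4 set)"
  shows "ext_dihedral_angle l {i, j} = arccos (max (-1) (min (phi l i j k h) 1))"
proof -
  have complement: "{c, d} = UNIV - {a, b}" if u: "{a, b, c, d} = UNIV" for a b c d :: 4
  proof -
    have "card (set [a, b, c, d]) = length [a, b, c, d]"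
      by (simp only: list.set u) simp
    then have "distinct [a, b, c, d]"
      by (rule card_distinct)
    then have "{c, d} = {a, b, c, d} - {a, b}"
      by auto
    then show ?thesis
      by (simp only: u)
  qed
  have "phi l i' j' k' h' = phi l i j k h"
    if e: "{i, j} = {i', j'}" and u: "{i', j', k', h'} = UNIV" for i' j' k' h'
  proof -
    have "{k, h} = {k', h'}"
      by (simp only: complement[OF assms] complement[OF u] e)
    with e have "(i' = i \<and> j' = j \<or> i' = j \<and> j' = i) \<and> (k' = k \<and> h' = h \<or> k' = h \<and> h' = k)"
      by (metis doubleton_eq_iff)
    then show ?thesis
      by (elim conjE disjE) (simp_all only: phi_swap)
  qed
  note unique = this
  show ?thesis
    unfolding ext_dihedral_angle_def
  proof (rule the_equality)
    show "\<exists>i' j' k' h'. {i, j} = {i', j'} \<and> {i', j', k', h'} = UNIV \<and>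
        arccos (max (-1) (min (phi l i j k h) 1)) = arccos (max (-1) (min (phi l i' j' k' h') 1))"
      using assms by (intro exI conjI) (rule refl, assumption, rule refl)
  qed (elim exE conjE, simp only: unique)
qed

section \<open>Curvatures, hyper-ideal metrics and the extended Ricci flow\<close>

definition hyper_ideal_metric :: "('t::finite) gluing \<Rightarrow> (('t \<times> 4 set) set \<Rightarrow> real) \<Rightarrow> bool" where
  "hyper_ideal_metric G l \<longleftrightarrow>
     pos_on_edges G l \<and> (\<forall>T. tet_lengths G l T \<in> hyper_ideal_lengths)"

definition ricci_curvature ::
    "('t::finite) gluing \<Rightarrow> (('t \<times> 4 set) set \<Rightarrow> real) \<Rightarrow> ('t \<times> 4 set) set \<Rightarrow> real" where
  "ricci_curvature G l e =
     2 * pi - (\<Sum>(T, \<epsilon>) | (T, \<epsilon>) \<in> tet_edges \<and> edge_proj G (T, \<epsilon>) = e.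
                 dihedral_angle (tet_lengths G l T) \<epsilon>)"

definition ext_ricci_curvature ::
    "('t::finite) gluing \<Rightarrow> (('t \<times> 4 set) set \<Rightarrow> real) \<Rightarrow> ('t \<times> 4 set) set \<Rightarrow> real" where
  "ext_ricci_curvature G l e =
     2 * pi - (\<Sum>(T, \<epsilon>) | (T, \<epsilon>) \<in> tet_edges \<and> edge_proj G (T, \<epsilon>) = e.
                 ext_dihedral_angle (tet_lengths G l T) \<epsilon>)"

definition zero_curvature_metric ::
    "('t::finite) gluing \<Rightarrow> (('t \<times> 4 set) set \<Rightarrow> real) \<Rightarrow> bool" where
  "zero_curvature_metric G l \<longleftrightarrow>
     hyper_ideal_metric G l \<and> (\<forall>e\<in>edges G. ricci_curvature G l e = 0)"

text \<open>At \<open>t = 0\<close> the derivative is one-sided.\<close>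

definition ext_ricci_flow ::
    "('t::finite) gluing \<Rightarrow> (('t \<times> 4 set) set \<Rightarrow> real) \<Rightarrow>
     (real \<Rightarrow> ('t \<times> 4 set) set \<Rightarrow> real) \<Rightarrow> bool" where
  "ext_ricci_flow G l0 l \<longleftrightarrow>
     (\<forall>e\<in>edges G. l 0 e = l0 e) \<and>
     (\<forall>t\<ge>0. pos_on_edges G (l t) \<and>
        (\<forall>e\<in>edges G. ((\<lambda>s. l s e) has_real_derivative
           ext_ricci_curvature G (l t) e * l t e) (at t within {0..})))"

definition flow_converges ::
    "('t::finite) gluing \<Rightarrow> (real \<Rightarrow> ('t \<times> 4 set) set \<Rightarrow> real) \<Rightarrow>
     (('t \<times> 4 set) set \<Rightarrow> real) \<Rightarrow> bool" where
  "flow_converges G l l_inf \<longleftrightarrow> (\<forall>e\<in>edges G. ((\<lambda>t. l t e) \<longlongrightarrow> l_inf e) at_top)"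

definition flow_converges_exp ::
    "('t::finite) gluing \<Rightarrow> (real \<Rightarrow> ('t \<times> 4 set) set \<Rightarrow> real) \<Rightarrow>
     (('t \<times> 4 set) set \<Rightarrow> real) \<Rightarrow> bool" where
  "flow_converges_exp G l l_inf \<longleftrightarrow> flow_converges G l l_inf \<and>
     (\<exists>A>0. \<exists>r>0. \<forall>t\<ge>0. L2_set (\<lambda>e. l t e - l_inf e) (edges G) \<le> A * exp (- r * t))"

end

theory Submission
  imports Defs "HOL-Complex_Analysis.Great_Picard"
begin

text \<open>
  On the six edge lengths of a tetrahedron the extended dihedral angles form a monotone vector
  field. Where the Gram determinant of the truncating planes is negative, their Jacobian is
  symmetric and positive definite: it is nondegenerate because the angles determine the lengths
  infinitesimally, this region is connected, and the Jacobian is positive definite at a regular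
  tetrahedron. Everywhere else all angles are 0 or \<open>\<pi>\<close>, so along a segment the pairing of the
  angles with its direction takes only finitely many values there and hence cannot decrease.
  Near a hyper-ideal \<open>l*\<close> the monotonicity is strict. If \<open>l*\<close> has zero curvature,
  \<open>\<Sum>\<^sub>e (l\<^sub>e - l*\<^sub>e - l*\<^sub>e ln (l\<^sub>e / l*\<^sub>e))\<close> is therefore a Lyapunov function that decays exponentially
  along every solution. Solutions exist for all time by Peano's theorem, since in the coordinates
  \<open>ln l\<close> the flow has a bounded continuous right-hand side. That a hyper-ideal tetrahedron has a
  negative Gram determinant and the stated dihedral angles follows by expressing its vertices in
  the hyperboloid model through the unit normals of its triangles.
\<close>

section \<open>The Jacobian of the dihedral angles\<close>

text \<open>No convexity of the set of hyper-ideal length vectors is at hand, so the segment from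
  \<open>l*\<close> to another positive vector may leave that set, and on its boundary
  \<open>arccos\<close> has infinite slope. The monotonicity argument thus has to cross a region
  without a Jacobian. It can, because one and the same polynomial \<open>gram\<close> decides for
  all six edges whether the cosine lies strictly between -1 and 1. The constant of strong
  monotonicity depends on how far \<open>l\<close> may be from \<open>l*\<close>. The flow is
  therefore estimated twice: at a single time any positive constant shows that the Lyapunov function
  does not increase, which confines the solution to a compact set of positive lengths; there one
  constant serves all times and gives the exponential rate. The infinite slope of
  \<open>arccos\<close> is also why existence rests on continuity alone; the decay estimate is
  proved for an arbitrary solution. For the converse direction, a positive limit of a solution must
  be a zero of the curvature, because its speed converges as well.\<close>

text \<open>
  Throughout, \<open>a, b, c, d, e, f\<close> belong to the edges 12, 13, 14, 23, 24, 34. With \<open>a = cosh l\<^sub>1\<^sub>2\<close>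
  etc., the outward unit normals of the four triangles have the Gram matrix \<open>G\<close> with diagonal
  entries 1 and off-diagonal entries \<open>- cosh l\<^sub>i\<^sub>j\<close>. Its principal 3-by-3 minors are the numbers
  \<open>- face_poly\<close>, its other cofactors are the numbers \<open>edge_poly\<close>, which are the numerators of the
  cosines of the dihedral angles, and \<open>det G = - gram\<close>.
\<close>

definition face_poly :: "real \<Rightarrow> real \<Rightarrow> real \<Rightarrow> real" where
  "face_poly p q r = 2 * p * q * r + p\<^sup>2 + q\<^sup>2 + r\<^sup>2 - 1"

definition edge_poly :: "real \<Rightarrow> real \<Rightarrow> real \<Rightarrow> real \<Rightarrow> real \<Rightarrow> real \<Rightarrow> real" where
  "edge_poly a b c d e f = b * c + d * e + a * b * e + a * c * d - (a\<^sup>2 - 1) * f"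

definition gram :: "real \<Rightarrow> real \<Rightarrow> real \<Rightarrow> real \<Rightarrow> real \<Rightarrow> real \<Rightarrow> real" where
  "gram a b c d e f = a\<^sup>2 + b\<^sup>2 + c\<^sup>2 + d\<^sup>2 + e\<^sup>2 + f\<^sup>2 - 1
     + 2 * (a * b * d + a * c * e + b * c * f + d * e * f)
     + 2 * (a * b * e * f + a * c * d * f + b * c * d * e)
     - (a * f)\<^sup>2 - (b * e)\<^sup>2 - (c * d)\<^sup>2"

text \<open>An instance of Jacobi's identity for complementary minors.\<close>

lemma gram_identity:
  "face_poly a b d * face_poly a c e - (edge_poly a b c d e f)\<^sup>2 = (a\<^sup>2 - 1) * gram a b c d e f"
  unfolding face_poly_def edge_poly_def gram_def by algebra

text \<open>The differential of \<open>face_poly\<close>; \<open>edge_diff\<close> below is that of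
  \<open>edge_poly\<close>. Being explicit polynomials, they keep the kernel computation purely
  algebraic; calculus enters with \<open>has_real_derivative_cos_angle\<close>.\<close>

definition face_diff :: "real \<Rightarrow> real \<Rightarrow> real \<Rightarrow> real \<Rightarrow> real \<Rightarrow> real \<Rightarrow> real" where
  "face_diff p q r x y z = 2 * (x * q * r + p * y * r + p * q * z + p * x + q * y + r * z)"

definition edge_diff :: "real \<Rightarrow> real \<Rightarrow> real \<Rightarrow> real \<Rightarrow> real \<Rightarrow> real \<Rightarrow>
    real \<Rightarrow> real \<Rightarrow> real \<Rightarrow> real \<Rightarrow> real \<Rightarrow> real \<Rightarrow> real" where
  "edge_diff a b c d e f x1 x2 x3 x4 x5 x6 =
    x2 * c + b * x3 + x4 * e + d * x5 + x1 * b * e + a * x2 * e + a * b * x5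
    + x1 * c * d + a * x3 * d + a * c * x4 - 2 * a * x1 * f - (a\<^sup>2 - 1) * x6"

text \<open>
  Up to the factor \<open>sinh a / sqrt gram\<close>, the derivative of the dihedral angle at the edge 12 in a
  direction in which \<open>a, \<dots>, f\<close> change at the rates \<open>x1, \<dots>, x6\<close> is \<open>jac_row\<close>. The six rows,
  obtained by permuting the vertices, form a symmetric matrix.
\<close>

definition diag_coeff :: "real \<Rightarrow> real \<Rightarrow> real \<Rightarrow> real \<Rightarrow> real \<Rightarrow> real \<Rightarrow> real" where
  "diag_coeff a b c d e f =
     (edge_poly a b c d e f * ((b * d + a) / face_poly a b d + (c * e + a) / face_poly a c e)
       - (b * e + c * d - 2 * a * f)) / (a\<^sup>2 - 1)"

definition jac_row :: "real \<Rightarrow> real \<Rightarrow> real \<Rightarrow> real \<Rightarrow> real \<Rightarrow> real \<Rightarrow>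
    real \<Rightarrow> real \<Rightarrow> real \<Rightarrow> real \<Rightarrow> real \<Rightarrow> real \<Rightarrow> real" where
  "jac_row a b c d e f x1 x2 x3 x4 x5 x6 = diag_coeff a b c d e f * x1 + x6
     - edge_poly d a e b f c / face_poly a b d * x2
     - edge_poly e a d c f b / face_poly a c e * x3
     - edge_poly b a c d f e / face_poly a b d * x4
     - edge_poly c a b e f d / face_poly a c e * x5"

text \<open>The quotient rule for the cosine \<open>n / (sqrt P * sqrt Q)\<close>: its derivative is
  the right-hand side divided by \<open>sqrt P * sqrt Q\<close>. Rewriting this numerator through
  cofactors exposes the entries that make the Jacobian symmetric.\<close>

lemma jac_row_edge_diff:
  assumes "face_poly a b d \<noteq> 0" "face_poly a c e \<noteq> 0" "a\<^sup>2 \<noteq> 1"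
  shows "- (a\<^sup>2 - 1) * jac_row a b c d e f x1 x2 x3 x4 x5 x6 =
    edge_diff a b c d e f x1 x2 x3 x4 x5 x6
    - edge_poly a b c d e f * (face_diff a b d x1 x2 x4 / (2 * face_poly a b d)
        + face_diff a c e x1 x3 x5 / (2 * face_poly a c e))"
proof -
  let ?n = "edge_poly a b c d e f" and ?P = "face_poly a b d" and ?Q = "face_poly a c e"
  \<comment> \<open>These four identities come from \<open>G C = det G\<close> with the cofactor
    matrix \<open>C\<close>: in column 4 or 3, the first two equations are solved for the entry in
    row 1 or row 2 by eliminating the other one.\<close>
  have i2: "(a\<^sup>2 - 1) * edge_poly d a e b f c = (c + a * e) * ?P - ?n * (b + a * d)"
    unfolding face_poly_def edge_poly_def by algebra
  have i3: "(a\<^sup>2 - 1) * edge_poly e a d c f b = (b + a * d) * ?Q - ?n * (c + a * e)"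
    unfolding face_poly_def edge_poly_def by algebra
  have i4: "(a\<^sup>2 - 1) * edge_poly b a c d f e = (e + a * c) * ?P - ?n * (d + a * b)"
    unfolding face_poly_def edge_poly_def by algebra
  have i5: "(a\<^sup>2 - 1) * edge_poly c a b e f d = (d + a * b) * ?Q - ?n * (e + a * c)"
    unfolding face_poly_def edge_poly_def by algebra
  have d: "(a\<^sup>2 - 1) * diag_coeff a b c d e f =
      ?n * ((b * d + a) / ?P + (c * e + a) / ?Q) - (b * e + c * d - 2 * a * f)"
    using assms(3) by (simp add: diag_coeff_def)
  have "(a\<^sup>2 - 1) * jac_row a b c d e f x1 x2 x3 x4 x5 x6 =
      (a\<^sup>2 - 1) * diag_coeff a b c d e f * x1 + (a\<^sup>2 - 1) * x6
      - (a\<^sup>2 - 1) * edge_poly d a e b f c / ?P * x2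
      - (a\<^sup>2 - 1) * edge_poly e a d c f b / ?Q * x3
      - (a\<^sup>2 - 1) * edge_poly b a c d f e / ?P * x4
      - (a\<^sup>2 - 1) * edge_poly c a b e f d / ?Q * x5"
    by (simp add: jac_row_def algebra_simps)
  also have "\<dots> = (?n * ((b * d + a) / ?P + (c * e + a) / ?Q) - (b * e + c * d - 2 * a * f)) * x1
      + (a\<^sup>2 - 1) * x6
      - ((c + a * e) - ?n * (b + a * d) / ?P) * x2
      - ((b + a * d) - ?n * (c + a * e) / ?Q) * x3
      - ((e + a * c) - ?n * (d + a * b) / ?P) * x4
      - ((d + a * b) - ?n * (e + a * c) / ?Q) * x5"
    unfolding d i2 i3 i4 i5 using assms(1,2) by (simp add: diff_divide_distrib)
  also have "\<dots> = - edge_diff a b c d e f x1 x2 x3 x4 x5 x6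
      + ?n * (face_diff a b d x1 x2 x4 / (2 * ?P) + face_diff a c e x1 x3 x5 / (2 * ?Q))"
    unfolding edge_diff_def face_diff_def
    by (simp add: add_divide_distrib algebra_simps)
  finally show ?thesis by (simp only: minus_mult_left[symmetric])
qed

text \<open>
  If the angles do not change, the cofactor matrix \<open>C\<close> changes by \<open>m C + C m\<close> with a diagonal matrix
  \<open>m\<close>. Differentiating \<open>G C = det G\<close> then yields \<open>dG = m G - G m\<close>, of which this is the first row.
\<close>

lemma kernel_row:
  fixes a b c d e f x1 x2 x3 x4 x5 x6 m1 m2 m3 m4 :: real
  defines "D \<equiv> gram a b c d e f"
  assumes "D \<noteq> 0"
   and f1: "face_diff d e f x4 x5 x6 = 2 * m1 * face_poly d e f"
   and f2: "face_diff b c f x2 x3 x6 = 2 * m2 * face_poly b c f"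
   and f3: "face_diff a c e x1 x3 x5 = 2 * m3 * face_poly a c e"
   and f4: "face_diff a b d x1 x2 x4 = 2 * m4 * face_poly a b d"
   and n34: "edge_diff f b d c e a x6 x2 x4 x3 x5 x1 = (m1 + m2) * edge_poly f b d c e a"
   and n24: "edge_diff e a d c f b x5 x1 x4 x3 x6 x2 = (m1 + m3) * edge_poly e a d c f b"
   and n23: "edge_diff d a e b f c x4 x1 x5 x2 x6 x3 = (m1 + m4) * edge_poly d a e b f c"
   and n14: "edge_diff c a b e f d x3 x1 x2 x5 x6 x4 = (m2 + m3) * edge_poly c a b e f d"
   and n13: "edge_diff b a c d f e x2 x1 x3 x4 x6 x5 = (m2 + m4) * edge_poly b a c d f e"
   and n12: "edge_diff a b c d e f x1 x2 x3 x4 x5 x6 = (m3 + m4) * edge_poly a b c d e f"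
  shows "x1 = a * (m1 - m2) \<and> x2 = b * (m1 - m3) \<and> x3 = c * (m1 - m4)"
proof -
  let ?h2 = "- x1 - a * m2" and ?h3 = "- x2 - b * m3" and ?h4 = "- x3 - c * m4"
  let ?C11 = "- face_poly d e f" and ?C22 = "- face_poly b c f"
   and ?C33 = "- face_poly a c e" and ?C44 = "- face_poly a b d"
   and ?C12 = "edge_poly f b d c e a" and ?C13 = "edge_poly e a d c f b"
   and ?C14 = "edge_poly d a e b f c" and ?C23 = "edge_poly c a b e f d"
   and ?C24 = "edge_poly b a c d f e" and ?C34 = "edge_poly a b c d e f"
  have r1: "?C12 - a * ?C22 - b * ?C23 - c * ?C24 = 0"
    and r2: "?C13 - a * ?C23 - b * ?C33 - c * ?C34 = 0"
    and r3: "?C14 - a * ?C24 - b * ?C34 - c * ?C44 = 0"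
    unfolding face_poly_def edge_poly_def by algebra+
  have d1: "edge_diff f b d c e a x6 x2 x4 x3 x5 x1 + x1 * face_poly b c f + a * face_diff b c f x2 x3 x6
      - x2 * ?C23 - b * edge_diff c a b e f d x3 x1 x2 x5 x6 x4
      - x3 * ?C24 - c * edge_diff b a c d f e x2 x1 x3 x4 x6 x5 = 0"
    unfolding face_poly_def edge_poly_def edge_diff_def face_diff_def by algebra
  have d2: "edge_diff e a d c f b x5 x1 x4 x3 x6 x2 - x1 * ?C23
      - a * edge_diff c a b e f d x3 x1 x2 x5 x6 x4 + x2 * face_poly a c e + b * face_diff a c e x1 x3 x5
      - x3 * ?C34 - c * edge_diff a b c d e f x1 x2 x3 x4 x5 x6 = 0"
    unfolding face_poly_def edge_poly_def edge_diff_def face_diff_def by algebra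
  have d3: "edge_diff d a e b f c x4 x1 x5 x2 x6 x3 - x1 * ?C24
      - a * edge_diff b a c d f e x2 x1 x3 x4 x6 x5 - x2 * ?C34
      - b * edge_diff a b c d e f x1 x2 x3 x4 x5 x6 + x3 * face_poly a b d + c * face_diff a b d x1 x2 x4 = 0"
    unfolding face_poly_def edge_poly_def edge_diff_def face_diff_def by algebra
  have h2: "m1 * ?C12 + ?h2 * ?C22 + ?h3 * ?C23 + ?h4 * ?C24 = 0"
    using d1 r1 unfolding f2 n34 n14 n13 by algebra
  have h3: "m1 * ?C13 + ?h2 * ?C23 + ?h3 * ?C33 + ?h4 * ?C34 = 0"
    using d2 r2 unfolding f3 n24 n14 n12 by algebra
  have h4: "m1 * ?C14 + ?h2 * ?C24 + ?h3 * ?C34 + ?h4 * ?C44 = 0"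
    using d3 r3 unfolding f4 n23 n13 n12 by algebra
  \<comment> \<open>The only entry of that row times \<open>C\<close> that may be nonzero.
    Multiplying back by \<open>G\<close>, where \<open>g1\<close> to \<open>g4\<close> say
    \<open>G C = - D\<close>, recovers the row as a multiple of the first row
    \<open>(1, -a, -b, -c)\<close> of \<open>G\<close>.\<close>
  define nu where "nu = m1 * ?C11 + ?h2 * ?C12 + ?h3 * ?C13 + ?h4 * ?C14"
  have g1: "?C11 - a * ?C12 - b * ?C13 - c * ?C14 = - D"
     "- a * ?C11 + ?C12 - d * ?C13 - e * ?C14 = 0"
     "- b * ?C11 - d * ?C12 + ?C13 - f * ?C14 = 0"
     "- c * ?C11 - e * ?C12 - f * ?C13 + ?C14 = 0"
    unfolding face_poly_def edge_poly_def D_def gram_def by algebra+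
  have g2: "?C12 - a * ?C22 - b * ?C23 - c * ?C24 = 0"
     "- a * ?C12 + ?C22 - d * ?C23 - e * ?C24 = - D"
     "- b * ?C12 - d * ?C22 + ?C23 - f * ?C24 = 0"
     "- c * ?C12 - e * ?C22 - f * ?C23 + ?C24 = 0"
    unfolding face_poly_def edge_poly_def D_def gram_def by algebra+
  have g3: "?C13 - a * ?C23 - b * ?C33 - c * ?C34 = 0"
     "- a * ?C13 + ?C23 - d * ?C33 - e * ?C34 = 0"
     "- b * ?C13 - d * ?C23 + ?C33 - f * ?C34 = - D"
     "- c * ?C13 - e * ?C23 - f * ?C33 + ?C34 = 0"
    unfolding face_poly_def edge_poly_def D_def gram_def by algebra+
  have g4: "?C14 - a * ?C24 - b * ?C34 - c * ?C44 = 0"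
     "- a * ?C14 + ?C24 - d * ?C34 - e * ?C44 = 0"
     "- b * ?C14 - d * ?C24 + ?C34 - f * ?C44 = 0"
     "- c * ?C14 - e * ?C24 - f * ?C34 + ?C44 = - D"
    unfolding face_poly_def edge_poly_def D_def gram_def by algebra+
  note gen = nu_def h2 h3 h4
  define h2' h3' h4' where h'_def: "h2' = ?h2" "h3' = ?h3" "h4' = ?h4"
  define C11 C22 C33 C44 C12 C13 C14 C23 C24 C34 where
    C_def: "C11 = ?C11" "C22 = ?C22" "C33 = ?C33" "C44 = ?C44" "C12 = ?C12" "C13 = ?C13"
      "C14 = ?C14" "C23 = ?C23" "C24 = ?C24" "C34 = ?C34"
  note folds = C_def[symmetric] h'_def[symmetric]
  note E = gen[unfolded folds] g1[unfolded folds] g2[unfolded folds] g3[unfolded folds] g4[unfolded folds]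
  have "nu = - D * m1"
  proof -
    have "nu = nu - a * 0 - b * 0 - c * 0" by simp
    also have "\<dots> = (m1 * C11 + h2' * C12 + h3' * C13 + h4' * C14)
       - a * (m1 * C12 + h2' * C22 + h3' * C23 + h4' * C24)
       - b * (m1 * C13 + h2' * C23 + h3' * C33 + h4' * C34)
       - c * (m1 * C14 + h2' * C24 + h3' * C34 + h4' * C44)"
      by (simp only: E(1)[symmetric] E(2-4))
    also have "\<dots> = m1 * (C11 - a * C12 - b * C13 - c * C14)
       + h2' * (C12 - a * C22 - b * C23 - c * C24)
       + h3' * (C13 - a * C23 - b * C33 - c * C34)
       + h4' * (C14 - a * C24 - b * C34 - c * C44)"
      by (simp add: algebra_simps)
    also have "\<dots> = - D * m1" using E by simp
    finally show ?thesis .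
  qed
  have "- a * nu = - D * h2'"
  proof -
    have "- a * nu = - a * nu + 0 - d * 0 - e * 0" by simp
    also have "\<dots> = - a * (m1 * C11 + h2' * C12 + h3' * C13 + h4' * C14)
       + (m1 * C12 + h2' * C22 + h3' * C23 + h4' * C24)
       - d * (m1 * C13 + h2' * C23 + h3' * C33 + h4' * C34)
       - e * (m1 * C14 + h2' * C24 + h3' * C34 + h4' * C44)"
      by (simp only: E(1)[symmetric] E(2-4))
    also have "\<dots> = m1 * (- a * C11 + C12 - d * C13 - e * C14)
       + h2' * (- a * C12 + C22 - d * C23 - e * C24)
       + h3' * (- a * C13 + C23 - d * C33 - e * C34)
       + h4' * (- a * C14 + C24 - d * C34 - e * C44)"
      by (simp add: algebra_simps)
    also have "\<dots> = - D * h2'" using E by simp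
    finally show ?thesis .
  qed
  moreover have "- b * nu = - D * h3'"
  proof -
    have "- b * nu = - b * nu - d * 0 + 0 - f * 0" by simp
    also have "\<dots> = - b * (m1 * C11 + h2' * C12 + h3' * C13 + h4' * C14)
       - d * (m1 * C12 + h2' * C22 + h3' * C23 + h4' * C24)
       + (m1 * C13 + h2' * C23 + h3' * C33 + h4' * C34)
       - f * (m1 * C14 + h2' * C24 + h3' * C34 + h4' * C44)"
      by (simp only: E(1)[symmetric] E(2-4))
    also have "\<dots> = m1 * (- b * C11 - d * C12 + C13 - f * C14)
       + h2' * (- b * C12 - d * C22 + C23 - f * C24)
       + h3' * (- b * C13 - d * C23 + C33 - f * C34)
       + h4' * (- b * C14 - d * C24 + C34 - f * C44)"
      by (simp add: algebra_simps)
    also have "\<dots> = - D * h3'" using E by simp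
    finally show ?thesis .
  qed
  moreover have "- c * nu = - D * h4'"
  proof -
    have "- c * nu = - c * nu - e * 0 - f * 0 + 0" by simp
    also have "\<dots> = - c * (m1 * C11 + h2' * C12 + h3' * C13 + h4' * C14)
       - e * (m1 * C12 + h2' * C22 + h3' * C23 + h4' * C24)
       - f * (m1 * C13 + h2' * C23 + h3' * C33 + h4' * C34)
       + (m1 * C14 + h2' * C24 + h3' * C34 + h4' * C44)"
      by (simp only: E(1)[symmetric] E(2-4))
    also have "\<dots> = m1 * (- c * C11 - e * C12 - f * C13 + C14)
       + h2' * (- c * C12 - e * C22 - f * C23 + C24)
       + h3' * (- c * C13 - e * C23 - f * C33 + C34)
       + h4' * (- c * C14 - e * C24 - f * C34 + C44)"
      by (simp add: algebra_simps)
    also have "\<dots> = - D * h4'" using E by simp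
    finally show ?thesis .
  qed
  ultimately have "D * (h2' + a * m1) = 0" "D * (h3' + b * m1) = 0" "D * (h4' + c * m1) = 0"
    using \<open>nu = - D * m1\<close> by (simp_all add: algebra_simps)
  then have "h2' = - a * m1" "h3' = - b * m1" "h4' = - c * m1"
    using \<open>D \<noteq> 0\<close> by (simp_all add: eq_neg_iff_add_eq_0)
  then show ?thesis unfolding h'_def by (auto simp: algebra_simps)
qed

section \<open>Relabelling of the vertices, and triviality of the kernel\<close>

lemma face_poly_perm:
  "face_poly q p r = face_poly p q r" "face_poly p r q = face_poly p q r"
  "face_poly q r p = face_poly p q r" "face_poly r p q = face_poly p q r"
  "face_poly r q p = face_poly p q r"
  by (simp_all add: face_poly_def algebra_simps)

lemma edge_poly_perm:
  "edge_poly a d e b c f = edge_poly a b c d e f"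
  "edge_poly a c b e d f = edge_poly a b c d e f"
  "edge_poly a e d c b f = edge_poly a b c d e f"
  by (simp_all add: edge_poly_def algebra_simps)

lemma face_diff_perm:
  "face_diff q p r y x z = face_diff p q r x y z" "face_diff p r q x z y = face_diff p q r x y z"
  "face_diff q r p y z x = face_diff p q r x y z" "face_diff r p q z x y = face_diff p q r x y z"
  "face_diff r q p z y x = face_diff p q r x y z"
  by (simp_all add: face_diff_def algebra_simps)

lemma edge_diff_perm:
  "edge_diff a d e b c f x1 x4 x5 x2 x3 x6 = edge_diff a b c d e f x1 x2 x3 x4 x5 x6"
  "edge_diff a c b e d f x1 x3 x2 x5 x4 x6 = edge_diff a b c d e f x1 x2 x3 x4 x5 x6"
  "edge_diff a e d c b f x1 x5 x4 x3 x2 x6 = edge_diff a b c d e f x1 x2 x3 x4 x5 x6"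
  by (simp_all add: edge_diff_def algebra_simps)

text \<open>For symmetric \<open>G\<close> and diagonal \<open>m\<close> the matrix
  \<open>m G - G m\<close> is antisymmetric, whereas \<open>dG\<close> is symmetric; so
  \<open>dG = m G - G m\<close> forces both to vanish.\<close>

lemma kernel_trivial:
  fixes a b c d e f x1 x2 x3 x4 x5 x6 :: real
  assumes "gram a b c d e f \<noteq> 0"
   and f: "face_poly d e f \<noteq> 0" "face_poly b c f \<noteq> 0" "face_poly a c e \<noteq> 0" "face_poly a b d \<noteq> 0"
   and s: "a\<^sup>2 \<noteq> 1" "b\<^sup>2 \<noteq> 1" "c\<^sup>2 \<noteq> 1" "d\<^sup>2 \<noteq> 1" "e\<^sup>2 \<noteq> 1" "f\<^sup>2 \<noteq> 1"
   and r: "jac_row a b c d e f x1 x2 x3 x4 x5 x6 = 0" "jac_row b a c d f e x2 x1 x3 x4 x6 x5 = 0"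
     "jac_row c a b e f d x3 x1 x2 x5 x6 x4 = 0" "jac_row d a e b f c x4 x1 x5 x2 x6 x3 = 0"
     "jac_row e a d c f b x5 x1 x4 x3 x6 x2 = 0" "jac_row f b d c e a x6 x2 x4 x3 x5 x1 = 0"
  shows "x1 = 0 \<and> x2 = 0 \<and> x3 = 0 \<and> x4 = 0 \<and> x5 = 0 \<and> x6 = 0"
proof -
  \<comment> \<open>Half the logarithmic derivatives of the diagonal cofactors, as required by
    \<open>dC = m C + C m\<close> on the diagonal.\<close>
  define m1 where "m1 = face_diff d e f x4 x5 x6 / (2 * face_poly d e f)"
  define m2 where "m2 = face_diff b c f x2 x3 x6 / (2 * face_poly b c f)"
  define m3 where "m3 = face_diff a c e x1 x3 x5 / (2 * face_poly a c e)"
  define m4 where "m4 = face_diff a b d x1 x2 x4 / (2 * face_poly a b d)"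
  have f1: "face_diff d e f x4 x5 x6 = 2 * m1 * face_poly d e f"
   and f2: "face_diff b c f x2 x3 x6 = 2 * m2 * face_poly b c f"
   and f3: "face_diff a c e x1 x3 x5 = 2 * m3 * face_poly a c e"
   and f4: "face_diff a b d x1 x2 x4 = 2 * m4 * face_poly a b d"
    using f by (simp_all add: m1_def m2_def m3_def m4_def)
  note fp = face_poly_perm
  have n12: "edge_diff a b c d e f x1 x2 x3 x4 x5 x6 = (m3 + m4) * edge_poly a b c d e f"
    using jac_row_edge_diff[of a b d c e f x1 x2 x3 x4 x5 x6] f s r(1)
    by (simp add: f3 f4 algebra_simps)
  have n13: "edge_diff b a c d f e x2 x1 x3 x4 x6 x5 = (m2 + m4) * edge_poly b a c d f e"
    using jac_row_edge_diff[of b a d c f e x2 x1 x3 x4 x6 x5] f s r(2)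
    by (simp add: fp(1)[of b a d] face_diff_perm(1)[of b a d] f2 f4 algebra_simps)
  have n14: "edge_diff c a b e f d x3 x1 x2 x5 x6 x4 = (m2 + m3) * edge_poly c a b e f d"
    using jac_row_edge_diff[of c a e b f d x3 x1 x2 x5 x6 x4] f s r(3)
    by (simp add: fp(1)[of c a e] fp(1)[of c b f] face_diff_perm(1)[of c a e] face_diff_perm(1)[of c b f] f2 f3 algebra_simps)
  have n23: "edge_diff d a e b f c x4 x1 x5 x2 x6 x3 = (m1 + m4) * edge_poly d a e b f c"
    using jac_row_edge_diff[of d a b e f c x4 x1 x5 x2 x6 x3] f s r(4)
    by (simp add: fp(4)[of d a b] face_diff_perm(4)[of d a b] f1 f4 algebra_simps)
  have n24: "edge_diff e a d c f b x5 x1 x4 x3 x6 x2 = (m1 + m3) * edge_poly e a d c f b"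
    using jac_row_edge_diff[of e a c d f b x5 x1 x4 x3 x6 x2] f s r(5)
    by (simp add: fp(4)[of e a c] fp(1)[of e d f] face_diff_perm(4)[of e a c] face_diff_perm(1)[of e d f] f1 f3 algebra_simps)
  have n34: "edge_diff f b d c e a x6 x2 x4 x3 x5 x1 = (m1 + m2) * edge_poly f b d c e a"
    using jac_row_edge_diff[of f b c d e a x6 x2 x4 x3 x5 x1] f s r(6)
    by (simp add: fp(4)[of f b c] fp(4)[of f d e] face_diff_perm(4)[of f b c] face_diff_perm(4)[of f d e] f1 f2 algebra_simps)
  have g: "gram a d e b c f = gram a b c d e f" "gram d b f a e c = gram a b c d e f"
    "gram e f c d a b = gram a b c d e f"
    by (simp_all add: gram_def algebra_simps power_mult_distrib)
  have k1: "x1 = a * (m1 - m2) \<and> x2 = b * (m1 - m3) \<and> x3 = c * (m1 - m4)"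
    by (rule kernel_row[OF assms(1) f1 f2 f3 f4 n34 n24 n23 n14 n13 n12])
  \<comment> \<open>The facts \<open>k2\<close>, \<open>k3\<close> and \<open>k4\<close> are the
    same first row after exchanging vertex 1 with vertex 2, 3 and 4. Each edge is then described
    from both of its ends, with opposite signs.\<close>
  have k2: "x1 = a * (m2 - m1) \<and> x4 = d * (m2 - m3) \<and> x5 = e * (m2 - m4)"
  proof (rule kernel_row)
    show "gram a d e b c f \<noteq> 0" using assms(1) by (simp only: g(1) not_False_eq_True)
    show "face_diff b c f x2 x3 x6 = 2 * m2 * face_poly b c f"
      by (simp only: f2)
    show "face_diff d e f x4 x5 x6 = 2 * m1 * face_poly d e f"
      by (simp only: f1)
    show "face_diff a e c x1 x5 x3 = 2 * m3 * face_poly a e c"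
      by (simp only: f3 face_poly_perm(2)[of a e c] face_diff_perm(2)[of a e c x1 x5 x3])
    show "face_diff a d b x1 x4 x2 = 2 * m4 * face_poly a d b"
      by (simp only: f4 face_poly_perm(2)[of a d b] face_diff_perm(2)[of a d b x1 x4 x2])
    show "edge_diff f d b e c a x6 x4 x2 x5 x3 x1 = (m2 + m1) * edge_poly f d b e c a"
      by (simp only: n34 add.commute edge_poly_perm(2)[of f d b e c a] edge_diff_perm(2)[of f d b e c a x6 x4 x2 x5 x3 x1])
    show "edge_diff c a b e f d x3 x1 x2 x5 x6 x4 = (m2 + m3) * edge_poly c a b e f d"
      by (simp only: n14 add.commute)
    show "edge_diff b a c d f e x2 x1 x3 x4 x6 x5 = (m2 + m4) * edge_poly b a c d f e"
      by (simp only: n13 add.commute)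
    show "edge_diff e a d c f b x5 x1 x4 x3 x6 x2 = (m1 + m3) * edge_poly e a d c f b"
      by (simp only: n24 add.commute)
    show "edge_diff d a e b f c x4 x1 x5 x2 x6 x3 = (m1 + m4) * edge_poly d a e b f c"
      by (simp only: n23 add.commute)
    show "edge_diff a d e b c f x1 x4 x5 x2 x3 x6 = (m3 + m4) * edge_poly a d e b c f"
      by (simp only: n12 add.commute edge_poly_perm(1)[of a d e b c f] edge_diff_perm(1)[of a d e b c f x1 x4 x5 x2 x3 x6])
  qed
  have k3: "x4 = d * (m3 - m2) \<and> x2 = b * (m3 - m1) \<and> x6 = f * (m3 - m4)"
  proof (rule kernel_row)
    show "gram d b f a e c \<noteq> 0" using assms(1) by (simp only: g(2) not_False_eq_True)
    show "face_diff a e c x1 x5 x3 = 2 * m3 * face_poly a e c"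
      by (simp only: f3 face_poly_perm(2)[of a e c] face_diff_perm(2)[of a e c x1 x5 x3])
    show "face_diff b f c x2 x6 x3 = 2 * m2 * face_poly b f c"
      by (simp only: f2 face_poly_perm(2)[of b f c] face_diff_perm(2)[of b f c x2 x6 x3])
    show "face_diff d f e x4 x6 x5 = 2 * m1 * face_poly d f e"
      by (simp only: f1 face_poly_perm(2)[of d f e] face_diff_perm(2)[of d f e x4 x6 x5])
    show "face_diff d b a x4 x2 x1 = 2 * m4 * face_poly d b a"
      by (simp only: f4 face_poly_perm(5)[of d b a] face_diff_perm(5)[of d b a x4 x2 x1])
    show "edge_diff c b a f e d x3 x2 x1 x6 x5 x4 = (m3 + m2) * edge_poly c b a f e d"
      by (simp only: n14 add.commute edge_poly_perm(2)[of c b a f e d] edge_diff_perm(2)[of c b a f e d x3 x2 x1 x6 x5 x4])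
    show "edge_diff e d a f c b x5 x4 x1 x6 x3 x2 = (m3 + m1) * edge_poly e d a f c b"
      by (simp only: n24 add.commute edge_poly_perm(2)[of e d a f c b] edge_diff_perm(2)[of e d a f c b x5 x4 x1 x6 x3 x2])
    show "edge_diff a d e b c f x1 x4 x5 x2 x3 x6 = (m3 + m4) * edge_poly a d e b c f"
      by (simp only: n12 add.commute edge_poly_perm(1)[of a d e b c f] edge_diff_perm(1)[of a d e b c f x1 x4 x5 x2 x3 x6])
    show "edge_diff f d b e c a x6 x4 x2 x5 x3 x1 = (m2 + m1) * edge_poly f d b e c a"
      by (simp only: n34 add.commute edge_poly_perm(2)[of f d b e c a] edge_diff_perm(2)[of f d b e c a x6 x4 x2 x5 x3 x1])
    show "edge_diff b d f a c e x2 x4 x6 x1 x3 x5 = (m2 + m4) * edge_poly b d f a c e"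
      by (simp only: n13 add.commute edge_poly_perm(1)[of b d f a c e] edge_diff_perm(1)[of b d f a c e x2 x4 x6 x1 x3 x5])
    show "edge_diff d b f a e c x4 x2 x6 x1 x5 x3 = (m1 + m4) * edge_poly d b f a e c"
      by (simp only: n23 add.commute edge_poly_perm(1)[of d b f a e c] edge_diff_perm(1)[of d b f a e c x4 x2 x6 x1 x5 x3])
  qed
  have k4: "x5 = e * (m4 - m2) \<and> x6 = f * (m4 - m3) \<and> x3 = c * (m4 - m1)"
  proof (rule kernel_row)
    show "gram e f c d a b \<noteq> 0" using assms(1) by (simp only: g(3) not_False_eq_True)
    show "face_diff d a b x4 x1 x2 = 2 * m4 * face_poly d a b"
      by (simp only: f4 face_poly_perm(4)[of d a b] face_diff_perm(4)[of d a b x4 x1 x2])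
    show "face_diff f c b x6 x3 x2 = 2 * m2 * face_poly f c b"
      by (simp only: f2 face_poly_perm(5)[of f c b] face_diff_perm(5)[of f c b x6 x3 x2])
    show "face_diff e c a x5 x3 x1 = 2 * m3 * face_poly e c a"
      by (simp only: f3 face_poly_perm(5)[of e c a] face_diff_perm(5)[of e c a x5 x3 x1])
    show "face_diff e f d x5 x6 x4 = 2 * m1 * face_poly e f d"
      by (simp only: f1 face_poly_perm(3)[of e f d] face_diff_perm(3)[of e f d x5 x6 x4])
    show "edge_diff b f d c a e x2 x6 x4 x3 x1 x5 = (m4 + m2) * edge_poly b f d c a e"
      by (simp only: n13 add.commute edge_poly_perm(3)[of b f d c a e] edge_diff_perm(3)[of b f d c a e x2 x6 x4 x3 x1 x5])
    show "edge_diff a e d c b f x1 x5 x4 x3 x2 x6 = (m4 + m3) * edge_poly a e d c b f"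
      by (simp only: n12 add.commute edge_poly_perm(3)[of a e d c b f] edge_diff_perm(3)[of a e d c b f x1 x5 x4 x3 x2 x6])
    show "edge_diff d e a f b c x4 x5 x1 x6 x2 x3 = (m4 + m1) * edge_poly d e a f b c"
      by (simp only: n23 add.commute edge_poly_perm(2)[of d e a f b c] edge_diff_perm(2)[of d e a f b c x4 x5 x1 x6 x2 x3])
    show "edge_diff c e f a b d x3 x5 x6 x1 x2 x4 = (m2 + m3) * edge_poly c e f a b d"
      by (simp only: n14 add.commute edge_poly_perm(1)[of c e f a b d] edge_diff_perm(1)[of c e f a b d x3 x5 x6 x1 x2 x4])
    show "edge_diff f e c d b a x6 x5 x3 x4 x2 x1 = (m2 + m1) * edge_poly f e c d b a"
      by (simp only: n34 add.commute edge_poly_perm(3)[of f e c d b a] edge_diff_perm(3)[of f e c d b a x6 x5 x3 x4 x2 x1])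
    show "edge_diff e f c d a b x5 x6 x3 x4 x1 x2 = (m3 + m1) * edge_poly e f c d a b"
      by (simp only: n24 add.commute edge_poly_perm(3)[of e f c d a b] edge_diff_perm(3)[of e f c d a b x5 x6 x3 x4 x1 x2])
  qed
  have z: "y = 0" if "y = p * (u - v)" "y = p * (v - u)" for y p u v :: real
    using that by (simp add: right_diff_distrib)
  show ?thesis
    using z[of x1 a m1 m2] z[of x2 b m1 m3] z[of x3 c m1 m4] z[of x4 d m2 m3] z[of x5 e m2 m4]
      z[of x6 f m3 m4] k1 k2 k3 k4 by blast
qed

section \<open>Families of quadratic forms\<close>

text \<open>By compactness of the unit sphere, half the minimum of the form at \<open>p0\<close>
  remains a lower bound for all nearby parameters; homogeneity carries it to all vectors. The
  uniform \<open>k\<close> later becomes the constant of strong monotonicity.\<close>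

lemma pos_def_near:
  fixes Q :: "'p::metric_space \<Rightarrow> 'v::euclidean_space \<Rightarrow> real"
  assumes cont: "continuous_on (S \<times> UNIV) (\<lambda>(p, x). Q p x)"
    and hom: "\<And>p r x. Q p (r *\<^sub>R x) = r\<^sup>2 * Q p x"
    and p0: "p0 \<in> S" and pd: "\<And>x. x \<noteq> 0 \<Longrightarrow> Q p0 x > 0"
  shows "\<exists>k>0. \<exists>r>0. \<forall>p\<in>S. dist p p0 < r \<longrightarrow> (\<forall>x. Q p x \<ge> k * (norm x)\<^sup>2)"
proof -
  have comp: "compact (sphere (0::'v) 1)" and ne: "sphere (0::'v) 1 \<noteq> {}"
    by auto
  have c0: "continuous_on (sphere 0 1) (Q p0)"
    by (rule continuous_on_compose2[OF cont, where f = "\<lambda>x. (p0, x)", simplified])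
       (use p0 in \<open>auto intro!: continuous_intros\<close>)
  from continuous_attains_inf[OF comp ne c0] obtain z where
    z: "z \<in> sphere 0 1" "\<And>y. y \<in> sphere 0 1 \<Longrightarrow> Q p0 z \<le> Q p0 y" by blast
  define m where "m = Q p0 z"
  have m: "m > 0" unfolding m_def using z(1) by (intro pd) auto
  have "\<exists>r>0. \<forall>p\<in>S. dist p p0 < r \<longrightarrow> (\<forall>x\<in>sphere 0 1. Q p x \<ge> m / 2)"
  proof (rule ccontr)
    assume neg: "\<not> ?thesis"
    have "\<exists>p x. p \<in> S \<and> dist p p0 < inverse (real (Suc n)) \<and> x \<in> sphere 0 1 \<and> Q p x < m / 2" for n
    proof -
      have "inverse (real (Suc n)) > 0" by simp
      with neg obtain p where "p \<in> S" "dist p p0 < inverse (real (Suc n))"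
        "\<exists>x\<in>sphere 0 1. \<not> Q p x \<ge> m / 2" by blast
      then show ?thesis unfolding not_le by blast
    qed
    then obtain p x where px: "\<And>n. p n \<in> S" "\<And>n. dist (p n) p0 < inverse (real (Suc n))"
      "\<And>n. x n \<in> sphere 0 1" "\<And>n. Q (p n) (x n) < m / 2" by metis
    obtain y k where y: "y \<in> sphere (0::'v) 1" "strict_mono (k :: nat \<Rightarrow> nat)" "(x \<circ> k) \<longlonglongrightarrow> y"
      using compact_imp_seq_compact[OF comp] px(3) by (metis seq_compactE)
    have "p \<longlonglongrightarrow> p0"
      by (rule metric_tendsto_imp_tendsto[where f = "\<lambda>n. inverse (real (Suc n))" and a = 0])
         (use LIMSEQ_inverse_real_of_nat px(2) in \<open>auto intro!: always_eventually less_imp_le\<close>)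
    then have "(p \<circ> k) \<longlonglongrightarrow> p0" using y(2) by (rule LIMSEQ_subseq_LIMSEQ)
    then have "(\<lambda>n. ((p \<circ> k) n, (x \<circ> k) n)) \<longlonglongrightarrow> (p0, y)" using y(3) by (rule tendsto_Pair)
    then have "(\<lambda>n. (\<lambda>(p, x). Q p x) ((p \<circ> k) n, (x \<circ> k) n)) \<longlonglongrightarrow> (\<lambda>(p, x). Q p x) (p0, y)"
      by (rule continuous_on_tendsto_compose[OF cont]) (use p0 px in auto)
    then have "Q p0 y \<le> m / 2"
      by (intro LIMSEQ_le_const2) (use px(4) in \<open>auto intro!: less_imp_le\<close>)
    with z(2)[OF y(1)] m show False unfolding m_def by simp
  qed
  then obtain r where r: "r > 0" "\<And>p x. p \<in> S \<Longrightarrow> dist p p0 < r \<Longrightarrow> x \<in> sphere 0 1 \<Longrightarrow> Q p x \<ge> m / 2"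
    by blast
  have "Q p x \<ge> m / 2 * (norm x)\<^sup>2" if "p \<in> S" "dist p p0 < r" for p x
  proof (cases "x = 0")
    case True
    then show ?thesis using hom[of p 0 x] by simp
  next
    case False
    then have "m / 2 \<le> Q p ((1 / norm x) *\<^sub>R x)" by (intro r(2) that) simp
    also have "\<dots> = Q p x / (norm x)\<^sup>2" by (simp add: hom power_divide)
    finally show ?thesis using False by (simp add: field_simps)
  qed
  then show ?thesis using m r(1) by (intro exI[of _ "m / 2"]) auto
qed

text \<open>Positive definiteness cannot be lost without passing through a degenerate form.\<close>

lemma pos_def_connected:
  fixes Q :: "'p::metric_space \<Rightarrow> 'v::euclidean_space \<Rightarrow> real"
  assumes conn: "connected S" and cont: "continuous_on (S \<times> UNIV) (\<lambda>(p, x). Q p x)"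
    and hom: "\<And>p r x. Q p (r *\<^sub>R x) = r\<^sup>2 * Q p x"
    and nondeg: "\<And>p x. p \<in> S \<Longrightarrow> (\<And>y. Q p y \<ge> 0) \<Longrightarrow> Q p x = 0 \<Longrightarrow> x = 0"
    and p0: "p0 \<in> S" "\<And>x. x \<noteq> 0 \<Longrightarrow> Q p0 x > 0"
    and p: "p \<in> S" "x \<noteq> 0"
  shows "Q p x > 0"
proof -
  define T where "T = {p \<in> S. \<forall>x. x \<noteq> 0 \<longrightarrow> Q p x > 0}"
  \<comment> \<open>Strict positivity gives openness of \<open>T\<close>, the weak inequality gives
    closedness; nondegeneracy at semidefinite points is exactly what makes the two descriptions
    agree.\<close>
  have T_eq: "T = {p \<in> S. \<forall>x. Q p x \<ge> 0}"
  proof -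
    have Q0: "Q p 0 = 0" for p using hom[of p 0 0] by simp
    have "(\<forall>x. x \<noteq> 0 \<longrightarrow> Q p x > 0) \<longleftrightarrow> (\<forall>x. Q p x \<ge> 0)" if "p \<in> S" for p
      using nondeg[OF that] Q0[of p] by (metis less_le order_refl)
    then show ?thesis unfolding T_def by blast
  qed
  have "openin (top_of_set S) T"
  proof (subst openin_euclidean_subtopology_iff, intro conjI ballI)
    show "T \<subseteq> S" by (auto simp: T_def)
    fix q assume "q \<in> T"
    then have "q \<in> S" "\<And>x. x \<noteq> 0 \<Longrightarrow> Q q x > 0" by (auto simp: T_def)
    from pos_def_near[OF cont hom this] obtain k r where kr:
      "k > 0" "r > 0" "\<And>p x. p \<in> S \<Longrightarrow> dist p q < r \<Longrightarrow> Q p x \<ge> k * (norm x)\<^sup>2"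
      by blast
    have "Q p x > 0" if "p \<in> S" "dist p q < r" "x \<noteq> 0" for p x
    proof -
      have "0 < k * (norm x)\<^sup>2" using kr(1) that(3) by simp
      also have "\<dots> \<le> Q p x" by (intro kr(3) that)
      finally show ?thesis .
    qed
    with kr(2) show "\<exists>e>0. \<forall>x'\<in>S. dist x' q < e \<longrightarrow> x' \<in> T"
      by (auto simp: T_def)
  qed
  moreover have "closedin (top_of_set S) T"
  proof -
    have "closedin (top_of_set S) {p \<in> S. Q p x \<in> {0..}}" for x
    proof -
      have "continuous_on S (\<lambda>p. Q p x)"
        by (rule continuous_on_compose2[OF cont, where f = "\<lambda>p. (p, x)", simplified])
           (auto intro!: continuous_intros)
      from continuous_closedin_preimage[OF this, of "{0..}"] show ?thesis
        by (simp add: vimage_def Int_def conj_commute)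
    qed
    then have "closedin (top_of_set S) (\<Inter>x. {p \<in> S. Q p x \<in> {0..}})" by (intro closedin_Inter) auto
    moreover have "(\<Inter>x. {p \<in> S. Q p x \<in> {0..}}) = T" unfolding T_eq by auto
    ultimately show ?thesis by simp
  qed
  ultimately have "T = {} \<or> T = S" using conn by (simp add: connected_clopen)
  moreover have "p0 \<in> T" using p0 by (auto simp: T_def)
  ultimately show ?thesis using p by (auto simp: T_def)
qed

text \<open>The first-order condition at a minimum: a semidefinite form that vanishes at a point has
  vanishing gradient there.\<close>

lemma linear_coeff_zero:
  fixes r w :: real
  assumes "\<And>t. 0 \<le> 2 * t * r + t\<^sup>2 * w"
  shows "r = 0"
proof (rule ccontr)
  assume r: "r \<noteq> 0"
  \<comment> \<open>The minimiser of the majorant in which \<open>w\<close> is replaced by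
    \<open>\<bar>w\<bar> + 1\<close>; the added 1 keeps the leading coefficient positive.\<close>
  define t where "t = - r / (\<bar>w\<bar> + 1)"
  have "0 \<le> 2 * t * r + t\<^sup>2 * w" by fact
  also have "\<dots> \<le> 2 * t * r + t\<^sup>2 * (\<bar>w\<bar> + 1)"
    by (intro add_left_mono mult_left_mono) auto
  also have "\<dots> = - r\<^sup>2 / (\<bar>w\<bar> + 1)"
  proof -
    have w: "\<bar>w\<bar> + 1 \<noteq> 0" by linarith
    have "2 * t * r + t\<^sup>2 * (\<bar>w\<bar> + 1) = t * (2 * r + t * (\<bar>w\<bar> + 1))"
      by (simp add: power2_eq_square algebra_simps)
    also have "t * (\<bar>w\<bar> + 1) = - r" using w by (simp add: t_def)
    finally show ?thesis using w by (simp add: t_def power2_eq_square)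
  qed
  also have "\<dots> < 0" using r by (simp add: divide_less_0_iff)
  finally show False by simp
qed

section \<open>Positive definiteness of the Jacobian\<close>

type_synonym real6 = "real \<times> real \<times> real \<times> real \<times> real \<times> real"

text \<open>The vector \<open>x\<close> holds rates of change of the hyperbolic cosines, not of the
  lengths; \<open>sinh6\<close> converts between the two. The common positive factor
  \<open>1 / sqrt gram\<close> is left out.\<close>

definition jac_form :: "real6 \<Rightarrow> real6 \<Rightarrow> real" where
  "jac_form = (\<lambda>(a, b, c, d, e, f) (x1, x2, x3, x4, x5, x6).
     x1 * jac_row a b c d e f x1 x2 x3 x4 x5 x6 + x2 * jac_row b a c d f e x2 x1 x3 x4 x6 x5 +
     x3 * jac_row c a b e f d x3 x1 x2 x5 x6 x4 + x4 * jac_row d a e b f c x4 x1 x5 x2 x6 x3 +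
     x5 * jac_row e a d c f b x5 x1 x4 x3 x6 x2 + x6 * jac_row f b d c e a x6 x2 x4 x3 x5 x1)"

lemma jac_form_scale: "jac_form p (r *\<^sub>R x) = r\<^sup>2 * jac_form p x"
  by (cases p, cases x) (simp add: jac_form_def jac_row_def algebra_simps power2_eq_square)

definition admissible :: "real6 set" where
  "admissible = {(a, b, c, d, e, f). a > 1 \<and> b > 1 \<and> c > 1 \<and> d > 1 \<and> e > 1 \<and> f > 1 \<and>
     gram a b c d e f > 0}"

lemma face_poly_gt:
  assumes "p > 1" "q > 1" "r > 1"
  shows "face_poly p q r > p\<^sup>2 - 1" "face_poly p q r > 0"
proof -
  have "0 < 2 * p * q * r + q\<^sup>2 + r\<^sup>2" using assms by (intro add_pos_pos mult_pos_pos) auto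
  then show "face_poly p q r > p\<^sup>2 - 1" by (simp add: face_poly_def)
  moreover have "p\<^sup>2 > 1" using assms by (simp add: power_strict_increasing one_less_power)
  ultimately show "face_poly p q r > 0" by linarith
qed

text \<open>A zero of a nonnegative form is a minimum, so its gradient vanishes. By symmetry the
  gradient is twice the vector of rows, and the rows have no common kernel.\<close>

lemma jac_form_nondegenerate:
  assumes p: "p \<in> admissible" and nn: "\<And>y. jac_form p y \<ge> 0" and z: "jac_form p x = 0"
  shows "x = 0"
proof -
  obtain a b c d e f where pe: "p = (a, b, c, d, e, f)" by (cases p)
  obtain x1 x2 x3 x4 x5 x6 where xe: "x = (x1, x2, x3, x4, x5, x6)" by (cases x)
  have gt: "a > 1" "b > 1" "c > 1" "d > 1" "e > 1" "f > 1" "gram a b c d e f > 0"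
    using p by (auto simp: admissible_def pe)
  define E12 E13 E14 E23 E24 E34 where E:
    "E12 = edge_poly a b c d e f" "E13 = edge_poly b a c d f e" "E14 = edge_poly c a b e f d"
    "E23 = edge_poly d a e b f c" "E24 = edge_poly e a d c f b" "E34 = edge_poly f b d c e a"
  define F1 F2 F3 F4 where F: "F1 = face_poly d e f" "F2 = face_poly b c f"
    "F3 = face_poly a c e" "F4 = face_poly a b d"
  define D1 D2 D3 D4 D5 D6 where D: "D1 = diag_coeff a b c d e f" "D2 = diag_coeff b a c d f e"
    "D3 = diag_coeff c a b e f d" "D4 = diag_coeff d a e b f c" "D5 = diag_coeff e a d c f b"
    "D6 = diag_coeff f b d c e a"
  have Fs: "face_poly b a d = F4" "face_poly b c f = F2" "face_poly c a e = F3" "face_poly c b f = F2"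
     "face_poly d a b = F4" "face_poly d e f = F1" "face_poly e a c = F3" "face_poly e d f = F1"
     "face_poly f b c = F2" "face_poly f d e = F1"
    unfolding F by (simp_all add: face_poly_def algebra_simps)
  \<comment> \<open>With shared names for the cofactors the symmetry is visible:
    \<open>E23 / F4\<close>, for instance, couples \<open>x1\<close> and \<open>x2\<close> in both
    of their rows.\<close>
  have rows: "jac_row a b c d e f x1 x2 x3 x4 x5 x6 =
      D1 * x1 + x6 - E23 / F4 * x2 - E24 / F3 * x3 - E13 / F4 * x4 - E14 / F3 * x5"
    "jac_row b a c d f e x2 x1 x3 x4 x6 x5 =
      D2 * x2 + x5 - E23 / F4 * x1 - E34 / F2 * x3 - E12 / F4 * x4 - E14 / F2 * x6"
    "jac_row c a b e f d x3 x1 x2 x5 x6 x4 =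
      D3 * x3 + x4 - E24 / F3 * x1 - E34 / F2 * x2 - E12 / F3 * x5 - E13 / F2 * x6"
    "jac_row d a e b f c x4 x1 x5 x2 x6 x3 =
      D4 * x4 + x3 - E13 / F4 * x1 - E34 / F1 * x5 - E12 / F4 * x2 - E24 / F1 * x6"
    "jac_row e a d c f b x5 x1 x4 x3 x6 x2 =
      D5 * x5 + x2 - E14 / F3 * x1 - E34 / F1 * x4 - E12 / F3 * x3 - E23 / F1 * x6"
    "jac_row f b d c e a x6 x2 x4 x3 x5 x1 =
      D6 * x6 + x1 - E14 / F2 * x2 - E24 / F1 * x4 - E13 / F2 * x3 - E23 / F1 * x5"
    for x1 x2 x3 x4 x5 x6
    unfolding jac_row_def D[symmetric] Fs F[symmetric]
    by (simp_all add: E edge_poly_def algebra_simps)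
  have var: "0 \<le> 2 * t * R + t\<^sup>2 * w" if "jac_form p (x + t *\<^sub>R v) = jac_form p x + 2 * t * R + t\<^sup>2 * w" for v t R w
    using nn[of "x + t *\<^sub>R v"] that z by simp
  note q = pe xe jac_form_def rows
  have "jac_row a b c d e f x1 x2 x3 x4 x5 x6 = 0"
    by (rule linear_coeff_zero[of _ D1], rule var[of _ "(1,0,0,0,0,0)"])
       (simp add: q algebra_simps add_divide_distrib power2_eq_square)
  moreover have "jac_row b a c d f e x2 x1 x3 x4 x6 x5 = 0"
    by (rule linear_coeff_zero[of _ D2], rule var[of _ "(0,1,0,0,0,0)"])
       (simp add: q algebra_simps add_divide_distrib power2_eq_square)
  moreover have "jac_row c a b e f d x3 x1 x2 x5 x6 x4 = 0"
    by (rule linear_coeff_zero[of _ D3], rule var[of _ "(0,0,1,0,0,0)"])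
       (simp add: q algebra_simps add_divide_distrib power2_eq_square)
  moreover have "jac_row d a e b f c x4 x1 x5 x2 x6 x3 = 0"
    by (rule linear_coeff_zero[of _ D4], rule var[of _ "(0,0,0,1,0,0)"])
       (simp add: q algebra_simps add_divide_distrib power2_eq_square)
  moreover have "jac_row e a d c f b x5 x1 x4 x3 x6 x2 = 0"
    by (rule linear_coeff_zero[of _ D5], rule var[of _ "(0,0,0,0,1,0)"])
       (simp add: q algebra_simps add_divide_distrib power2_eq_square)
  moreover have "jac_row f b d c e a x6 x2 x4 x3 x5 x1 = 0"
    by (rule linear_coeff_zero[of _ D6], rule var[of _ "(0,0,0,0,0,1)"])
       (simp add: q algebra_simps add_divide_distrib power2_eq_square)
  moreover have "y\<^sup>2 \<noteq> 1" if "y > 1" for y :: real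
    using that by (simp add: power2_eq_1_iff)
  moreover have "face_poly d e f \<noteq> 0" "face_poly b c f \<noteq> 0" "face_poly a c e \<noteq> 0" "face_poly a b d \<noteq> 0"
    using face_poly_gt(2)[of d e f] face_poly_gt(2)[of b c f] face_poly_gt(2)[of a c e]
      face_poly_gt(2)[of a b d] gt by auto
  ultimately have "x1 = 0 \<and> x2 = 0 \<and> x3 = 0 \<and> x4 = 0 \<and> x5 = 0 \<and> x6 = 0"
    using gt by (intro kernel_trivial[of a b c d e f]) auto
  then show ?thesis by (simp add: xe zero_prod_def)
qed

text \<open>At a regular tetrahedron the form becomes an explicit sum of squares in the sums and
  differences of opposite edges, the pairs (1,6), (2,5) and (3,4).\<close>

lemma jac_form_regular: "x \<noteq> 0 \<Longrightarrow> jac_form (2, 2, 2, 2, 2, 2) x > 0"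
proof -
  assume x: "x \<noteq> 0"
  obtain x1 x2 x3 x4 x5 x6 where xe: "x = (x1, x2, x3, x4, x5, x6)" by (cases x)
  \<comment> \<open>The squares are abstracted to variables, so that the comparison becomes linear:
    half of each \<open>s + d\<close> supplies the \<open>y\<close> terms, and nonnegative multiples
    of \<open>d\<close> and \<open>e\<close> remain.\<close>
  have aux: "y1 + y2 + y3 + y4 + y5 + y6 \<le> q"
    if "q = 1/2 * (s1 + s2 + s3) + 5/6 * (d1 + d2 + d3) + 2/3 * (e1 + e2 + e3)"
      "s1 + d1 = 2 * (y1 + y6)" "s2 + d2 = 2 * (y2 + y5)" "s3 + d3 = 2 * (y3 + y4)"
      "0 \<le> e1" "0 \<le> e2" "0 \<le> e3" "0 \<le> d1" "0 \<le> d2" "0 \<le> d3"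
    for q s1 s2 s3 d1 d2 d3 e1 e2 e3 y1 y2 y3 y4 y5 y6 :: real
  proof -
    have "q = (y1 + y2 + y3 + y4 + y5 + y6) + 1/3 * (d1 + d2 + d3) + 2/3 * (e1 + e2 + e3)"
      using that(1-4) by (simp add: field_simps)
    then show ?thesis using that(5-) by simp
  qed
  have "jac_form (2, 2, 2, 2, 2, 2) x = 1/2 * ((x1 + x6)\<^sup>2 + (x2 + x5)\<^sup>2 + (x3 + x4)\<^sup>2)
     + 5/6 * ((x1 - x6)\<^sup>2 + (x2 - x5)\<^sup>2 + (x3 - x4)\<^sup>2)
     + 2/3 * ((x1 + x6 - x2 - x5)\<^sup>2 + (x1 + x6 - x3 - x4)\<^sup>2 + (x2 + x5 - x3 - x4)\<^sup>2)"
    by (simp add: jac_form_def xe jac_row_def diag_coeff_def edge_poly_def face_poly_def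
        power2_eq_square field_simps)
  moreover have "(x1 + x6)\<^sup>2 + (x1 - x6)\<^sup>2 = 2 * (x1\<^sup>2 + x6\<^sup>2)"
    "(x2 + x5)\<^sup>2 + (x2 - x5)\<^sup>2 = 2 * (x2\<^sup>2 + x5\<^sup>2)"
    "(x3 + x4)\<^sup>2 + (x3 - x4)\<^sup>2 = 2 * (x3\<^sup>2 + x4\<^sup>2)"
    by (simp_all add: power2_eq_square algebra_simps)
  moreover have "0 \<le> (x1 + x6 - x2 - x5)\<^sup>2" "0 \<le> (x1 + x6 - x3 - x4)\<^sup>2" "0 \<le> (x2 + x5 - x3 - x4)\<^sup>2"
    "0 \<le> (x1 - x6)\<^sup>2" "0 \<le> (x2 - x5)\<^sup>2" "0 \<le> (x3 - x4)\<^sup>2"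
    by simp_all
  ultimately have ge: "jac_form (2, 2, 2, 2, 2, 2) x \<ge> x1\<^sup>2 + x2\<^sup>2 + x3\<^sup>2 + x4\<^sup>2 + x5\<^sup>2 + x6\<^sup>2"
    by (rule aux)
  have "x1 \<noteq> 0 \<or> x2 \<noteq> 0 \<or> x3 \<noteq> 0 \<or> x4 \<noteq> 0 \<or> x5 \<noteq> 0 \<or> x6 \<noteq> 0" using x xe by (auto simp: zero_prod_def)
  moreover have p: "y \<noteq> 0 \<Longrightarrow> 0 < y\<^sup>2" and nn: "0 \<le> y\<^sup>2" for y :: real
    by simp_all
  ultimately have "0 < x1\<^sup>2 + x2\<^sup>2 + x3\<^sup>2 + x4\<^sup>2 + x5\<^sup>2 + x6\<^sup>2"
    using nn[of x1] nn[of x2] nn[of x3] nn[of x4] nn[of x5] nn[of x6]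
    by (elim disjE; drule_tac p; linarith)
  with ge show ?thesis by linarith
qed

lemma continuous_on_jac_row:
  assumes c: "continuous_on S a" "continuous_on S b" "continuous_on S c" "continuous_on S d"
    "continuous_on S e" "continuous_on S f"
    and x: "continuous_on S x1" "continuous_on S x2" "continuous_on S x3" "continuous_on S x4"
    "continuous_on S x5" "continuous_on S x6"
    and gt: "\<And>p. p \<in> S \<Longrightarrow> a p > 1 \<and> b p > 1 \<and> c p > 1 \<and> d p > 1 \<and> e p > 1 \<and> f p > 1"
  shows "continuous_on S (\<lambda>p. jac_row (a p) (b p) (c p) (d p) (e p) (f p)
    (x1 p) (x2 p) (x3 p) (x4 p) (x5 p) (x6 p))"
proof -
  have e: "continuous_on S (\<lambda>p. edge_poly (a p) (b p) (c p) (d p) (e p) (f p))"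
    if "continuous_on S a" "continuous_on S b" "continuous_on S c" "continuous_on S d"
    "continuous_on S e" "continuous_on S f" for a b c d e f :: "'a \<Rightarrow> real"
    unfolding edge_poly_def by (intro continuous_intros that)
  have f: "continuous_on S (\<lambda>p. face_poly (a p) (b p) (c p))"
    if "continuous_on S a" "continuous_on S b" "continuous_on S c" for a b c :: "'a \<Rightarrow> real"
    unfolding face_poly_def by (intro continuous_intros that)
  have n1: "face_poly (a p) (b p) (d p) \<noteq> 0" if "p \<in> S" for p
    using gt[OF that] face_poly_gt(2)[of "a p" "b p" "d p"] by auto
  have n2: "face_poly (a p) (c p) (e p) \<noteq> 0" if "p \<in> S" for p
    using gt[OF that] face_poly_gt(2)[of "a p" "c p" "e p"] by auto
  have n3: "(a p)\<^sup>2 - 1 \<noteq> 0" if "p \<in> S" for p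
    using gt[OF that] by (auto simp: power2_eq_1_iff)
  show ?thesis unfolding jac_row_def diag_coeff_def
    by (intro continuous_intros e f c x ballI n1 n2 n3)
qed

lemma continuous_on_jac_form: "continuous_on (admissible \<times> UNIV) (\<lambda>(p, x). jac_form p x)"
  unfolding jac_form_def split_beta
  by (intro continuous_intros continuous_on_jac_row) (auto simp: admissible_def)

text \<open>
  For fixed \<open>a, \<dots>, e\<close> the admissible \<open>f\<close> form an interval: \<open>gram\<close> is a concave quadratic
  polynomial in \<open>f\<close>, whose larger root exceeds 1.
\<close>

lemma connected_admissible: "connected admissible"
proof -
  \<comment> \<open>By \<open>gram_identity\<close>, \<open>gram > 0\<close> means that
    \<open>N - (a\<^sup>2 - 1) * f\<close> has absolute value below \<open>P\<close>. Hence
    \<open>up\<close> is the larger root in \<open>f\<close>, and \<open>lo\<close> is the maximum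
    of 1 and the smaller root.\<close>
  define N where "N = (\<lambda>(a, b, c, d, e). b * c + d * e + a * b * e + a * c * (d::real))"
  define P where "P = (\<lambda>(a, b, c, d, e). sqrt (face_poly a b d * face_poly a c e))"
  define lo where "lo = (\<lambda>y. max 1 ((N y - P y) / ((fst y)\<^sup>2 - 1)))"
  define up where "up = (\<lambda>y. (N y + P y) / ((fst y)\<^sup>2 - 1))"
  define S where "S = {1::real<..} \<times> {1::real<..} \<times> {1::real<..} \<times> {1::real<..} \<times> {1::real<..}"
  define h where "h = (\<lambda>((a, b, c, d, e), t). (a, b, c, d, e,
     (1 - t) * lo (a, b, c, d, e) + t * up (a, b, c, d, e)))"
  have sq: "y\<^sup>2 > 1" if "y > 1" for y :: real using that by (simp add: one_less_power)
  \<comment> \<open>Both face polynomials exceed \<open>a\<^sup>2 - 1\<close>, hence so does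
    \<open>P\<close>; as \<open>N > 0\<close>, this pushes \<open>up\<close> above 1.\<close>
  have lu: "lo y < up y" if "y \<in> S" for y
  proof -
    obtain a b c d e where y: "y = (a, b, c, d, e)" by (cases y)
    have gt: "a > 1" "b > 1" "c > 1" "d > 1" "e > 1" using that by (auto simp: y S_def)
    note f = face_poly_gt[of a b d] face_poly_gt[of a c e]
    have "(a\<^sup>2 - 1)\<^sup>2 < face_poly a b d * face_poly a c e"
      unfolding power2_eq_square[of "a\<^sup>2 - 1"] using gt f sq[of a] by (intro mult_strict_mono) auto
    then have "a\<^sup>2 - 1 < P y" unfolding P_def y by (simp add: real_less_rsqrt)
    moreover have "N y > 0" using gt by (auto simp: N_def y intro!: add_pos_pos)
    moreover have "P y > 0" using f gt by (simp add: P_def y)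
    ultimately show ?thesis using sq[OF gt(1)] by (simp add: lo_def up_def y field_simps)
  qed
  have gram_iff: "gram a b c d e f > 0 \<longleftrightarrow>
      (N (a, b, c, d, e) - P (a, b, c, d, e)) / (a\<^sup>2 - 1) < f \<and> f < up (a, b, c, d, e)"
    if "(a, b, c, d, e) \<in> S" for a b c d e f
  proof -
    have gt: "a > 1" "b > 1" "c > 1" "d > 1" "e > 1" using that by (auto simp: S_def)
    note s = sq[OF gt(1)]
    have "gram a b c d e f > 0 \<longleftrightarrow> (a\<^sup>2 - 1) * gram a b c d e f > 0"
      using s by (simp add: zero_less_mult_iff)
    also have "\<dots> \<longleftrightarrow> (edge_poly a b c d e f)\<^sup>2 < face_poly a b d * face_poly a c e"
      unfolding gram_identity[symmetric] by simp
    also have "\<dots> \<longleftrightarrow> \<bar>edge_poly a b c d e f\<bar> < P (a, b, c, d, e)"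
      unfolding P_def prod.case by (metis real_sqrt_abs real_sqrt_less_iff)
    also have "edge_poly a b c d e f = N (a, b, c, d, e) - (a\<^sup>2 - 1) * f"
      by (simp add: edge_poly_def N_def)
    also have "\<bar>N (a, b, c, d, e) - (a\<^sup>2 - 1) * f\<bar> < P (a, b, c, d, e) \<longleftrightarrow>
      (N (a, b, c, d, e) - P (a, b, c, d, e)) / (a\<^sup>2 - 1) < f \<and> f < up (a, b, c, d, e)"
      using s unfolding up_def by (auto simp: field_simps abs_less_iff)
    finally show ?thesis .
  qed
  have "admissible = h ` (S \<times> {0<..<1})"
  proof (intro equalityI subsetI)
    fix p assume "p \<in> admissible"
    obtain a b c d e f where pe: "p = (a, b, c, d, e, f)" by (cases p)
    let ?y = "(a, b, c, d, e)"
    have y: "?y \<in> S" and f: "f > 1" "gram a b c d e f > 0"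
      using \<open>p \<in> admissible\<close> by (auto simp: pe admissible_def S_def)
    then have "lo ?y < f" "f < up ?y" using gram_iff[OF y, of f] by (auto simp: lo_def)
    define t where "t = (f - lo ?y) / (up ?y - lo ?y)"
    have "t \<in> {0<..<1}" unfolding t_def using \<open>lo ?y < f\<close> \<open>f < up ?y\<close> by auto
    moreover have "f = (1 - t) * lo ?y + t * up ?y"
    proof -
      have "t * (up ?y - lo ?y) = f - lo ?y" using lu[OF y] by (simp add: t_def)
      then show ?thesis by (simp add: algebra_simps)
    qed
    ultimately show "p \<in> h ` (S \<times> {0<..<1})"
      using y by (intro image_eqI[of _ _ "(?y, t)"]) (auto simp: h_def pe)
  next
    fix p assume "p \<in> h ` (S \<times> {0<..<1})"
    then obtain a b c d e t where t: "(a, b, c, d, e) \<in> S" "0 < t" "t < 1"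
      and pe: "p = h ((a, b, c, d, e), t)" by auto
    let ?y = "(a, b, c, d, e)"
    define f where "f = (1 - t) * lo ?y + t * up ?y"
    have l: "lo ?y < up ?y" by (rule lu[OF t(1)])
    have "lo ?y < f"
    proof -
      have "0 < t * (up ?y - lo ?y)" using l t by simp
      then show ?thesis by (simp add: f_def algebra_simps)
    qed
    moreover have "f < up ?y"
    proof -
      have "0 < (1 - t) * (up ?y - lo ?y)" using l t by simp
      then show ?thesis by (simp add: f_def algebra_simps)
    qed
    ultimately have "gram a b c d e f > 0" "f > 1"
      using gram_iff[OF t(1), of f] by (auto simp: lo_def)
    then show "p \<in> admissible" using t(1) by (auto simp: pe h_def f_def admissible_def S_def)
  qed
  moreover have "connected (S \<times> {0<..<(1::real)})"
    unfolding S_def by (intro convex_connected convex_Times convex_real_interval)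
  moreover have "continuous_on (S \<times> {0<..<1}) h"
  proof -
    have "a\<^sup>2 \<noteq> 1" if "a > 1" for a :: real using sq[OF that] by simp
    then show ?thesis
      unfolding h_def lo_def up_def N_def P_def split_beta face_poly_def
      by (intro continuous_intros) (auto simp: S_def)
  qed
  ultimately show ?thesis by (metis connected_continuous_image)
qed

theorem jac_form_pos:
  assumes "p \<in> admissible" "x \<noteq> 0"
  shows "jac_form p x > 0"
proof (rule pos_def_connected[OF connected_admissible continuous_on_jac_form jac_form_scale])
  show "(2, 2, 2, 2, 2, 2) \<in> admissible" by (simp add: admissible_def gram_def)
  show "y = 0" if "q \<in> admissible" "\<And>y. 0 \<le> jac_form q y" "jac_form q y = 0" for q y
    using that by (rule jac_form_nondegenerate)
qed (fact jac_form_regular assms)+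

section \<open>Extended dihedral angles and their monotonicity\<close>

definition cos_angle :: "real \<Rightarrow> real \<Rightarrow> real \<Rightarrow> real \<Rightarrow> real \<Rightarrow> real \<Rightarrow> real" where
  "cos_angle a b c d e f = edge_poly a b c d e f / (sqrt (face_poly a b d) * sqrt (face_poly a c e))"

definition angle :: "real \<Rightarrow> real \<Rightarrow> real \<Rightarrow> real \<Rightarrow> real \<Rightarrow> real \<Rightarrow> real" where
  "angle a b c d e f = arccos (max (- 1) (min (cos_angle (cosh a) (cosh b) (cosh c) (cosh d) (cosh e) (cosh f)) 1))"

lemma cosh_gt_1: "cosh x > 1" if "x > 0" for x :: real
  using cosh_real_strict_mono[of 0 x] that by simp

lemma face_poly_cosh_pos: "face_poly (cosh p) (cosh q) (cosh r) > 0"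
proof -
  have 1: "cosh p \<ge> 1" "cosh q \<ge> 1" "cosh r \<ge> 1" by (simp_all add: cosh_real_ge_1)
  then have "(cosh p)\<^sup>2 \<ge> 1" by (simp add: one_le_power)
  moreover have "2 * cosh p * cosh q * cosh r > 0" by (simp add: cosh_real_pos)
  moreover have "(cosh q)\<^sup>2 \<ge> 0" "(cosh r)\<^sup>2 \<ge> 0" by simp_all
  ultimately show ?thesis unfolding face_poly_def by linarith
qed

lemma cos_angle_sq:
  assumes "face_poly a b d > 0" "face_poly a c e > 0"
  shows "1 - (cos_angle a b c d e f)\<^sup>2 =
    (a\<^sup>2 - 1) * gram a b c d e f / (face_poly a b d * face_poly a c e)"
proof -
  have "(cos_angle a b c d e f)\<^sup>2 = (edge_poly a b c d e f)\<^sup>2 / (face_poly a b d * face_poly a c e)"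
    using assms by (simp add: cos_angle_def power_divide power_mult_distrib)
  then show ?thesis using assms unfolding gram_identity[symmetric] by (simp add: diff_divide_distrib)
qed

text \<open>The right-hand side is invariant under relabelling of the vertices, so the six angles of
  a tetrahedron degenerate simultaneously.\<close>

lemma abs_cos_angle_less_iff:
  assumes "a > 1" "b > 1" "c > 1" "d > 1" "e > 1"
  shows "\<bar>cos_angle a b c d e f\<bar> < 1 \<longleftrightarrow> gram a b c d e f > 0"
proof -
  have f: "face_poly a b d > 0" "face_poly a c e > 0" using assms face_poly_gt by auto
  have a: "a\<^sup>2 > 1" using assms(1) by (simp add: one_less_power)
  have "\<bar>cos_angle a b c d e f\<bar> < 1 \<longleftrightarrow> 1 - (cos_angle a b c d e f)\<^sup>2 > 0"
    by (simp add: abs_square_less_1)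
  also have "\<dots> \<longleftrightarrow> gram a b c d e f > 0"
    unfolding cos_angle_sq[OF f] using f a
    by (simp add: zero_less_divide_iff zero_less_mult_iff mult_less_0_iff)
  finally show ?thesis .
qed

lemma angle_degenerate:
  assumes "\<not> \<bar>cos_angle (cosh a) (cosh b) (cosh c) (cosh d) (cosh e) (cosh f)\<bar> < 1"
  shows "angle a b c d e f \<in> {0, pi}"
proof -
  let ?u = "cos_angle (cosh a) (cosh b) (cosh c) (cosh d) (cosh e) (cosh f)"
  from assms have "max (- 1) (min ?u 1) = 1 \<or> max (- 1) (min ?u 1) = - 1" by linarith
  then show ?thesis unfolding angle_def by (elim disjE) simp_all
qed

lemma has_real_derivative_cos_angle:
  assumes a: "(a has_real_derivative x1) (at s)" and b: "(b has_real_derivative x2) (at s)"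
    and c: "(c has_real_derivative x3) (at s)" and d: "(d has_real_derivative x4) (at s)"
    and e: "(e has_real_derivative x5) (at s)" and f: "(f has_real_derivative x6) (at s)"
    and P: "face_poly (a s) (b s) (d s) > 0" and Q: "face_poly (a s) (c s) (e s) > 0"
    and a1: "(a s)\<^sup>2 \<noteq> 1"
  shows "((\<lambda>s. cos_angle (a s) (b s) (c s) (d s) (e s) (f s)) has_real_derivative
    - ((a s)\<^sup>2 - 1) * jac_row (a s) (b s) (c s) (d s) (e s) (f s) x1 x2 x3 x4 x5 x6 /
      (sqrt (face_poly (a s) (b s) (d s)) * sqrt (face_poly (a s) (c s) (e s)))) (at s)"
proof -
  have dn: "((\<lambda>s. edge_poly (a s) (b s) (c s) (d s) (e s) (f s)) has_real_derivative
      edge_diff (a s) (b s) (c s) (d s) (e s) (f s) x1 x2 x3 x4 x5 x6) (at s)"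
    unfolding edge_poly_def edge_diff_def
    by (rule derivative_eq_intros a b c d e f refl)+ (simp add: algebra_simps)
  have df: "((\<lambda>s. face_poly (a s) (b s) (c s)) has_real_derivative
      face_diff (a s) (b s) (c s) x1 x2 x3) (at s)"
    if "(a has_real_derivative x1) (at s)" "(b has_real_derivative x2) (at s)"
      "(c has_real_derivative x3) (at s)" for a b c x1 x2 x3
    unfolding face_poly_def face_diff_def
    by (rule derivative_eq_intros that refl)+ (simp add: algebra_simps)
  note dP = df[OF a b d] and dQ = df[OF a c e]
  define p q n dp dq dn' where "p = sqrt (face_poly (a s) (b s) (d s))"
    and "q = sqrt (face_poly (a s) (c s) (e s))"
    and "n = edge_poly (a s) (b s) (c s) (d s) (e s) (f s)"
    and "dp = face_diff (a s) (b s) (d s) x1 x2 x4" and "dq = face_diff (a s) (c s) (e s) x1 x3 x5"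
    and "dn' = edge_diff (a s) (b s) (c s) (d s) (e s) (f s) x1 x2 x3 x4 x5 x6"
  have pq: "p > 0" "q > 0" using P Q by (simp_all add: p_def q_def)
  have sp: "((\<lambda>s. sqrt (face_poly (a s) (b s) (d s))) has_real_derivative dp / (2 * p)) (at s)"
    using DERIV_chain2[OF DERIV_real_sqrt[OF P] dP] by (simp add: p_def dp_def field_simps)
  have sq: "((\<lambda>s. sqrt (face_poly (a s) (c s) (e s))) has_real_derivative dq / (2 * q)) (at s)"
    using DERIV_chain2[OF DERIV_real_sqrt[OF Q] dQ] by (simp add: q_def dq_def field_simps)
  have p2: "face_poly (a s) (b s) (d s) = p\<^sup>2" "face_poly (a s) (c s) (e s) = q\<^sup>2"
    using P Q by (simp_all add: p_def q_def)
  have "((\<lambda>s. cos_angle (a s) (b s) (c s) (d s) (e s) (f s)) has_real_derivative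
      (dn' * (p * q) - n * (dp / (2 * p) * q + dq / (2 * q) * p)) / ((p * q) * (p * q))) (at s)"
    unfolding cos_angle_def n_def dn'_def
    using DERIV_divide[OF dn DERIV_mult[OF sp sq]] pq by (simp add: p_def q_def)
  also have "(dn' * (p * q) - n * (dp / (2 * p) * q + dq / (2 * q) * p)) / ((p * q) * (p * q)) =
      (dn' - n * (dp / (2 * p\<^sup>2) + dq / (2 * q\<^sup>2))) / (p * q)"
    using pq by (simp add: field_simps power2_eq_square)
  also have "dn' - n * (dp / (2 * p\<^sup>2) + dq / (2 * q\<^sup>2)) =
      - ((a s)\<^sup>2 - 1) * jac_row (a s) (b s) (c s) (d s) (e s) (f s) x1 x2 x3 x4 x5 x6"
    unfolding dn'_def n_def dp_def dq_def p2[symmetric]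
    using jac_row_edge_diff[of "a s" "b s" "d s" "c s" "e s" "f s" x1 x2 x3 x4 x5 x6] P Q a1 by auto
  finally show ?thesis by (simp add: p_def q_def)
qed

text \<open>By \<open>gram_identity\<close>, the sine of the angle is
  \<open>sinh a * sqrt gram / (p * q)\<close>. The face factors cancel against those in the
  derivative of the cosine, leaving the factor \<open>1 / sqrt gram\<close> common to all edges;
  this makes the Jacobian in the lengths symmetric.\<close>

lemma has_real_derivative_angle:
  fixes a b c d e f :: "real \<Rightarrow> real"
  assumes a: "(a has_real_derivative x1) (at s)" and b: "(b has_real_derivative x2) (at s)"
    and c: "(c has_real_derivative x3) (at s)" and d: "(d has_real_derivative x4) (at s)"
    and e: "(e has_real_derivative x5) (at s)" and f: "(f has_real_derivative x6) (at s)"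
    and pos: "a s > 0" "b s > 0" "c s > 0" "d s > 0" "e s > 0"
    and g: "gram (cosh (a s)) (cosh (b s)) (cosh (c s)) (cosh (d s)) (cosh (e s)) (cosh (f s)) > 0"
  shows "((\<lambda>s. angle (a s) (b s) (c s) (d s) (e s) (f s)) has_real_derivative
     sinh (a s) * jac_row (cosh (a s)) (cosh (b s)) (cosh (c s)) (cosh (d s)) (cosh (e s)) (cosh (f s))
       (sinh (a s) * x1) (sinh (b s) * x2) (sinh (c s) * x3) (sinh (d s) * x4) (sinh (e s) * x5)
       (sinh (f s) * x6) /
     sqrt (gram (cosh (a s)) (cosh (b s)) (cosh (c s)) (cosh (d s)) (cosh (e s)) (cosh (f s)))) (at s)"
proof -
  let ?u = "\<lambda>s. cos_angle (cosh (a s)) (cosh (b s)) (cosh (c s)) (cosh (d s)) (cosh (e s)) (cosh (f s))"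
  let ?R = "jac_row (cosh (a s)) (cosh (b s)) (cosh (c s)) (cosh (d s)) (cosh (e s)) (cosh (f s))
       (sinh (a s) * x1) (sinh (b s) * x2) (sinh (c s) * x3) (sinh (d s) * x4) (sinh (e s) * x5)
       (sinh (f s) * x6)"
  let ?g = "gram (cosh (a s)) (cosh (b s)) (cosh (c s)) (cosh (d s)) (cosh (e s)) (cosh (f s))"
  define p q where "p = sqrt (face_poly (cosh (a s)) (cosh (b s)) (cosh (d s)))"
    and "q = sqrt (face_poly (cosh (a s)) (cosh (c s)) (cosh (e s)))"
  have pq: "p > 0" "q > 0" using face_poly_cosh_pos by (simp_all add: p_def q_def)
  have s2: "(cosh (a s))\<^sup>2 - 1 = (sinh (a s))\<^sup>2" by (simp add: cosh_square_eq)
  have s0: "sinh (a s) > 0" using pos(1) by simp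
  have ch: "((\<lambda>s. cosh (h s)) has_real_derivative sinh (h s) * y) (at s)"
    if "(h has_real_derivative y) (at s)" for h y
    using that by (auto intro!: derivative_eq_intros)
  have du: "(?u has_real_derivative - (sinh (a s))\<^sup>2 * ?R / (p * q)) (at s)"
    using has_real_derivative_cos_angle[OF ch[OF a] ch[OF b] ch[OF c] ch[OF d] ch[OF e] ch[OF f]]
      face_poly_cosh_pos s0 cosh_gt_1[OF pos(1)] by (simp add: p_def q_def s2 power2_eq_1_iff)
  have u1: "\<bar>?u s\<bar> < 1"
    using abs_cos_angle_less_iff g pos cosh_gt_1 by simp
  have "(?u s)\<^sup>2 < 1" using u1 by (simp add: abs_square_less_1)
  have sq: "sqrt (1 - (?u s)\<^sup>2) = sinh (a s) * sqrt ?g / (p * q)"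
    unfolding cos_angle_sq[OF face_poly_cosh_pos face_poly_cosh_pos] s2
    using s0 by (simp add: p_def q_def real_sqrt_divide real_sqrt_mult)
  have "((\<lambda>s. arccos (?u s)) has_real_derivative
      inverse (- sqrt (1 - (?u s)\<^sup>2)) * (- (sinh (a s))\<^sup>2 * ?R / (p * q))) (at s)"
    by (rule DERIV_chain2[OF DERIV_arccos du]) (use u1 in auto)
  also have "inverse (- sqrt (1 - (?u s)\<^sup>2)) * (- (sinh (a s))\<^sup>2 * ?R / (p * q)) = sinh (a s) * ?R / sqrt ?g"
    unfolding sq using pq s0 g by (simp add: field_simps power2_eq_square)
  finally have da: "((\<lambda>s. arccos (?u s)) has_real_derivative sinh (a s) * ?R / sqrt ?g) (at s)" .
  have "(g \<longlongrightarrow> g s) (nhds s)" if "isCont g s" for g :: "real \<Rightarrow> real"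
    using that by (simp add: isCont_def tendsto_at_iff_tendsto_nhds)
  from this[OF DERIV_isCont[OF du]] have "(?u \<longlongrightarrow> ?u s) (nhds s)" .
  \<comment> \<open>Where the cosine lies strictly between -1 and 1 the truncation in
    \<open>angle\<close> is inactive, so the derivative of the plain \<open>arccos\<close> carries
    over.\<close>
  then have "eventually (\<lambda>y. ?u y \<in> {-1<..<1}) (nhds s)"
    by (rule topological_tendstoD) (use u1 in \<open>auto simp: abs_less_iff\<close>)
  then have "eventually (\<lambda>y. angle (a y) (b y) (c y) (d y) (e y) (f y) = arccos (?u y)) (nhds s)"
    by eventually_elim (auto simp: angle_def max_def min_def)
  with da show ?thesis by (simp add: DERIV_cong_ev)
qed

lemma continuous_on_angle:
  assumes "continuous_on S a" "continuous_on S b" "continuous_on S c" "continuous_on S d"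
    "continuous_on S e" "continuous_on S f"
  shows "continuous_on S (\<lambda>x. angle (a x) (b x) (c x) (d x) (e x) (f x))"
proof -
  have c: "continuous_on S (\<lambda>x. cosh (h x))" if "continuous_on S h" for h :: "'a \<Rightarrow> real"
    using that by (intro continuous_intros)
  have n: "continuous_on S (\<lambda>x. edge_poly (cosh (a x)) (cosh (b x)) (cosh (c x)) (cosh (d x)) (cosh (e x)) (cosh (f x)))"
    unfolding edge_poly_def by (intro continuous_intros c assms)
  have p: "continuous_on S (\<lambda>x. sqrt (face_poly (cosh (h1 x)) (cosh (h2 x)) (cosh (h3 x))))"
    if "continuous_on S h1" "continuous_on S h2" "continuous_on S h3" for h1 h2 h3 :: "'a \<Rightarrow> real"
    unfolding face_poly_def by (intro continuous_intros c that)
  have nz: "sqrt (face_poly (cosh x) (cosh y) (cosh z)) * sqrt (face_poly (cosh u) (cosh v) (cosh w)) \<noteq> 0"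
    for x y z u v w :: real
    using face_poly_cosh_pos[of x y z] face_poly_cosh_pos[of u v w] by simp
  have u: "continuous_on S (\<lambda>x. cos_angle (cosh (a x)) (cosh (b x)) (cosh (c x)) (cosh (d x)) (cosh (e x)) (cosh (f x)))"
    unfolding cos_angle_def
    by (intro continuous_on_divide n continuous_on_mult p assms ballI nz)
  show ?thesis unfolding angle_def
    by (intro continuous_on_arccos continuous_intros continuous_on_max continuous_on_min u) auto
qed

text \<open>
  If \<open>g\<close> decreased, it would do so across a value outside \<open>F\<close>, at which it can only increase.
\<close>

lemma nondecreasing_off_finite:
  fixes g :: "real \<Rightarrow> real"
  assumes cont: "continuous_on {a..b} g" and F: "finite F" and ab: "a \<le> b"
    and D: "\<And>s. a \<le> s \<Longrightarrow> s \<le> b \<Longrightarrow> g s \<in> F \<or> (\<exists>D>0. (g has_real_derivative D) (at s))"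
  shows "g a \<le> g b"
proof (rule ccontr)
  assume "\<not> g a \<le> g b"
  then have lt: "g b < g a" by simp
  have "infinite {g b<..<g a}" using lt by (simp add: infinite_Ioo)
  then obtain v where v: "v \<in> {g b<..<g a}" "v \<notin> F"
    using F by (meson finite_subset subsetI)
  \<comment> \<open>\<open>Sup A\<close> is the last time at which \<open>g\<close> is still at
    least \<open>v\<close>. There \<open>g\<close> equals \<open>v\<close>, a value outside
    \<open>F\<close>, so the positive derivative produces a later member of
    \<open>A\<close>.\<close>
  define A where "A = {s \<in> {a..b}. v \<le> g s}"
  have "a \<in> A" using v ab by (auto simp: A_def)
  have "closed {s \<in> {a..b}. g s \<in> {v..}}"
    using continuous_on_closed_Collect_le[of "{a..b}" "\<lambda>_. v" g] cont by simp
  then have "closed A" by (simp add: A_def)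
  moreover have "bdd_above A" unfolding A_def by (rule bdd_aboveI[of _ b]) auto
  ultimately have S: "Sup A \<in> A" using \<open>a \<in> A\<close> by (intro closed_contains_Sup) auto
  have up: "s \<le> Sup A" if "s \<in> A" for s
    using that \<open>bdd_above A\<close> by (rule cSup_upper)
  let ?s = "Sup A"
  have s: "a \<le> ?s" "?s \<le> b" "v \<le> g ?s" using S by (auto simp: A_def)
  have "?s < b" using s v by (cases "?s = b") auto
  have "g ?s = v"
  proof -
    obtain x where "?s \<le> x" "x \<le> b" "g x = v"
      using IVT2'[of g b v ?s] v s continuous_on_subset[OF cont, of "{?s..b}"] by auto
    then have "x \<in> A" using s by (auto simp: A_def)
    with up[OF this] \<open>?s \<le> x\<close> \<open>g x = v\<close> show ?thesis by simp
  qed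
  with D[OF s(1,2)] v(2) obtain D where D: "D > 0" "(g has_real_derivative D) (at ?s)" by auto
  from DERIV_pos_inc_right[OF D(2,1)] obtain d where
    d: "d > 0" "\<And>h. h > 0 \<Longrightarrow> h < d \<Longrightarrow> g ?s < g (?s + h)" by blast
  define h where "h = min (d / 2) (b - ?s)"
  have "h > 0" "h < d" "?s + h \<le> b" using d(1) \<open>?s < b\<close> by (auto simp: h_def)
  then have "?s + h \<in> A" using d(2)[of h] \<open>g ?s = v\<close> s by (auto simp: A_def)
  from up[OF this] \<open>h > 0\<close> show False by simp
qed

text \<open>The inner product of the angle vector at the first argument with the second. In each
  summand the vertices are relabelled so that its own edge comes first, as \<open>angle\<close>
  expects.\<close>

definition angle_pairing :: "real6 \<Rightarrow> real6 \<Rightarrow> real" where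
  "angle_pairing = (\<lambda>(a, b, c, d, e, f) (x1, x2, x3, x4, x5, x6).
     x1 * angle a b c d e f + x2 * angle b a c d f e + x3 * angle c a b e f d +
     x4 * angle d a e b f c + x5 * angle e a d c f b + x6 * angle f b d c e a)"

definition cosh6 :: "real6 \<Rightarrow> real6" where
  "cosh6 = (\<lambda>(a, b, c, d, e, f). (cosh a, cosh b, cosh c, cosh d, cosh e, cosh f))"

definition sinh6 :: "real6 \<Rightarrow> real6 \<Rightarrow> real6" where
  "sinh6 = (\<lambda>(a, b, c, d, e, f) (x1, x2, x3, x4, x5, x6).
     (sinh a * x1, sinh b * x2, sinh c * x3, sinh d * x4, sinh e * x5, sinh f * x6))"

definition gram6 :: "real6 \<Rightarrow> real" where
  "gram6 = (\<lambda>(a, b, c, d, e, f). gram a b c d e f)"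

definition pos6 :: "real6 set" where
  "pos6 = {(a, b, c, d, e, f). a > 0 \<and> b > 0 \<and> c > 0 \<and> d > 0 \<and> e > 0 \<and> f > 0}"

definition hyper_ideal6 :: "real6 set" where
  "hyper_ideal6 = {l \<in> pos6. gram6 (cosh6 l) > 0}"

lemma gram_perm:
  "gram b a c d f e = gram a b c d e f" "gram c a b e f d = gram a b c d e f"
  "gram d a e b f c = gram a b c d e f" "gram e a d c f b = gram a b c d e f"
  "gram f b d c e a = gram a b c d e f"
  by (simp_all add: gram_def algebra_simps power_mult_distrib)

lemma pos6_eq: "pos6 = {0<..} \<times> {0<..} \<times> {0<..} \<times> {0<..} \<times> {0<..} \<times> {0<..}"
  by (auto simp: pos6_def)

lemma convex_pos6: "convex pos6"
  unfolding pos6_eq by (intro convex_Times convex_real_interval)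

lemma continuous_on_gram6: "continuous_on UNIV (\<lambda>l. gram6 (cosh6 l))"
  unfolding gram6_def cosh6_def gram_def split_beta by (simp, intro continuous_intros)

lemma open_hyper_ideal6: "open hyper_ideal6"
proof -
  have "open pos6" unfolding pos6_eq by (intro open_Times open_greaterThan)
  moreover have "open {l. 0 < gram6 (cosh6 l)}"
    by (intro open_Collect_less continuous_on_const continuous_on_gram6)
  ultimately show ?thesis unfolding hyper_ideal6_def
    using open_Int[of pos6 "{l. 0 < gram6 (cosh6 l)}"] by (simp add: Int_def)
qed

lemma continuous_on_angle_pairing: "continuous_on UNIV (\<lambda>l. angle_pairing l x)"
  unfolding angle_pairing_def split_beta by (intro continuous_intros continuous_on_angle)

lemma has_real_derivative_angle_pairing:
  assumes "l + s *\<^sub>R x \<in> hyper_ideal6"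
  shows "((\<lambda>s. angle_pairing (l + s *\<^sub>R x) x) has_real_derivative
    jac_form (cosh6 (l + s *\<^sub>R x)) (sinh6 (l + s *\<^sub>R x) x) / sqrt (gram6 (cosh6 (l + s *\<^sub>R x)))) (at s)"
proof -
  obtain a b c d e f where l: "l = (a, b, c, d, e, f)" by (cases l)
  obtain x1 x2 x3 x4 x5 x6 where x: "x = (x1, x2, x3, x4, x5, x6)" by (cases x)
  have g: "gram (cosh (a + s * x1)) (cosh (b + s * x2)) (cosh (c + s * x3)) (cosh (d + s * x4))
      (cosh (e + s * x5)) (cosh (f + s * x6)) > 0"
    and pos: "a + s * x1 > 0" "b + s * x2 > 0" "c + s * x3 > 0" "d + s * x4 > 0" "e + s * x5 > 0"
      "f + s * x6 > 0"
    using assms by (simp_all add: hyper_ideal6_def gram6_def cosh6_def l x pos6_def)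
  have lin: "((\<lambda>s. p + s * q) has_real_derivative q) (at s)" for p q
    by (auto intro!: derivative_eq_intros)
  note A = has_real_derivative_angle[OF lin lin lin lin lin lin]
  let ?g = "gram (cosh (a + s * x1)) (cosh (b + s * x2)) (cosh (c + s * x3)) (cosh (d + s * x4))
      (cosh (e + s * x5)) (cosh (f + s * x6))"
  have ge: "gram (cosh (b + s * x2)) (cosh (a + s * x1)) (cosh (c + s * x3)) (cosh (d + s * x4))
      (cosh (f + s * x6)) (cosh (e + s * x5)) = ?g"
     "gram (cosh (c + s * x3)) (cosh (a + s * x1)) (cosh (b + s * x2)) (cosh (e + s * x5))
      (cosh (f + s * x6)) (cosh (d + s * x4)) = ?g"
     "gram (cosh (d + s * x4)) (cosh (a + s * x1)) (cosh (e + s * x5)) (cosh (b + s * x2))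
      (cosh (f + s * x6)) (cosh (c + s * x3)) = ?g"
     "gram (cosh (e + s * x5)) (cosh (a + s * x1)) (cosh (d + s * x4)) (cosh (c + s * x3))
      (cosh (f + s * x6)) (cosh (b + s * x2)) = ?g"
     "gram (cosh (f + s * x6)) (cosh (b + s * x2)) (cosh (d + s * x4)) (cosh (c + s * x3))
      (cosh (e + s * x5)) (cosh (a + s * x1)) = ?g"
    by (rule gram_perm)+
  note gs = ge[THEN ssubst[of _ _ "\<lambda>z. 0 < z"], OF g]
  note B = DERIV_add[OF DERIV_add[OF DERIV_add[OF DERIV_add[OF DERIV_add[OF
     DERIV_cmult[OF A[OF pos(1,2,3,4,5) g], of x1]
     DERIV_cmult[OF A[OF pos(2,1,3,4,6) gs(1)], of x2]]
     DERIV_cmult[OF A[OF pos(3,1,2,5,6) gs(2)], of x3]]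
     DERIV_cmult[OF A[OF pos(4,1,5,2,6) gs(3)], of x4]]
     DERIV_cmult[OF A[OF pos(5,1,4,3,6) gs(4)], of x5]]
     DERIV_cmult[OF A[OF pos(6,2,4,3,5) gs(5)], of x6]]
  have eq: "(\<lambda>s. angle_pairing (l + s *\<^sub>R x) x) = (\<lambda>s.
      x1 * angle (a + s * x1) (b + s * x2) (c + s * x3) (d + s * x4) (e + s * x5) (f + s * x6) +
      x2 * angle (b + s * x2) (a + s * x1) (c + s * x3) (d + s * x4) (f + s * x6) (e + s * x5) +
      x3 * angle (c + s * x3) (a + s * x1) (b + s * x2) (e + s * x5) (f + s * x6) (d + s * x4) +
      x4 * angle (d + s * x4) (a + s * x1) (e + s * x5) (b + s * x2) (f + s * x6) (c + s * x3) +
      x5 * angle (e + s * x5) (a + s * x1) (d + s * x4) (c + s * x3) (f + s * x6) (b + s * x2) +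
      x6 * angle (f + s * x6) (b + s * x2) (d + s * x4) (c + s * x3) (e + s * x5) (a + s * x1))"
    by (simp add: angle_pairing_def l x)
  show ?thesis unfolding eq
    by (rule DERIV_cong[OF B])
      (simp only: ge l x jac_form_def cosh6_def sinh6_def gram6_def prod.case plus_prod_def scaleR_prod_def
         fst_conv snd_conv real_scaleR_def add_divide_distrib times_divide_eq_right mult_ac)
qed

lemma cosh6_admissible: "l \<in> hyper_ideal6 \<Longrightarrow> cosh6 l \<in> admissible"
  by (auto simp: hyper_ideal6_def gram6_def cosh6_def pos6_def admissible_def cosh_gt_1)

lemma sinh6_eq_0_iff: "l \<in> hyper_ideal6 \<Longrightarrow> sinh6 l x = 0 \<longleftrightarrow> x = 0"
  by (cases x) (auto simp: hyper_ideal6_def sinh6_def pos6_def zero_prod_def)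

text \<open>The finite set depends on the direction \<open>x\<close> alone, so a single set works
  along a whole segment in the direction \<open>x\<close>.\<close>

lemma angle_degenerate6:
  assumes "l \<in> pos6" "l \<notin> hyper_ideal6"
  shows "angle_pairing l x \<in> (\<lambda>t. (\<lambda>(x1, x2, x3, x4, x5, x6) (t1, t2, t3, t4, t5, t6).
     x1 * t1 + x2 * t2 + x3 * t3 + x4 * t4 + x5 * t5 + x6 * t6) x t) `
     ({0, pi} \<times> {0, pi} \<times> {0, pi} \<times> {0, pi} \<times> {0, pi} \<times> {0, pi})"
proof -
  obtain a b c d e f where l: "l = (a, b, c, d, e, f)" by (cases l)
  obtain x1 x2 x3 x4 x5 x6 where x: "x = (x1, x2, x3, x4, x5, x6)" by (cases x)
  have pos: "cosh a > 1" "cosh b > 1" "cosh c > 1" "cosh d > 1" "cosh e > 1" "cosh f > 1"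
    and g: "\<not> gram (cosh a) (cosh b) (cosh c) (cosh d) (cosh e) (cosh f) > 0"
    using assms by (simp_all add: hyper_ideal6_def gram6_def cosh6_def l x pos6_def cosh_gt_1)
  have "angle a b c d e f \<in> {0, pi}"
    by (rule angle_degenerate, subst abs_cos_angle_less_iff) (use pos g in auto)
  moreover have "angle b a c d f e \<in> {0, pi}"
    by (rule angle_degenerate, subst abs_cos_angle_less_iff)
      (use pos g gram_perm(1)[of "cosh b" "cosh a"] in auto)
  moreover have "angle c a b e f d \<in> {0, pi}"
    by (rule angle_degenerate, subst abs_cos_angle_less_iff)
      (use pos g gram_perm(2)[of "cosh c" "cosh a"] in auto)
  moreover have "angle d a e b f c \<in> {0, pi}"
    by (rule angle_degenerate, subst abs_cos_angle_less_iff)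
      (use pos g gram_perm(3)[of "cosh d" "cosh a"] in auto)
  moreover have "angle e a d c f b \<in> {0, pi}"
    by (rule angle_degenerate, subst abs_cos_angle_less_iff)
      (use pos g gram_perm(4)[of "cosh e" "cosh a"] in auto)
  moreover have "angle f b d c e a \<in> {0, pi}"
    by (rule angle_degenerate, subst abs_cos_angle_less_iff)
      (use pos g gram_perm(5)[of "cosh f" "cosh b"] in auto)
  ultimately have "(angle a b c d e f, angle b a c d f e, angle c a b e f d,
      angle d a e b f c, angle e a d c f b, angle f b d c e a) \<in>
      {0, pi} \<times> {0, pi} \<times> {0, pi} \<times> {0, pi} \<times> {0, pi} \<times> {0, pi}" (is "?t \<in> _")
    by (simp only: mem_Times_iff fst_conv snd_conv simp_thms)
  then show ?thesis
    by (rule image_eqI[rotated, of ?t]) (simp add: angle_pairing_def l x)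
qed

text \<open>Only an initial part of the segment from \<open>l0\<close> to \<open>l\<close> has to
  contribute: there the derivative of the pairing is at least \<open>k\<close> times the squared
  length. On the rest, which may leave the hyper-ideal region, it suffices that the pairing does not
  decrease.\<close>

lemma angle_pairing_strongly_monotone:
  assumes l0: "l0 \<in> hyper_ideal6" and R: "R > 0"
  shows "\<exists>k>0. \<forall>l\<in>pos6. norm (l - l0) \<le> R \<longrightarrow>
    angle_pairing l (l - l0) - angle_pairing l0 (l - l0) \<ge> k * (norm (l - l0))\<^sup>2"
proof -
  define Q where "Q = (\<lambda>l x. jac_form (cosh6 l) (sinh6 l x) / sqrt (gram6 (cosh6 l)))"
  have Q_pos: "Q l x > 0" if "l \<in> hyper_ideal6" "x \<noteq> 0" for l x
  proof -
    have "gram6 (cosh6 l) > 0" using that by (simp add: hyper_ideal6_def)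
    moreover have "jac_form (cosh6 l) (sinh6 l x) > 0"
      by (rule jac_form_pos) (use that cosh6_admissible sinh6_eq_0_iff in auto)
    ultimately show ?thesis by (simp add: Q_def)
  qed
  have Q_cont: "continuous_on (hyper_ideal6 \<times> UNIV) (\<lambda>(l, x). Q l x)"
  proof -
    have "continuous_on (hyper_ideal6 \<times> UNIV) (\<lambda>y. (cosh6 (fst y), sinh6 (fst y) (snd y)))"
      unfolding cosh6_def sinh6_def split_beta by (intro continuous_intros)
    moreover have "(\<lambda>y. (cosh6 (fst y), sinh6 (fst y) (snd y))) ` (hyper_ideal6 \<times> UNIV) \<subseteq> admissible \<times> UNIV"
      by (auto simp: cosh6_admissible)
    ultimately have "continuous_on (hyper_ideal6 \<times> UNIV)
        (\<lambda>y. (\<lambda>(p, x). jac_form p x) (cosh6 (fst y), sinh6 (fst y) (snd y)))"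
      by (rule continuous_on_compose2[OF continuous_on_jac_form])
    then have "continuous_on (hyper_ideal6 \<times> UNIV) (\<lambda>y. jac_form (cosh6 (fst y)) (sinh6 (fst y) (snd y)))"
      by simp
    moreover have "continuous_on (hyper_ideal6 \<times> (UNIV :: real6 set)) (\<lambda>y. sqrt (gram6 (cosh6 (fst y))))"
      by (intro continuous_on_real_sqrt continuous_on_compose2[OF continuous_on_gram6 continuous_on_fst[OF continuous_on_id]]) auto
    ultimately show ?thesis unfolding Q_def split_beta
      by (rule continuous_on_divide) (auto simp: hyper_ideal6_def)
  qed
  have Q_hom: "Q l (r *\<^sub>R x) = r\<^sup>2 * Q l x" for l r x
  proof -
    have "sinh6 l (r *\<^sub>R x) = r *\<^sub>R sinh6 l x" by (cases l, cases x) (simp add: sinh6_def)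
    then show ?thesis by (simp add: Q_def jac_form_scale)
  qed
  from pos_def_near[OF Q_cont Q_hom l0 Q_pos[OF l0]] obtain k r where k: "k > 0" and "r > 0"
    and Qk: "\<And>l x. l \<in> hyper_ideal6 \<Longrightarrow> dist l l0 < r \<Longrightarrow> k * (norm x)\<^sup>2 \<le> Q l x"
    by blast
  from open_hyper_ideal6 l0 obtain r' where r': "r' > 0" "ball l0 r' \<subseteq> hyper_ideal6"
    by (meson open_contains_ball)
  define \<rho> where "\<rho> = min r r'"
  have \<rho>: "\<rho> > 0" using \<open>r > 0\<close> r' by (simp add: \<rho>_def)
  have near: "l \<in> hyper_ideal6 \<and> k * (norm x)\<^sup>2 \<le> Q l x" if "dist l l0 < \<rho>" for l x
    using that r' Qk[of l x] by (auto simp: \<rho>_def dist_commute)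
  \<comment> \<open>The fraction of the segment that stays in the ball of radius
    \<open>\<rho>\<close> whenever its length is at most \<open>R\<close>; the factor 2 makes the
    inclusion strict.\<close>
  define m where "m = min 1 (\<rho> / (2 * R))"
  have m: "m > 0" using \<rho> R by (simp add: m_def)
  have "angle_pairing l (l - l0) - angle_pairing l0 (l - l0) \<ge> (k * m) * (norm (l - l0))\<^sup>2"
    if l: "l \<in> pos6" and lR: "norm (l - l0) \<le> R" for l
  proof -
    define x where "x = l - l0"
    define g where "g = (\<lambda>s. angle_pairing (l0 + s *\<^sub>R x) x)"
    have g_cont: "continuous_on S g" for S
      unfolding g_def by (intro continuous_on_compose2[OF continuous_on_angle_pairing] continuous_intros) auto
    have g_deriv: "(g has_real_derivative Q (l0 + s *\<^sub>R x) x) (at s)" if "l0 + s *\<^sub>R x \<in> hyper_ideal6" for s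
      unfolding g_def Q_def by (rule has_real_derivative_angle_pairing[OF that])
    have "g 0 + k * (norm x)\<^sup>2 * m \<le> g m"
    proof -
      have "g 0 - k * (norm x)\<^sup>2 * 0 \<le> g m - k * (norm x)\<^sup>2 * m"
      proof (rule DERIV_nonneg_imp_nondecreasing[where f = "\<lambda>s. g s - k * (norm x)\<^sup>2 * s"])
        fix s assume s: "0 \<le> s" "s \<le> m"
        have "dist (l0 + s *\<^sub>R x) l0 = s * norm x" using s by (simp add: dist_norm)
        also have "\<dots> \<le> \<rho> / (2 * R) * R" using s lR R by (intro mult_mono) (auto simp: m_def x_def)
        also have "\<dots> < \<rho>" using R \<rho> by simp
        finally have "l0 + s *\<^sub>R x \<in> hyper_ideal6" "k * (norm x)\<^sup>2 \<le> Q (l0 + s *\<^sub>R x) x"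
          using near by auto
        then show "\<exists>y. ((\<lambda>s. g s - k * (norm x)\<^sup>2 * s) has_real_derivative y) (at s) \<and> 0 \<le> y"
          by (intro exI[of _ "Q (l0 + s *\<^sub>R x) x - k * (norm x)\<^sup>2"])
            (auto intro!: derivative_eq_intros g_deriv)
      qed (use m in simp)
      then show ?thesis by simp
    qed
    moreover have "g m \<le> g 1"
    proof (cases "x = 0")
      case True
      then show ?thesis by (simp add: g_def)
    next
      case False
      let ?F = "(\<lambda>t. (\<lambda>(x1, x2, x3, x4, x5, x6) (t1, t2, t3, t4, t5, t6).
        x1 * t1 + x2 * t2 + x3 * t3 + x4 * t4 + x5 * t5 + x6 * t6) x t) `
        ({0, pi} \<times> {0, pi} \<times> {0, pi} \<times> {0, pi} \<times> {0, pi} \<times> {0, pi})"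
      show ?thesis
      proof (rule nondecreasing_off_finite[where g = g and a = m and b = 1 and F = ?F])
        fix s assume s: "m \<le> s" "s \<le> (1::real)"
        have "(1 - s) *\<^sub>R l0 + s *\<^sub>R l \<in> pos6"
          using s m l l0 by (intro convexD[OF convex_pos6]) (auto simp: hyper_ideal6_def)
        also have "(1 - s) *\<^sub>R l0 + s *\<^sub>R l = l0 + s *\<^sub>R x" by (simp add: x_def algebra_simps)
        finally have p: "l0 + s *\<^sub>R x \<in> pos6" .
        show "g s \<in> ?F \<or> (\<exists>D>0. (g has_real_derivative D) (at s))"
        proof (cases "l0 + s *\<^sub>R x \<in> hyper_ideal6")
          case True
          then show ?thesis using g_deriv Q_pos False by blast
        next
          case False
          then show ?thesis unfolding g_def using angle_degenerate6[OF p False, of x] by blast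
        qed
      qed (auto simp: g_cont m_def)
    qed
    ultimately show ?thesis by (simp add: g_def x_def algebra_simps)
  qed
  then show ?thesis using k m by (intro exI[of _ "k * m"]) auto
qed

section \<open>Hyper-ideal tetrahedra in the hyperboloid model\<close>

definition minkowski :: "(real^3) \<times> real \<Rightarrow> (real^3) \<times> real \<Rightarrow> real" where
  "minkowski u v = fst u \<bullet> fst v - snd u * snd v"

lemma minkowski_simps:
  "minkowski (u + v) w = minkowski u w + minkowski v w" "minkowski u (v + w) = minkowski u v + minkowski u w"
  "minkowski (u - v) w = minkowski u w - minkowski v w" "minkowski u (v - w) = minkowski u v - minkowski u w"
  "minkowski (r *\<^sub>R u) w = r * minkowski u w" "minkowski u (r *\<^sub>R w) = r * minkowski u w"
  by (simp_all add: minkowski_def inner_simps algebra_simps)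

lemma minkowski_commute: "minkowski u v = minkowski v u"
  by (simp add: minkowski_def inner_commute mult.commute)

definition hyperboloid :: "real^3 \<Rightarrow> (real^3) \<times> real" where
  "hyperboloid x = (1 / sqrt (1 - x \<bullet> x)) *\<^sub>R (x, 1)"

lemma inner_less_1: "x \<in> ball 0 1 \<Longrightarrow> x \<bullet> x < 1" for x :: "real^3"
  by (simp add: norm_eq_sqrt_inner)

lemma minkowski_hyperboloid_self:
  assumes "x \<in> ball 0 1"
  shows "minkowski (hyperboloid x) (hyperboloid x) = -1"
proof -
  have "1 - x \<bullet> x > 0" using assms(1) inner_less_1 by auto
  then have "minkowski (hyperboloid x) (hyperboloid x) = (x \<bullet> x - 1) / (1 - x \<bullet> x)"
    unfolding hyperboloid_def by (simp only: minkowski_simps) (simp add: minkowski_def)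
  also have "\<dots> = -1" using \<open>1 - x \<bullet> x > 0\<close> by (simp add: divide_eq_minus_1_iff)
  finally show ?thesis .
qed

lemma minkowski_hyperboloid: "minkowski (a, b) (hyperboloid x) = (a \<bullet> x - b) / sqrt (1 - x \<bullet> x)"
  unfolding hyperboloid_def minkowski_simps by (simp add: minkowski_def)

text \<open>For \<open>minkowski X X = -1\<close> this is the Minkowski product of the projections
  of \<open>u\<close> and \<open>v\<close> onto the tangent space at \<open>X\<close>.\<close>

definition tangent_form :: "(real^3) \<times> real \<Rightarrow> (real^3) \<times> real \<Rightarrow> (real^3) \<times> real \<Rightarrow> real" where
  "tangent_form X u v = minkowski u v + minkowski X u * minkowski X v"

text \<open>The Klein vector \<open>y - x\<close> corresponds to a positive multiple of the
  tangential part of \<open>hyperboloid y\<close> at \<open>hyperboloid x\<close>. Angles and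
  orthogonality can therefore be read off in Minkowski space.\<close>

lemma klein_metric_hyperboloid:
  assumes "x \<in> ball 0 1" "y \<in> ball 0 1" "z \<in> ball 0 1"
  shows "klein_metric x (y - x) (z - x) = sqrt (1 - y \<bullet> y) * sqrt (1 - z \<bullet> z) / (1 - x \<bullet> x) *
    tangent_form (hyperboloid x) (hyperboloid y) (hyperboloid z)"
proof -
  define rx ry rz where "rx = sqrt (1 - x \<bullet> x)" and "ry = sqrt (1 - y \<bullet> y)" and "rz = sqrt (1 - z \<bullet> z)"
  have r: "rx > 0" "ry > 0" "rz > 0" using assms[THEN inner_less_1] by (simp_all add: rx_def ry_def rz_def)
  have rx2: "1 - x \<bullet> x = rx\<^sup>2" using assms(1)[THEN inner_less_1] by (simp add: rx_def)
  have xx: "x \<bullet> x = 1 - rx\<^sup>2" using rx2 by simp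
  have "ry * rz * tangent_form (hyperboloid x) (hyperboloid y) (hyperboloid z) =
      y \<bullet> z - 1 + (x \<bullet> y - 1) * (x \<bullet> z - 1) / rx\<^sup>2"
    unfolding tangent_form_def hyperboloid_def rx_def[symmetric] ry_def[symmetric] rz_def[symmetric] minkowski_simps
    using r by (simp add: minkowski_def field_simps power2_eq_square)
  moreover have "klein_metric x (y - x) (z - x) * rx\<^sup>2 = y \<bullet> z - 1 + (x \<bullet> y - 1) * (x \<bullet> z - 1) / rx\<^sup>2"
  proof -
    have "klein_metric x (y - x) (z - x) * rx\<^sup>2 * rx\<^sup>2 = (y - x) \<bullet> (z - x) * rx\<^sup>2 + (x \<bullet> (y - x)) * (x \<bullet> (z - x))"
      unfolding klein_metric_def rx2 using r(1) by (simp add: field_simps power2_eq_square)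
    also have "\<dots> = (y \<bullet> z - 1) * rx\<^sup>2 + (x \<bullet> y - 1) * (x \<bullet> z - 1)"
      by (simp add: inner_simps xx inner_commute[of y x] inner_commute[of z x]) algebra
    finally show ?thesis using r(1) by (simp add: field_simps)
  qed
  ultimately have "klein_metric x (y - x) (z - x) * rx\<^sup>2 =
      ry * rz * tangent_form (hyperboloid x) (hyperboloid y) (hyperboloid z)"
    by (rule trans[OF _ sym, rotated])
  then show ?thesis unfolding rx2 ry_def[symmetric] rz_def[symmetric] using r
    by (simp add: eq_divide_eq)
qed

lemma klein_metric_pos:
  assumes "x \<in> ball 0 1" "u \<noteq> 0"
  shows "klein_metric x u u > 0"
proof -
  have "1 - x \<bullet> x > 0" using assms(1)[THEN inner_less_1] by simp
  then show ?thesis using assms unfolding klein_metric_def by (intro add_pos_nonneg) auto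
qed

text \<open>The strictness is what places the cosine of a dihedral angle strictly between -1 and
  1.\<close>

lemma klein_metric_Cauchy_Schwarz:
  assumes "x \<in> ball 0 1" "w \<noteq> 0" "\<And>t. u \<noteq> t *\<^sub>R w"
  shows "\<bar>klein_metric x u w\<bar> < sqrt (klein_metric x u u) * sqrt (klein_metric x w w)"
proof -
  let ?K = "klein_metric x"
  have w: "?K w w > 0" by (rule klein_metric_pos) fact+
  define t where "t = ?K u w / ?K w w"
  have "0 < ?K (u - t *\<^sub>R w) (u - t *\<^sub>R w)"
    by (rule klein_metric_pos) (use assms in auto)
  also have "?K (u - t *\<^sub>R w) (u - t *\<^sub>R w) = ?K u u - 2 * t * ?K u w + t\<^sup>2 * ?K w w"
    unfolding klein_metric_def
    by (simp add: inner_simps inner_commute power2_eq_square algebra_simps diff_divide_distrib add_divide_distrib)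
  also have "\<dots> = ?K u u - (?K u w)\<^sup>2 / ?K w w"
    using w by (simp add: t_def power2_eq_square field_simps)
  finally have "(?K u w)\<^sup>2 < ?K u u * ?K w w" using w by (simp add: field_simps)
  then have "sqrt ((?K u w)\<^sup>2) < sqrt (?K u u * ?K w w)" by (rule real_sqrt_less_mono)
  then show ?thesis by (simp add: real_sqrt_mult)
qed

lemma klein_metric_scaleR: "klein_metric x (t *\<^sub>R u) w = t * klein_metric x u w"
  by (simp add: klein_metric_def algebra_simps add_divide_distrib)

text \<open>Undoing \<open>arccos\<close> requires its argument to lie between -1 and 1. For
  independent vectors this is the Cauchy-Schwarz inequality; for nonzero collinear ones the argument
  is 1 or -1.\<close>

lemma orthogonal_of_tangent_angle:
  assumes x: "x \<in> ball 0 1" and w: "w \<noteq> 0" and ang: "tangent_angle x u w = pi / 2"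
  shows "klein_metric x u w = 0"
proof (cases "\<exists>t. u = t *\<^sub>R w")
  case False
  let ?q = "klein_metric x u w / (sqrt (klein_metric x u u) * sqrt (klein_metric x w w))"
  have "u \<noteq> 0" using False by (metis scale_zero_left)
  have pos: "klein_metric x u u > 0" "klein_metric x w w > 0"
    by (rule klein_metric_pos; fact)+
  have "\<bar>klein_metric x u w\<bar> < sqrt (klein_metric x u u) * sqrt (klein_metric x w w)"
    by (rule klein_metric_Cauchy_Schwarz) (use assms False in auto)
  then have "\<bar>?q\<bar> \<le> 1" using pos by (simp add: abs_mult)
  then have "?q = cos (arccos ?q)" by (rule cos_arccos_abs[symmetric])
  also have "arccos ?q = pi / 2" using ang by (simp only: tangent_angle_def)
  finally show ?thesis using pos by simp
next
  case True
  then obtain t where t: "u = t *\<^sub>R w" by blast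
  have pos: "klein_metric x w w > 0" by (rule klein_metric_pos) fact+
  have K: "klein_metric x w u = klein_metric x u w" for u w
    by (simp add: klein_metric_def inner_commute mult.commute)
  have uu: "klein_metric x u u = t\<^sup>2 * klein_metric x w w"
    using K[of "t *\<^sub>R w" w] by (simp add: t klein_metric_scaleR power2_eq_square)
  show ?thesis
  proof (cases "t = 0")
    case True
    then show ?thesis by (simp add: t klein_metric_def)
  next
    case False
    let ?q = "klein_metric x u w / (sqrt (klein_metric x u u) * sqrt (klein_metric x w w))"
    have "?q = t / \<bar>t\<bar>" unfolding uu using pos by (simp add: t klein_metric_scaleR real_sqrt_mult mult.assoc)
    then have "\<bar>?q\<bar> \<le> 1" using False by simp
    then have "?q = cos (arccos ?q)" by (rule cos_arccos_abs[symmetric])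
    also have "arccos ?q = pi / 2" using ang by (simp only: tangent_angle_def)
    finally show ?thesis using pos False uu by simp
  qed
qed

lemma UNIV_4_distinct:
  assumes "{i, j, k, h} = (UNIV :: 4 set)"
  shows "i \<noteq> j" "i \<noteq> k" "i \<noteq> h" "j \<noteq> k" "j \<noteq> h" "k \<noteq> h"
proof -
  have "card (set [i, j, k, h]) = length [i, j, k, h]"
    by (simp only: list.set assms) simp
  then have "distinct [i, j, k, h]" by (rule card_distinct)
  then show "i \<noteq> j" "i \<noteq> k" "i \<noteq> h" "j \<noteq> k" "j \<noteq> h" "k \<noteq> h" by auto
qed

lemma UNIV_4_complete:
  assumes "i \<noteq> (j :: 4)"
  obtains k h where "{i, j, k, h} = (UNIV :: 4 set)"
proof -
  have "card (UNIV - {i, j}) = 2" using assms by (simp add: card_Diff_subset)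
  then obtain k h where "UNIV - {i, j} = {k, h}" by (meson card_2_iff)
  then have "{i, j, k, h} = UNIV" by auto
  then show ?thesis by (rule that)
qed

section \<open>From the polytope to the normals of its triangular faces\<close>

locale hyper_ideal =
  fixes p :: "4 \<Rightarrow> 4 \<Rightarrow> real^3"
  assumes hyper_ideal: "hyper_ideal_tetrahedron p"
begin

lemma vertex_in: "i \<noteq> j \<Longrightarrow> p i j \<in> trunc_polyhedron p"
  unfolding trunc_polyhedron_def trunc_vertices_def by (intro hull_inc) auto

lemma vertex_in_ball: "i \<noteq> j \<Longrightarrow> p i j \<in> ball 0 1"
proof -
  assume "i \<noteq> j"
  moreover have "trunc_polyhedron p \<subseteq> ball 0 1"
    using hyper_ideal by (simp only: hyper_ideal_tetrahedron_def)
  ultimately show ?thesis using vertex_in by blast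
qed

lemma vertex_inj: "i \<noteq> j \<Longrightarrow> k \<noteq> h \<Longrightarrow> p i j = p k h \<Longrightarrow> i = k \<and> j = h"
proof -
  assume "i \<noteq> j" "k \<noteq> h" "p i j = p k h"
  moreover have "inj_on (\<lambda>(i, j). p i j) {(i, j). i \<noteq> j}"
    using hyper_ideal by (simp add: hyper_ideal_tetrahedron_def)
  ultimately show ?thesis
    using inj_onD[of "\<lambda>(i, j). p i j" "{(i, j). i \<noteq> j}" "(i, j)" "(k, h)"] by simp
qed

lemma facet: "triangle_face p i facet_of trunc_polyhedron p"
proof -
  have "{F. F facet_of trunc_polyhedron p} = range (triangle_face p) \<union> range (hexagon_face p)"
    using hyper_ideal by (simp only: hyper_ideal_tetrahedron_def)
  then show ?thesis by blast
qed

lemma aff_dim_triangle: "aff_dim {p i j | j. j \<noteq> i} = 2"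
proof -
  have "aff_dim (triangle_face p i) = aff_dim (trunc_polyhedron p) - 1"
    using facet[of i] by (simp add: facet_of_def)
  also have "\<dots> = 2" using hyper_ideal by (simp add: hyper_ideal_tetrahedron_def)
  finally show ?thesis by (simp add: triangle_face_def aff_dim_convex_hull)
qed

lemma triangle_not_collinear:
  assumes u: "{i, j, k, h} = (UNIV :: 4 set)"
  shows "p i k - p i j \<noteq> t *\<^sub>R (p i h - p i j)"
proof
  assume "p i k - p i j = t *\<^sub>R (p i h - p i j)"
  then have "p i k = (1 - t) *\<^sub>R p i j + t *\<^sub>R p i h" by (simp add: algebra_simps)
  then have "p i k \<in> affine hull {p i j, p i h}" unfolding affine_hull_2 by force
  moreover have "p i j \<in> affine hull {p i j, p i h}" "p i h \<in> affine hull {p i j, p i h}"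
    by (simp_all add: hull_inc)
  ultimately have "{p i j, p i k, p i h} \<subseteq> affine hull {p i j, p i h}" by simp
  moreover have "{p i j | j. j \<noteq> i} \<subseteq> {p i j, p i k, p i h}"
  proof
    fix x assume "x \<in> {p i j | j. j \<noteq> i}"
    then obtain m where "x = p i m" "m \<noteq> i" by blast
    moreover have "m \<in> {i, j, k, h}" by (simp only: u UNIV_I)
    ultimately show "x \<in> {p i j, p i k, p i h}" by auto
  qed
  ultimately have "{p i j | j. j \<noteq> i} \<subseteq> affine hull {p i j, p i h}" by (rule order_trans[rotated])
  from aff_dim_subset[OF this] have "2 \<le> aff_dim {p i j, p i h}"
    by (simp only: aff_dim_triangle aff_dim_affine_hull)
  then show False by (simp split: if_splits)
qed

text \<open>The inequality is strict because a vertex of the polytope on a facet is extreme in that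
  facet too, hence one of the three points spanning the triangle; \<open>p j i\<close> differs from
  these by injectivity. The affine hull is the whole plane since both have dimension 2.\<close>

lemma supporting_plane:
  "\<exists>a b. a \<noteq> 0 \<and> affine hull {p i j | j. j \<noteq> i} = {x. a \<bullet> x = b} \<and>
    (\<forall>j. j \<noteq> i \<longrightarrow> a \<bullet> p i j = b \<and> a \<bullet> p j i < b)"
proof -
  let ?T = "trunc_polyhedron p"
  have "finite (trunc_vertices p)"
  proof -
    have "trunc_vertices p \<subseteq> range (\<lambda>(i, j). p i j)" by (auto simp: trunc_vertices_def)
    then show ?thesis by (rule finite_subset) simp
  qed
  then have "polyhedron ?T"
    unfolding trunc_polyhedron_def by (intro polytope_imp_polyhedron polytope_convex_hull)
  from facet_of_polyhedron[OF this facet[of i]] obtain a b where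
    ab: "a \<noteq> 0" "?T \<subseteq> {x. a \<bullet> x \<le> b}" "triangle_face p i = ?T \<inter> {x. a \<bullet> x = b}" by blast
  have sub: "{p i j | j. j \<noteq> i} \<subseteq> triangle_face p i"
    unfolding triangle_face_def by (rule hull_subset)
  then have eq: "a \<bullet> p i j = b" if "j \<noteq> i" for j using that ab(3) by blast
  have "a \<bullet> p j i < b" if j: "j \<noteq> i" for j
  proof -
    have T: "p j i \<in> ?T" using j by (intro vertex_in)
    then have "a \<bullet> p j i \<le> b" using ab(2) by blast
    moreover have "a \<bullet> p j i \<noteq> b"
    proof
      assume "a \<bullet> p j i = b"
      then have F: "p j i \<in> triangle_face p i" using T ab(3) by blast
      have "{x. x extreme_point_of ?T} = trunc_vertices p"
        using hyper_ideal by (simp only: hyper_ideal_tetrahedron_def)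
      moreover have "p j i \<in> trunc_vertices p" using j by (auto simp: trunc_vertices_def)
      ultimately have "p j i extreme_point_of ?T" by blast
      then have "p j i extreme_point_of triangle_face p i"
        using F ab(3) by (auto simp: extreme_point_of_def)
      then have "p j i \<in> {p i j | j. j \<noteq> i}"
        unfolding triangle_face_def by (rule extreme_point_of_convex_hull)
      then obtain m where "p j i = p i m" "m \<noteq> i" by blast
      then show False using j vertex_inj[of j i i m] by simp
    qed
    ultimately show ?thesis by simp
  qed
  moreover have "affine hull {p i j | j. j \<noteq> i} = {x. a \<bullet> x = b}"
  proof -
    have "{p i j | j. j \<noteq> i} \<subseteq> {x. a \<bullet> x = b}" using eq by auto
    moreover have "aff_dim {p i j | j. j \<noteq> i} = aff_dim {x. a \<bullet> x = b}"
      using ab(1) by (simp add: aff_dim_triangle aff_dim_hyperplane)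
    ultimately have "affine hull {p i j | j. j \<noteq> i} = affine hull {x. a \<bullet> x = b}"
      using aff_dim_eq_full_gen by blast
    then show ?thesis by (simp add: affine_hyperplane hull_same)
  qed
  ultimately show ?thesis using ab(1) eq by blast
qed

lemma right_angle:
  assumes "i \<noteq> j" "i \<noteq> k" "j \<noteq> k"
  shows "klein_metric (p i j) (p j i - p i j) (p i k - p i j) = 0"
proof (rule orthogonal_of_tangent_angle)
  show "p i j \<in> ball 0 1" using assms by (intro vertex_in_ball)
  show "p i k - p i j \<noteq> 0" using vertex_inj[of i j i k] assms by auto
  show "tangent_angle (p i j) (p j i - p i j) (p i k - p i j) = pi / 2"
    using hyper_ideal assms by (simp add: hyper_ideal_tetrahedron_def hyp_angle_def)
qed

abbreviation "X i j \<equiv> hyperboloid (p i j)"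

abbreviation "len i j \<equiv> hyp_dist (p i j) (p j i)"

text \<open>One unit normal serves all three edges at the triangle: the right angles make every edge
  leave it orthogonally. In the hyperboloid model, \<open>X j i\<close> is then reached from
  \<open>X i j\<close> by the geodesic with initial velocity \<open>- v\<close>.\<close>

lemma normal_exists:
  "\<exists>v. minkowski v v = 1 \<and> (\<forall>j. j \<noteq> i \<longrightarrow> minkowski v (X i j) = 0 \<and> len i j > 0 \<and>
     X j i = cosh (len i j) *\<^sub>R X i j - sinh (len i j) *\<^sub>R v)"
proof -
  from supporting_plane[of i] obtain a b where
    ab: "a \<noteq> 0" "affine hull {p i j | j. j \<noteq> i} = {x. a \<bullet> x = b}" and
    eqlt: "\<forall>j. j \<noteq> i \<longrightarrow> a \<bullet> p i j = b \<and> a \<bullet> p j i < b"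
    by blast
  have eq: "a \<bullet> p i j = b" and lt: "a \<bullet> p j i < b" if "j \<noteq> i" for j
    using eqlt that by auto
  define N where "N = (a, b)"
  obtain j0 where j0: "j0 \<noteq> i"
  proof -
    have "UNIV \<noteq> {i}"
    proof
      assume "UNIV = {i}"
      then have "card (UNIV :: 4 set) = card {i}" by simp
      then show False by simp
    qed
    then show ?thesis using that by blast
  qed
  \<comment> \<open>The plane meets the open unit ball, so by Cauchy-Schwarz its Minkowski normal
    \<open>N\<close> is spacelike.\<close>
  have NN: "minkowski N N > 0"
  proof -
    have "b\<^sup>2 = (a \<bullet> p i j0)\<^sup>2" using eq[OF j0] by simp
    also have "\<dots> \<le> (a \<bullet> a) * (p i j0 \<bullet> p i j0)" by (rule Cauchy_Schwarz_ineq)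
    also have "\<dots> < (a \<bullet> a) * 1"
      using inner_less_1[OF vertex_in_ball[of i j0]] j0 ab(1) by (intro mult_strict_left_mono) auto
    finally show ?thesis by (simp add: minkowski_def N_def power2_eq_square)
  qed
  define n where "n = sqrt (minkowski N N)"
  have n: "n > 0" "n\<^sup>2 = minkowski N N" using NN by (simp_all add: n_def)
  define v where "v = (1 / n) *\<^sub>R N"
  have "minkowski v v = 1" using n by (simp add: v_def minkowski_simps power2_eq_square flip: n(2))
  have sq: "sqrt (1 - x \<bullet> x) > 0" if "x \<in> ball 0 1" for x :: "real^3"
    using that[THEN inner_less_1] by simp
  have NX: "minkowski N (X i j) = 0" if "j \<noteq> i" for j
    using eq[OF that] by (simp add: N_def minkowski_hyperboloid)
  have NY: "minkowski N (X j i) < 0" if "j \<noteq> i" for j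
    using lt[OF that] sq[OF vertex_in_ball[OF that]]
    unfolding N_def minkowski_hyperboloid by (simp only: divide_less_0_iff) simp
  have "minkowski v (X i j) = 0 \<and> len i j > 0 \<and>
     X j i = cosh (len i j) *\<^sub>R X i j - sinh (len i j) *\<^sub>R v" if j: "j \<noteq> i" for j
  proof -
    let ?x = "p i j" and ?y = "p j i"
    have xy: "?x \<in> ball 0 1" "?y \<in> ball 0 1" using j vertex_in_ball[of i j] vertex_in_ball[of j i] by auto
    have XX: "minkowski (X i j) (X i j) = -1" "minkowski (X j i) (X j i) = -1"
      using xy by (simp_all add: minkowski_hyperboloid_self)
    \<comment> \<open>\<open>C\<close> will turn out to be the hyperbolic cosine of the edge length,
      and \<open>W\<close> is the part of \<open>X j i\<close> tangent to the hyperboloid at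
      \<open>X i j\<close>.\<close>
    define C where "C = - minkowski (X i j) (X j i)"
    define W where "W = X j i - C *\<^sub>R X i j"
    have WX: "minkowski W (X i k) = 0" if k: "k \<noteq> i" for k
    proof (cases "k = j")
      case True
      then show ?thesis by (simp add: W_def minkowski_simps XX C_def minkowski_commute)
    next
      case False
      have z: "p i k \<in> ball 0 1" using k vertex_in_ball[of i k] by auto
      have "klein_metric ?x (?y - ?x) (p i k - ?x) = 0" using right_angle[of i j k] j k False by auto
      then have "tangent_form (X i j) (X j i) (X i k) = 0"
        unfolding klein_metric_hyperboloid[OF xy z] using sq[OF xy(2)] sq[OF z] sq[OF xy(1)] by auto
      then show ?thesis by (simp add: W_def minkowski_simps tangent_form_def C_def)
    qed
    have Wp: "fst W \<bullet> p i k = snd W" if k: "k \<noteq> i" for k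
    proof -
      have "p i k \<in> ball 0 1" using k vertex_in_ball[of i k] by auto
      from WX[OF k] sq[OF this] show ?thesis
        using minkowski_hyperboloid[of "fst W" "snd W" "p i k"] by auto
    qed
    have plane: "fst W \<bullet> z = snd W" if "a \<bullet> z = b" for z
    proof -
      have "affine hull {p i j | j. j \<noteq> i} \<subseteq> {z. fst W \<bullet> z = snd W}"
        by (rule hull_minimal) (use Wp affine_hyperplane in auto)
      then show ?thesis using ab(2) that by blast
    qed
    \<comment> \<open>\<open>W\<close> vanishes on the plane with normal \<open>a\<close>, so the
      component \<open>w\<close> of \<open>fst W\<close> orthogonal to \<open>a\<close>, a direction
      of that plane, must be 0; hence \<open>W\<close> is a multiple of \<open>N\<close>.\<close>
    define m where "m = (fst W \<bullet> a) / (a \<bullet> a)"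
    have aa: "a \<bullet> a > 0" using ab(1) by simp
    define w where "w = fst W - m *\<^sub>R a"
    have aw: "a \<bullet> w = 0" using aa by (simp add: w_def m_def inner_simps inner_commute)
    have "fst W \<bullet> w = 0"
      using plane[of "?x + w"] plane[of ?x] eq[OF j] aw by (simp add: inner_simps)
    moreover have "w \<bullet> w = fst W \<bullet> w - m * (a \<bullet> w)"
      by (subst (1) w_def) (simp add: inner_diff_left)
    ultimately have "w \<bullet> w = 0" using aw by simp
    then have W1: "fst W = m *\<^sub>R a" by (simp add: w_def)
    then have "snd W = m * b" using plane[OF eq[OF j]] eq[OF j] by simp
    with W1 have W: "W = m *\<^sub>R N" by (simp add: N_def prod_eq_iff)
    have "m * minkowski N N = minkowski N W" by (simp add: W minkowski_simps)
    also have "\<dots> = minkowski N (X j i)" using NX[OF j] by (simp add: W_def minkowski_simps)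
    finally have "m * minkowski N N < 0" using NY[OF j] by simp
    then have "m < 0" using NN by (simp add: mult_less_0_iff)
    define \<sigma> where "\<sigma> = - m * n"
    have \<sigma>: "\<sigma> > 0" using \<open>m < 0\<close> n(1) by (simp add: \<sigma>_def mult_neg_pos)
    have W\<sigma>: "W = - \<sigma> *\<^sub>R v" using n by (simp add: W \<sigma>_def v_def)
    have "minkowski W W = C\<^sup>2 - 1"
      by (simp add: W_def minkowski_simps XX minkowski_commute[of "X j i" "X i j"]) (simp add: C_def power2_eq_square)
    moreover have "minkowski W W = \<sigma>\<^sup>2"
      unfolding W\<sigma> minkowski_simps using \<open>minkowski v v = 1\<close> by (simp add: power2_eq_square)
    ultimately have C2: "C\<^sup>2 = 1 + \<sigma>\<^sup>2" by simp
    have C_eq: "C = (1 - ?x \<bullet> ?y) / (sqrt (1 - ?x \<bullet> ?x) * sqrt (1 - ?y \<bullet> ?y))"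
      unfolding C_def hyperboloid_def minkowski_simps by (simp add: minkowski_def minus_divide_left)
    have "?x \<bullet> ?y < 1"
    proof -
      have "?x \<bullet> ?y \<le> norm ?x * norm ?y" by (rule norm_cauchy_schwarz)
      also have "\<dots> < 1 * 1" using xy by (intro mult_strict_mono') auto
      finally show ?thesis by simp
    qed
    then have C0: "C > 0" unfolding C_eq using sq[OF xy(1)] sq[OF xy(2)] by simp
    have C1: "C > 1"
    proof (rule ccontr)
      assume "\<not> C > 1"
      then have "C\<^sup>2 \<le> 1" using C0 by (intro power_le_one) auto
      moreover have "\<sigma>\<^sup>2 > 0" using \<sigma> by simp
      ultimately show False using C2 by linarith
    qed
    have len: "len i j = arcosh C" by (simp add: hyp_dist_def C_eq)
    have cosh: "cosh (len i j) = C" unfolding len using C1 by (intro cosh_arcosh_real) simp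
    have "len i j \<ge> 0" unfolding len using C1 by simp
    moreover have "len i j \<noteq> 0"
    proof
      assume "len i j = 0"
      with cosh have "C = 1" by (simp only: cosh_0)
      with C1 show False by simp
    qed
    ultimately have pos: "len i j > 0" by simp
    have "(sinh (len i j))\<^sup>2 = \<sigma>\<^sup>2" unfolding sinh_square_eq cosh C2 by simp
    moreover have "sinh (len i j) > 0" using pos by simp
    ultimately have sinh: "sinh (len i j) = \<sigma>" using \<sigma>
      by (metis less_imp_le power2_eq_imp_eq)
    have "X j i = C *\<^sub>R X i j - \<sigma> *\<^sub>R v" using W\<sigma> by (simp add: W_def algebra_simps)
    moreover have "minkowski v (X i j) = 0" using NX[OF j] by (simp add: v_def minkowski_simps)
    ultimately show ?thesis using pos by (simp add: cosh sinh)
  qed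
  with \<open>minkowski v v = 1\<close> show ?thesis by blast
qed

lemma len_commute: "len j i = len i j"
  by (simp add: hyp_dist_def inner_commute mult.commute)

definition normal :: "4 \<Rightarrow> (real^3) \<times> real" where
  "normal i = (SOME v. minkowski v v = 1 \<and> (\<forall>j. j \<noteq> i \<longrightarrow> minkowski v (X i j) = 0 \<and> len i j > 0 \<and>
     X j i = cosh (len i j) *\<^sub>R X i j - sinh (len i j) *\<^sub>R v))"

lemma normal:
  "minkowski (normal i) (normal i) = 1"
  "j \<noteq> i \<Longrightarrow> minkowski (normal i) (X i j) = 0"
  "j \<noteq> i \<Longrightarrow> len i j > 0"
  "j \<noteq> i \<Longrightarrow> X j i = cosh (len i j) *\<^sub>R X i j - sinh (len i j) *\<^sub>R normal i"
  using someI_ex[OF normal_exists[of i]] unfolding normal_def[symmetric] by auto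

text \<open>Reading the geodesic from both ends and eliminating \<open>X j i\<close> expresses the
  vertex by two normals. This identifies \<open>- cosh\<close> of the edge lengths as the
  off-diagonal Gram entries of the normals.\<close>

lemma vertex_normals:
  assumes "j \<noteq> i"
  shows "X i j = (1 / sinh (len i j)) *\<^sub>R (normal j + cosh (len i j) *\<^sub>R normal i)"
    and "minkowski (normal i) (normal j) = - cosh (len i j)"
proof -
  define c s where "c = cosh (len i j)" and "s = sinh (len i j)"
  have s: "s > 0" using normal(3)[OF assms] by (simp add: s_def)
  have cs: "c\<^sup>2 - 1 = s\<^sup>2" by (simp add: c_def s_def sinh_square_eq)
  have 1: "X j i = c *\<^sub>R X i j - s *\<^sub>R normal i" using normal(4)[OF assms] by (simp add: c_def s_def)
  have 2: "X i j = c *\<^sub>R X j i - s *\<^sub>R normal j"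
    using normal(4)[of i j] assms by (simp add: c_def s_def len_commute[of i j])
  have "s *\<^sub>R normal j = c *\<^sub>R (c *\<^sub>R X i j - s *\<^sub>R normal i) - X i j"
    using 2 unfolding 1 by (simp add: algebra_simps)
  also have "\<dots> = (c\<^sup>2 - 1) *\<^sub>R X i j - (c * s) *\<^sub>R normal i"
    by (simp add: algebra_simps power2_eq_square)
  also have "\<dots> = s *\<^sub>R (s *\<^sub>R X i j - c *\<^sub>R normal i)"
    unfolding cs by (simp add: algebra_simps power2_eq_square)
  finally have nj: "normal j = s *\<^sub>R X i j - c *\<^sub>R normal i" using s by simp
  then show "X i j = (1 / sinh (len i j)) *\<^sub>R (normal j + cosh (len i j) *\<^sub>R normal i)"
    using s by (simp add: c_def s_def)
  show "minkowski (normal i) (normal j) = - cosh (len i j)"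
    unfolding nj minkowski_simps normal(1) normal(2)[OF assms] by (simp add: c_def)
qed

text \<open>Since vertices are combinations of normals, all products at \<open>p i j\<close> become
  polynomials in the hyperbolic cosines, and the normalising factors cancel in the quotient. Its
  absolute value is below 1 because the triangle is not degenerate.\<close>

lemma dihedral:
  assumes u: "{i, j, k, h} = (UNIV :: 4 set)" and l: "has_edge_lengths p l"
  shows "\<bar>phi l i j k h\<bar> < 1"
    and "hyp_dihedral (p i j) (p j i) (p i k) (p i h) = arccos (phi l i j k h)"
proof -
  note d = UNIV_4_distinct[OF u]
  define c where "c = (\<lambda>a b. cosh (l {a, b}))"
  define s where "s = (\<lambda>a b. sinh (l {a, b}))"
  have cc: "c a b = c b a" "s a b = s b a" for a b by (simp_all add: c_def s_def insert_commute)
  have len: "len a b = l {a, b}" if "a \<noteq> b" for a b using l that by (simp add: has_edge_lengths_def)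
  have s_pos: "s a b > 0" if "a \<noteq> b" for a b
    using normal(3)[of b a] that len[of a b] by (simp add: s_def)
  have s2: "(s a b)\<^sup>2 = (c a b)\<^sup>2 - 1" for a b by (simp add: s_def c_def sinh_square_eq)
  have XN: "X i a = (1 / s i a) *\<^sub>R (normal a + c i a *\<^sub>R normal i)" if "a \<noteq> i" for a
    using vertex_normals(1)[OF that] len[of i a] that by (simp add: c_def s_def)
  have NN: "minkowski (normal a) (normal b) = - c a b" if "a \<noteq> b" for a b
    using vertex_normals(2)[of b a] len[of a b] that by (simp add: c_def)
  have Xab: "minkowski (X i a) (X i b) = - (c a b + c i a * c i b) / (s i a * s i b)"
    if "a \<noteq> i" "b \<noteq> i" "a \<noteq> b" for a b
    using that by (simp add: XN minkowski_simps NN normal(1) cc(1)[of _ i] field_simps diff_divide_distrib)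
  have Xaa: "minkowski (X i a) (X i a) = -1" if "a \<noteq> i" for a
    using that by (intro minkowski_hyperboloid_self vertex_in_ball) auto
  define T where "T = tangent_form (X i j)"
  have sp: "s i j > 0" "s i k > 0" "s i h > 0" using s_pos d by auto
  have Tkh: "T (X i k) (X i h) = (c i k * c i h + c j k * c j h + c i j * c i k * c j h + c i j * c i h * c j k
         - (s i j)\<^sup>2 * c k h) / ((s i j)\<^sup>2 * s i k * s i h)"
  proof -
    have "T (X i k) (X i h) * ((s i j)\<^sup>2 * s i k * s i h) =
       - (c k h + c i k * c i h) * (s i j)\<^sup>2 + (c j k + c i j * c i k) * (c j h + c i j * c i h)"
      unfolding T_def tangent_form_def using d sp by (simp add: Xab field_simps power2_eq_square)
    also have "\<dots> = c i k * c i h + c j k * c j h + c i j * c i k * c j h + c i j * c i h * c j k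
         - (s i j)\<^sup>2 * c k h"
      unfolding s2 by algebra
    finally show ?thesis using sp by (simp add: field_simps)
  qed
  have Taa: "T (X i a) (X i a) = (2 * c i j * c i a * c j a + (c i j)\<^sup>2 + (c i a)\<^sup>2 + (c j a)\<^sup>2 - 1) / (s i j * s i a)\<^sup>2"
    if a: "a \<noteq> i" "a \<noteq> j" for a
  proof -
    have sa: "s i a > 0" using a s_pos by auto
    have "T (X i a) (X i a) * (s i j * s i a)\<^sup>2 =
       - (s i j)\<^sup>2 * (s i a)\<^sup>2 + (c j a + c i j * c i a)\<^sup>2"
      unfolding T_def tangent_form_def Xaa[OF a(1)] using d a sp sa
      by (simp add: Xab field_simps power2_eq_square)
    also have "\<dots> = 2 * c i j * c i a * c j a + (c i j)\<^sup>2 + (c i a)\<^sup>2 + (c j a)\<^sup>2 - 1"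
      unfolding s2 by algebra
    finally show ?thesis using sp sa by (simp add: field_simps)
  qed
  have xyz: "p i j \<in> ball 0 1" "p i k \<in> ball 0 1" "p i h \<in> ball 0 1" using d vertex_in_ball by auto
  let ?K = "klein_metric (p i j)" and ?z = "p i k - p i j" and ?w = "p i h - p i j"
  \<comment> \<open>The hexagons' right angles make the projection in \<open>normal_part\<close>
    trivial: the dihedral angle is the angle of the triangular face at \<open>p i j\<close>.\<close>
  have "?K (p j i - p i j) ?z = 0" "?K (p j i - p i j) ?w = 0"
    using right_angle d by auto
  then have ang: "hyp_dihedral (p i j) (p j i) (p i k) (p i h) =
      arccos (?K ?z ?w / (sqrt (?K ?z ?z) * sqrt (?K ?w ?w)))"
    by (simp add: hyp_dihedral_def normal_part_def tangent_angle_def)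
  define rx ry rz where "rx = sqrt (1 - p i j \<bullet> p i j)" and "ry = sqrt (1 - p i k \<bullet> p i k)" and "rz = sqrt (1 - p i h \<bullet> p i h)"
  have r: "rx > 0" "ry > 0" "rz > 0" using xyz[THEN inner_less_1] by (simp_all add: rx_def ry_def rz_def)
  have rx2: "1 - p i j \<bullet> p i j = rx\<^sup>2" using xyz(1)[THEN inner_less_1] by (simp add: rx_def)
  have K: "?K ?z ?w = ry * rz / rx\<^sup>2 * T (X i k) (X i h)"
    "?K ?z ?z = ry * ry / rx\<^sup>2 * T (X i k) (X i k)" "?K ?w ?w = rz * rz / rx\<^sup>2 * T (X i h) (X i h)"
    unfolding T_def klein_metric_hyperboloid[OF xyz] klein_metric_hyperboloid[OF xyz(1,2,2)]
      klein_metric_hyperboloid[OF xyz(1,3,3)] rx2 ry_def rz_def by simp_all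
  have sqK: "sqrt (?K ?z ?z) = ry / rx * sqrt (T (X i k) (X i k))"
    "sqrt (?K ?w ?w) = rz / rx * sqrt (T (X i h) (X i h))"
    unfolding K using r by (simp_all add: real_sqrt_mult real_sqrt_divide)
  have quot: "?K ?z ?w / (sqrt (?K ?z ?z) * sqrt (?K ?w ?w)) = phi l i j k h"
  proof -
    have "?K ?z ?w / (sqrt (?K ?z ?z) * sqrt (?K ?w ?w)) =
        T (X i k) (X i h) / (sqrt (T (X i k) (X i k)) * sqrt (T (X i h) (X i h)))"
      unfolding sqK K(1) using r by (simp add: power2_eq_square)
    also have "sqrt (T (X i k) (X i k)) =
        sqrt (2 * c i j * c i k * c j k + (c i j)\<^sup>2 + (c i k)\<^sup>2 + (c j k)\<^sup>2 - 1) / (s i j * s i k)"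
      using Taa[of k] d sp by (simp add: real_sqrt_divide)
    also have "sqrt (T (X i h) (X i h)) =
        sqrt (2 * c i j * c i h * c j h + (c i j)\<^sup>2 + (c i h)\<^sup>2 + (c j h)\<^sup>2 - 1) / (s i j * s i h)"
      using Taa[of h] d sp by (simp add: real_sqrt_divide)
    finally show ?thesis
      unfolding Tkh phi_def Let_def c_def[symmetric] s_def[symmetric] using sp
      by (simp add: power2_eq_square)
  qed
  show "hyp_dihedral (p i j) (p j i) (p i k) (p i h) = arccos (phi l i j k h)"
    unfolding ang quot ..
  have "\<bar>?K ?z ?w\<bar> < sqrt (?K ?z ?z) * sqrt (?K ?w ?w)"
  proof (rule klein_metric_Cauchy_Schwarz)
    show "?w \<noteq> 0" using vertex_inj[of i h i j] d by auto
    show "?z \<noteq> t *\<^sub>R ?w" for t by (rule triangle_not_collinear[OF u])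
  qed fact
  moreover have quot_less: "\<bar>a / q\<bar> < 1" if "\<bar>a\<bar> < q" for a q :: real
  proof -
    have "q > 0" using that abs_ge_zero[of a] by linarith
    then show ?thesis using that by simp
  qed
  ultimately have "\<bar>?K ?z ?w / (sqrt (?K ?z ?z) * sqrt (?K ?w ?w))\<bar> < 1"
    by (intro quot_less)
  then show "\<bar>phi l i j k h\<bar> < 1" unfolding quot .
qed

end

lemma hyper_ideal_lengths_phi:
  assumes "l \<in> hyper_ideal_lengths" "{i, j, k, h} = (UNIV :: 4 set)"
  shows "\<bar>phi l i j k h\<bar> < 1" "l {i, j} > 0"
proof -
  from assms obtain p where p: "hyper_ideal_tetrahedron p" "has_edge_lengths p l"
    by (auto simp: hyper_ideal_lengths_def)
  interpret hyper_ideal p by standard fact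
  show "\<bar>phi l i j k h\<bar> < 1" by (rule dihedral) fact+
  show "l {i, j} > 0"
    using normal(3)[of j i] p(2) UNIV_4_distinct[OF assms(2)] by (simp add: has_edge_lengths_def)
qed

text \<open>The \<open>THE\<close> is well defined because every tetrahedron with these lengths
  yields \<open>arccos\<close> of \<open>phi\<close>, which depends on the lengths alone.\<close>

lemma dihedral_angle_eq_ext:
  assumes l: "l \<in> hyper_ideal_lengths" and "card \<epsilon> = 2"
  shows "dihedral_angle l \<epsilon> = ext_dihedral_angle l \<epsilon>"
proof -
  from l obtain p where p: "hyper_ideal_tetrahedron p" "has_edge_lengths p l"
    by (auto simp: hyper_ideal_lengths_def)
  obtain i j where \<epsilon>: "\<epsilon> = {i, j}" "i \<noteq> j" using assms(2) by (meson card_2_iff)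
  from UNIV_4_complete[OF this(2)] obtain k h where u: "{i, j, k, h} = UNIV" .
  have eq: "hyp_dihedral (p i j) (p j i) (p i k) (p i h) = ext_dihedral_angle l {i, j}"
    if "hyper_ideal_tetrahedron p" "has_edge_lengths p l" "{i, j, k, h} = UNIV" for p i j k h
  proof -
    interpret hyper_ideal p by standard fact
    have "max (-1) (min (phi l i j k h) 1) = phi l i j k h"
      using dihedral(1)[OF that(3,2)] by linarith
    then show ?thesis using dihedral(2)[OF that(3,2)] ext_dihedral_angle_eq[OF that(3)] by simp
  qed
  show ?thesis unfolding dihedral_angle_def
  proof (rule the_equality)
    show "\<exists>p i j k h. hyper_ideal_tetrahedron p \<and> has_edge_lengths p l \<and> \<epsilon> = {i, j} \<and>
        {i, j, k, h} = UNIV \<and> ext_dihedral_angle l \<epsilon> = hyp_dihedral (p i j) (p j i) (p i k) (p i h)"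
      using p \<epsilon>(1) u eq[OF p u] by metis
  qed (use eq in metis)
qed

section \<open>Peano's existence theorem\<close>

lemma continuous_on_delay:
  fixes f :: "'a::euclidean_space \<Rightarrow> 'a" and h :: real
  assumes "continuous_on UNIV f" and "h > 0" and v: "continuous_on {0..1} v"
  shows "continuous_on {0..1} (\<lambda>s. f (v (max 0 (s - h))))"
proof -
  have "continuous_on {0..1} (\<lambda>s. max 0 (s - h))"
    by (intro continuous_on_max continuous_intros)
  moreover have "(\<lambda>s. max 0 (s - h)) ` {0..1} \<subseteq> {0..1}" using assms(2) by auto
  ultimately have "continuous_on {0..1} (\<lambda>s. v (max 0 (s - h)))"
    by (rule continuous_on_compose2[OF v])
  then show ?thesis by (rule continuous_on_compose2[OF assms(1)]) auto
qed

text \<open>Tonelli's device: with the argument delayed by \<open>h\<close>, the integral over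
  \<open>{0..t}\<close> involves the solution only up to time \<open>t - h\<close>, and iteration
  becomes stationary.\<close>

lemma delayed_equation:
  fixes f :: "'a::euclidean_space \<Rightarrow> 'a" and h :: real
  assumes f: "continuous_on UNIV f" and h: "h > 0"
  shows "\<exists>v. continuous_on {0..1} v \<and>
    (\<forall>t\<in>{0..1}. v t = x0 + integral {0..t} (\<lambda>s. f (v (max 0 (s - h)))))"
proof -
  define \<Phi> where "\<Phi> = (\<lambda>v t. x0 + integral {0..t} (\<lambda>s. f (v (max 0 (s - h)))))"
  define W where "W = (\<lambda>k. (\<Phi> ^^ k) (\<lambda>_. x0))"
  have W_Suc: "W (Suc k) = \<Phi> (W k)" for k by (simp add: W_def)
  have int: "continuous_on {0..1} (\<lambda>s. f (v (max 0 (s - h))))" if "continuous_on {0..1} v" for v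
    by (rule continuous_on_delay[OF f h that])
  have cont: "continuous_on {0..1} (W k)" for k
  proof (induction k)
    case 0
    show ?case by (simp add: W_def)
  next
    case (Suc k)
    show ?case unfolding W_Suc \<Phi>_def
      by (intro continuous_intros indefinite_integral_continuous_1 integrable_continuous_real int Suc)
  qed
  \<comment> \<open>Each application of \<open>\<Phi>\<close> extends the interval of agreement by
    \<open>h\<close>; after \<open>k\<close> steps it has length \<open>k * h\<close>.\<close>
  have stat: "W (Suc k) t = W k t" if "t \<le> real k * h" "0 \<le> t" "t \<le> 1" for k t
    using that
  proof (induction k arbitrary: t)
    case 0
    then show ?case by (simp add: W_def \<Phi>_def)
  next
    case (Suc k)
    have "integral {0..t} (\<lambda>s. f (W (Suc k) (max 0 (s - h)))) =
        integral {0..t} (\<lambda>s. f (W k (max 0 (s - h))))"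
    proof (rule integral_cong)
      fix s assume s: "s \<in> {0..t}"
      have "W (Suc k) (max 0 (s - h)) = W k (max 0 (s - h))"
        by (rule Suc.IH) (use s Suc.prems h in \<open>auto simp: algebra_simps\<close>)
      then show "f (W (Suc k) (max 0 (s - h))) = f (W k (max 0 (s - h)))" by simp
    qed
    then show ?case unfolding W_Suc[of "Suc k"] W_Suc[of k] unfolding \<Phi>_def W_Suc[of k]
      by (simp add: W_Suc \<Phi>_def)
  qed
  obtain k :: nat where k: "1 / h \<le> real k" using real_arch_simple by blast
  have "W k t = x0 + integral {0..t} (\<lambda>s. f (W k (max 0 (s - h))))" if "t \<in> {0..1}" for t
  proof -
    have "1 \<le> real k * h" using k h by (simp add: field_simps)
    then have "W (Suc k) t = W k t" using that by (intro stat) auto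
    then show ?thesis by (simp add: W_Suc \<Phi>_def)
  qed
  then show ?thesis using cont by blast
qed

text \<open>The delayed solutions are bounded and Lipschitz with the common constant
  \<open>M\<close>, so Arzela-Ascoli yields a uniformly convergent subsequence as the delay tends to
  0; dominated convergence takes the integral equation to the limit.\<close>

lemma peano_unit_interval:
  fixes f :: "'a::euclidean_space \<Rightarrow> 'a"
  assumes f: "continuous_on UNIV f" and M: "\<And>x. norm (f x) \<le> M"
  shows "\<exists>u. u 0 = x0 \<and> (\<forall>t\<in>{0..1}. (u has_vector_derivative f (u t)) (at t within {0..1}))"
proof -
  have M0: "M \<ge> 0" using M[of 0] norm_ge_zero order_trans by blast
  define h where "h = (\<lambda>n. inverse (real (Suc n)))"
  have h0: "h n > 0" for n by (simp add: h_def)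
  from delayed_equation[OF f h0, of x0] obtain v where
    v_cont: "\<And>n. continuous_on {0..1} (v n)" and
    v_eq: "\<And>n t. t \<in> {0..1} \<Longrightarrow> v n t = x0 + integral {0..t} (\<lambda>s. f (v n (max 0 (s - h n))))"
    by metis
  have int: "continuous_on {0..1} (\<lambda>s. f (v n (max 0 (s - h n))))" for n
    by (rule continuous_on_delay[OF f h0 v_cont])
  have v_deriv: "(v n has_vector_derivative f (v n (max 0 (t - h n)))) (at t within {0..1})"
    if "t \<in> {0..1}" for n t
  proof -
    have "((\<lambda>t. x0 + integral {0..t} (\<lambda>s. f (v n (max 0 (s - h n)))))
        has_vector_derivative f (v n (max 0 (t - h n)))) (at t within {0..1})"
      using integral_has_vector_derivative[OF int that]
      by (auto intro!: derivative_eq_intros)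
    then show ?thesis
      by (rule has_vector_derivative_transform[rotated 2]) (use that v_eq in auto)
  qed
  have lip: "norm (v n x - v n y) \<le> M * norm (x - y)" if "x \<in> {0..1}" "y \<in> {0..1}" for n x y
  proof (rule differentiable_bound[where f' = "\<lambda>t z. z *\<^sub>R f (v n (max 0 (t - h n)))" and S = "{0..1}"])
    fix t :: real assume "t \<in> {0..1}"
    then show "(v n has_derivative (\<lambda>z. z *\<^sub>R f (v n (max 0 (t - h n))))) (at t within {0..1})"
      using v_deriv unfolding has_vector_derivative_def by blast
    show "onorm (\<lambda>z. z *\<^sub>R f (v n (max 0 (t - h n)))) \<le> M"
      by (rule onorm_le) (use mult_right_mono[OF M abs_ge_zero] in \<open>simp add: mult.commute\<close>)
  qed (use that in auto)
  have v0: "v n 0 = x0" for n using v_eq[of 0 n] by simp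
  have bound: "norm (v n x) \<le> norm x0 + M" if "x \<in> {0..1}" for n x
  proof -
    have "norm (v n x) \<le> norm x0 + norm (v n x - v n 0)"
      using norm_triangle_sub[of "v n x" x0] by (simp add: v0)
    also have "norm (v n x - v n 0) \<le> M * norm (x - 0)" by (rule lip) (use that in auto)
    also have "\<dots> \<le> M" using that M0 by (simp add: mult_left_le)
    finally show ?thesis by simp
  qed
  obtain g k where g: "continuous_on {0..1} g" "strict_mono (k :: nat \<Rightarrow> nat)"
    "\<And>e. 0 < e \<Longrightarrow> \<exists>N. \<forall>n x. n \<ge> N \<and> x \<in> {0..1} \<longrightarrow> norm (v (k n) x - g x) < e"
  proof (rule Arzela_Ascoli[of "{0..1::real}" v "norm x0 + M"])
    fix x e :: real assume x: "x \<in> {0..1}" and e: "0 < e"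
    show "\<exists>d. 0 < d \<and> (\<forall>n y. y \<in> {0..1} \<and> norm (x - y) < d \<longrightarrow> norm (v n x - v n y) < e)"
    proof (intro exI conjI allI impI)
      show "0 < e / (M + 1)" using e M0 by simp
      fix n y assume y: "y \<in> {0..1} \<and> norm (x - y) < e / (M + 1)"
      have "norm (v n x - v n y) \<le> M * norm (x - y)" by (rule lip) (use x y in auto)
      also have "\<dots> \<le> (M + 1) * norm (x - y)" by (simp add: mult_right_mono)
      also have "\<dots> < e" using y M0 by (simp add: field_simps)
      finally show "norm (v n x - v n y) < e" .
    qed
  qed (use bound in auto)
  have pw: "(\<lambda>n. v (k n) x) \<longlonglongrightarrow> g x" if "x \<in> {0..1}" for x
    using g(3) that by (intro LIMSEQ_I) blast
  have hk: "(\<lambda>n. h (k n)) \<longlonglongrightarrow> 0"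
    using LIMSEQ_subseq_LIMSEQ[OF LIMSEQ_inverse_real_of_nat g(2)] by (simp add: h_def o_def)
  have pwd: "(\<lambda>n. f (v (k n) (max 0 (x - h (k n))))) \<longlonglongrightarrow> f (g x)" if x: "x \<in> {0..1}" for x
  proof (rule continuous_on_tendsto_compose[OF f])
    have "(\<lambda>n. v (k n) (max 0 (x - h (k n))) - v (k n) x) \<longlonglongrightarrow> 0"
    proof (rule Lim_null_comparison)
      show "\<forall>\<^sub>F n in sequentially. norm (v (k n) (max 0 (x - h (k n))) - v (k n) x) \<le> M * h (k n)"
      proof (rule always_eventually, rule allI)
        fix n
        have "norm (v (k n) (max 0 (x - h (k n))) - v (k n) x) \<le> M * norm (max 0 (x - h (k n)) - x)"
          by (rule lip) (use x h0[of "k n"] in auto)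
        also have "\<dots> \<le> M * h (k n)"
          using x h0[of "k n"] M0 by (intro mult_left_mono) auto
        finally show "norm (v (k n) (max 0 (x - h (k n))) - v (k n) x) \<le> M * h (k n)" .
      qed
      show "(\<lambda>n. M * h (k n)) \<longlonglongrightarrow> 0" using tendsto_mult[OF tendsto_const hk, of M] by simp
    qed
    from tendsto_add[OF this pw[OF x]] show "(\<lambda>n. v (k n) (max 0 (x - h (k n)))) \<longlonglongrightarrow> g x" by simp
  qed auto
  have g_eq: "g t = x0 + integral {0..t} (\<lambda>s. f (g s))" if t: "t \<in> {0..1}" for t
  proof -
    have "(\<lambda>n. integral {0..t} (\<lambda>s. f (v (k n) (max 0 (s - h (k n)))))) \<longlonglongrightarrow> integral {0..t} (\<lambda>s. f (g s))"
    proof (rule dominated_convergence(2)[where h = "\<lambda>_. M"])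
      show "(\<lambda>s. f (v (k n) (max 0 (s - h (k n))))) integrable_on {0..t}" for n
        by (intro integrable_continuous_real continuous_on_subset[OF int]) (use t in auto)
    qed (use M pwd t in auto)
    from tendsto_add[OF tendsto_const this, of x0]
    have "(\<lambda>n. v (k n) t) \<longlonglongrightarrow> x0 + integral {0..t} (\<lambda>s. f (g s))"
      by (simp add: v_eq[OF t])
    with pw[OF t] show ?thesis by (rule LIMSEQ_unique)
  qed
  have "(g has_vector_derivative f (g t)) (at t within {0..1})" if t: "t \<in> {0..1}" for t
  proof -
    have "continuous_on {0..1} (\<lambda>s. f (g s))" by (rule continuous_on_compose2[OF f g(1)]) auto
    from integral_has_vector_derivative[OF this t]
    have "((\<lambda>t. x0 + integral {0..t} (\<lambda>s. f (g s))) has_vector_derivative f (g t)) (at t within {0..1})"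
      by (auto intro!: derivative_eq_intros)
    then show ?thesis
      by (rule has_vector_derivative_transform[rotated 2]) (use t g_eq in auto)
  qed
  moreover have "g 0 = x0" using g_eq[of 0] by simp
  ultimately show ?thesis by blast
qed

text \<open>The equation is autonomous, so unit-interval solutions can be concatenated, each
  restarting from the end point \<open>X k\<close> of its predecessor.\<close>

theorem peano_global:
  fixes f :: "'a::euclidean_space \<Rightarrow> 'a"
  assumes f: "continuous_on UNIV f" and M: "\<And>x. norm (f x) \<le> M"
  shows "\<exists>u. u 0 = x0 \<and> (\<forall>t\<ge>0. (u has_vector_derivative f (u t)) (at t within {0..}))"
proof -
  from peano_unit_interval[OF f M] obtain sol where
    sol0: "\<And>x. sol x 0 = x" and
    sol: "\<And>x t. t \<in> {0..1} \<Longrightarrow> (sol x has_vector_derivative f (sol x t)) (at t within {0..1})"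
    by metis
  define X where "X = rec_nat x0 (\<lambda>_ x. sol x 1)"
  have X: "X 0 = x0" "X (Suc k) = sol (X k) 1" for k by (simp_all add: X_def)
  define u where "u = (\<lambda>t. sol (X (nat \<lfloor>t\<rfloor>)) (t - real (nat \<lfloor>t\<rfloor>)))"
  have u_eq: "u t = sol (X k) (t - real k)" if "real k \<le> t" "t \<le> real k + 1" for k t
  proof (cases "t = real k + 1")
    case True
    then have "nat \<lfloor>t\<rfloor> = Suc k" by simp
    then show ?thesis using True by (simp add: u_def X sol0)
  next
    case False
    then have "\<lfloor>t\<rfloor> = int k" using that by (intro floor_unique) auto
    then show ?thesis by (simp add: u_def)
  qed
  have u_deriv: "(u has_vector_derivative f (u t)) (at t within {real k..real k + 1})"
    if t: "real k \<le> t" "t \<le> real k + 1" for k t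
  proof -
    have "((\<lambda>t. sol (X k) (t - real k)) has_vector_derivative 1 *\<^sub>R f (sol (X k) (t - real k)))
        (at t within {real k..real k + 1})"
    proof (rule vector_diff_chain_within[of "\<lambda>t. t - real k" 1 t _ "sol (X k)", unfolded o_def])
      show "((\<lambda>t. t - real k) has_vector_derivative 1) (at t within {real k..real k + 1})"
        by (auto intro!: derivative_eq_intros)
      have "(\<lambda>t. t - real k) ` {real k..real k + 1} = {0..1}" by (simp add: image_diff_atLeastAtMost)
      then show "(sol (X k) has_vector_derivative f (sol (X k) (t - real k)))
          (at (t - real k) within (\<lambda>t. t - real k) ` {real k..real k + 1})"
        using sol[of "t - real k" "X k"] t by simp
    qed
    then have "((\<lambda>t. sol (X k) (t - real k)) has_vector_derivative f (u t))
        (at t within {real k..real k + 1})" using u_eq[OF t] by simp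
    then show ?thesis
      by (rule has_vector_derivative_transform[rotated 2]) (use t u_eq in auto)
  qed
  have "(u has_vector_derivative f (u t)) (at t within {0..})" if "t \<ge> 0" for t
  proof -
    define k where "k = nat \<lfloor>t\<rfloor>"
    have k: "real k \<le> t" "t < real k + 1" using that by (auto simp: k_def)
    have right: "(u has_vector_derivative f (u t)) (at t within {real k..})"
    proof -
      have "at t within {real k..real k + 1} = at t within {real k..}"
        by (rule at_within_nhd[of _ "{..<real k + 1}"]) (use k in auto)
      then show ?thesis using u_deriv[of k t] k by simp
    qed
    show ?thesis
    proof (cases "real k < t")
      case True
      have "at t within {real k..} = at t within {0..}"
        by (rule at_within_nhd[of _ "{real k<..}"]) (use True in auto)
      then show ?thesis using right by simp
    next
      case False
      then have tk: "t = real k" using k by simp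
      show ?thesis
      proof (cases k)
        case 0
        then show ?thesis using right by simp
      next
        case (Suc j)
        have tj: "real j \<le> t" "t \<le> real j + 1" using tk Suc by auto
        \<comment> \<open>At an integer time the left derivative comes from the preceding piece and
          the right one from the next; both equal \<open>f (u t)\<close>.\<close>
        have "(u has_vector_derivative f (u t)) (at t within {real j..real j + 1} \<union> {real k..})"
          using u_deriv[OF tj] right
          unfolding has_vector_derivative_def has_derivative_within by (auto intro: Lim_Un)
        also have "{real j..real j + 1} \<union> {real k..} = {real j..}" using Suc by auto
        also have "at t within {real j..} = at t within {0..}"
          by (rule at_within_nhd[of _ "{real j<..}"]) (use tk Suc in auto)
        finally show ?thesis .
      qed
    qed
  qed
  moreover have "u 0 = x0" by (simp add: u_def sol0 X)
  ultimately show ?thesis by blast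
qed

section \<open>Monotonicity of the curvature\<close>

lemma phi_eq_cos_angle:
  "phi l i j k h = cos_angle (cosh (l {i, j})) (cosh (l {i, k})) (cosh (l {i, h}))
     (cosh (l {j, k})) (cosh (l {j, h})) (cosh (l {k, h}))"
  by (simp add: phi_def Let_def cos_angle_def edge_poly_def face_poly_def sinh_square_eq)

lemma ext_dihedral_angle_eq_angle:
  assumes "{i, j, k, h} = (UNIV :: 4 set)"
  shows "ext_dihedral_angle l {i, j} =
    angle (l {i, j}) (l {i, k}) (l {i, h}) (l {j, k}) (l {j, h}) (l {k, h})"
  unfolding ext_dihedral_angle_eq[OF assms] phi_eq_cos_angle angle_def ..

definition edge_vector :: "(4 set \<Rightarrow> real) \<Rightarrow> real6" where
  "edge_vector l = (l {1, 2}, l {1, 3}, l {1, 4}, l {2, 3}, l {2, 4}, l {3, 4})"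

lemma sum_pairs:
  fixes g :: "4 set \<Rightarrow> real"
  shows "(\<Sum>\<epsilon> | card \<epsilon> = 2. g \<epsilon>) = g {1, 2} + g {1, 3} + g {1, 4} + g {2, 3} + g {2, 4} + g {3, 4}"
proof -
  have "{\<epsilon> :: 4 set. card \<epsilon> = 2} = {{1, 2}, {1, 3}, {1, 4}, {2, 3}, {2, 4}, {3, 4}}"
  proof (intro equalityI subsetI)
    fix \<epsilon> :: "4 set" assume "\<epsilon> \<in> {\<epsilon>. card \<epsilon> = 2}"
    then obtain i j where "\<epsilon> = {i, j}" "i \<noteq> j" by (auto simp: card_2_iff)
    then show "\<epsilon> \<in> {{1, 2}, {1, 3}, {1, 4}, {2, 3}, {2, 4}, {3, 4}}"
      using exhaust_4[of i] exhaust_4[of j] by (auto simp: insert_commute)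
  qed auto
  then show ?thesis by (simp add: doubleton_eq_iff)
qed

lemma sum_ext_dihedral_angle:
  "(\<Sum>\<epsilon> | card \<epsilon> = 2. x \<epsilon> * ext_dihedral_angle l \<epsilon>) = angle_pairing (edge_vector l) (edge_vector x)"
proof -
  have c: "l {b, a} = l {a, b}" for a b by (simp add: insert_commute)
  have e: "ext_dihedral_angle l {1, 2} = angle (l {1, 2}) (l {1, 3}) (l {1, 4}) (l {2, 3}) (l {2, 4}) (l {3, 4})"
    "ext_dihedral_angle l {1, 3} = angle (l {1, 3}) (l {1, 2}) (l {1, 4}) (l {3, 2}) (l {3, 4}) (l {2, 4})"
    "ext_dihedral_angle l {1, 4} = angle (l {1, 4}) (l {1, 2}) (l {1, 3}) (l {4, 2}) (l {4, 3}) (l {2, 3})"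
    "ext_dihedral_angle l {2, 3} = angle (l {2, 3}) (l {2, 1}) (l {2, 4}) (l {3, 1}) (l {3, 4}) (l {1, 4})"
    "ext_dihedral_angle l {2, 4} = angle (l {2, 4}) (l {2, 1}) (l {2, 3}) (l {4, 1}) (l {4, 3}) (l {1, 3})"
    "ext_dihedral_angle l {3, 4} = angle (l {3, 4}) (l {3, 1}) (l {3, 2}) (l {4, 1}) (l {4, 2}) (l {1, 2})"
    by (rule ext_dihedral_angle_eq_angle, unfold UNIV_4, blast)+
  show ?thesis
    unfolding sum_pairs e c[of 3 2] c[of 2 1] c[of 4 2] c[of 3 1] c[of 4 1] c[of 4 3]
    by (simp add: angle_pairing_def edge_vector_def)
qed

lemma norm_edge_vector: "(norm (edge_vector x))\<^sup>2 = (\<Sum>\<epsilon> | card \<epsilon> = 2. (x \<epsilon>)\<^sup>2)"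
  unfolding sum_pairs by (simp add: edge_vector_def norm_Pair real_norm_def)

lemma edge_vector_diff: "edge_vector (\<lambda>\<epsilon>. x \<epsilon> - y \<epsilon>) = edge_vector x - edge_vector y"
  by (simp add: edge_vector_def)

lemma edge_vector_hyper_ideal:
  assumes "l \<in> hyper_ideal_lengths"
  shows "edge_vector l \<in> hyper_ideal6"
proof -
  have U: "{1, 2, 3, 4} = (UNIV :: 4 set)" by (simp only: UNIV_4)
  have pos: "l {i, j} > 0" if "i \<noteq> j" for i j
    using UNIV_4_complete[OF that] hyper_ideal_lengths_phi(2)[OF assms] by metis
  then have p: "l {1, 2} > 0" "l {1, 3} > 0" "l {1, 4} > 0" "l {2, 3} > 0" "l {2, 4} > 0" "l {3, 4} > 0"
    by auto
  have "\<bar>phi l 1 2 3 4\<bar> < 1" by (rule hyper_ideal_lengths_phi[OF assms U])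
  then have "gram (cosh (l {1, 2})) (cosh (l {1, 3})) (cosh (l {1, 4}))
     (cosh (l {2, 3})) (cosh (l {2, 4})) (cosh (l {3, 4})) > 0"
    unfolding phi_eq_cos_angle using abs_cos_angle_less_iff p cosh_gt_1 by blast
  with p show ?thesis by (simp add: hyper_ideal6_def edge_vector_def pos6_def gram6_def cosh6_def)
qed

lemma ext_dihedral_angle_strongly_monotone:
  assumes l0: "l0 \<in> hyper_ideal_lengths" and R: "R > 0"
  shows "\<exists>k>0. \<forall>l. (\<forall>\<epsilon>. card \<epsilon> = 2 \<longrightarrow> l \<epsilon> > 0 \<and> \<bar>l \<epsilon> - l0 \<epsilon>\<bar> \<le> R) \<longrightarrow>
    k * (\<Sum>\<epsilon> | card \<epsilon> = 2. (l \<epsilon> - l0 \<epsilon>)\<^sup>2) \<le>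
    (\<Sum>\<epsilon> | card \<epsilon> = 2. (l \<epsilon> - l0 \<epsilon>) * (ext_dihedral_angle l \<epsilon> - ext_dihedral_angle l0 \<epsilon>))"
proof -
  \<comment> \<open>Six coordinates of size at most \<open>R\<close> have Euclidean norm at most
    \<open>3 * R\<close>.\<close>
  have "3 * R > 0" using R by simp
  from angle_pairing_strongly_monotone[OF edge_vector_hyper_ideal[OF l0] this] obtain k where k: "k > 0"
    and mono: "\<And>l. l \<in> pos6 \<Longrightarrow> norm (l - edge_vector l0) \<le> 3 * R \<Longrightarrow>
      k * (norm (l - edge_vector l0))\<^sup>2 \<le> angle_pairing l (l - edge_vector l0) - angle_pairing (edge_vector l0) (l - edge_vector l0)"
    by blast
  have "k * (\<Sum>\<epsilon> | card \<epsilon> = 2. (l \<epsilon> - l0 \<epsilon>)\<^sup>2) \<le>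
    (\<Sum>\<epsilon> | card \<epsilon> = 2. (l \<epsilon> - l0 \<epsilon>) * (ext_dihedral_angle l \<epsilon> - ext_dihedral_angle l0 \<epsilon>))"
    if l: "\<forall>\<epsilon>. card \<epsilon> = 2 \<longrightarrow> l \<epsilon> > 0 \<and> \<bar>l \<epsilon> - l0 \<epsilon>\<bar> \<le> R" for l
  proof -
    have "edge_vector l \<in> pos6" using l by (simp add: edge_vector_def pos6_def)
    moreover have "norm (edge_vector l - edge_vector l0) \<le> 3 * R"
    proof (rule power2_le_imp_le)
      have le: "(l \<epsilon> - l0 \<epsilon>)\<^sup>2 \<le> R\<^sup>2" if "card \<epsilon> = 2" for \<epsilon>
        using l that R by (intro abs_le_square_iff[THEN iffD1]) auto
      have "(norm (edge_vector l - edge_vector l0))\<^sup>2 = (\<Sum>\<epsilon> | card \<epsilon> = 2. (l \<epsilon> - l0 \<epsilon>)\<^sup>2)"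
        by (simp only: norm_edge_vector flip: edge_vector_diff)
      also have "\<dots> \<le> (\<Sum>\<epsilon> :: 4 set | card \<epsilon> = 2. R\<^sup>2)" by (intro sum_mono le) simp
      also have "\<dots> \<le> (3 * R)\<^sup>2" by (subst sum_pairs) (simp add: power_mult_distrib)
      finally show "(norm (edge_vector l - edge_vector l0))\<^sup>2 \<le> (3 * R)\<^sup>2" .
    qed (use R in simp)
    ultimately have "k * (norm (edge_vector l - edge_vector l0))\<^sup>2 \<le>
      angle_pairing (edge_vector l) (edge_vector l - edge_vector l0) - angle_pairing (edge_vector l0) (edge_vector l - edge_vector l0)" by (rule mono)
    then show ?thesis
      by (simp only: norm_edge_vector right_diff_distrib sum_subtractf sum_ext_dihedral_angle flip: edge_vector_diff)
  qed
  with k show ?thesis by blast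
qed

lemma edges_eq: "edges G = edge_proj G ` tet_edges"
  by (auto simp: edges_def quotient_def edge_proj_def)

lemma tet_edges_eq: "tet_edges = UNIV \<times> {\<epsilon>. card \<epsilon> = 2}"
  by (auto simp: tet_edges_def)

text \<open>Grouping the edges of the tetrahedra by their class under the gluing splits a pairing
  with the curvature into contributions of single tetrahedra.\<close>

lemma sum_edges:
  fixes G :: "('t::finite) gluing"
  shows "(\<Sum>e\<in>edges G. y e * (\<Sum>(T, \<epsilon>) | (T, \<epsilon>) \<in> tet_edges \<and> edge_proj G (T, \<epsilon>) = e. F T \<epsilon>)) =
    (\<Sum>T\<in>UNIV. \<Sum>\<epsilon> | card \<epsilon> = 2. y (edge_proj G (T, \<epsilon>)) * (F T \<epsilon> :: real))"
proof -
  have "(\<Sum>T\<in>UNIV. \<Sum>\<epsilon> | card \<epsilon> = 2. y (edge_proj G (T, \<epsilon>)) * F T \<epsilon>) =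
      (\<Sum>(T, \<epsilon>)\<in>tet_edges. y (edge_proj G (T, \<epsilon>)) * F T \<epsilon>)"
    unfolding tet_edges_eq by (rule sum.cartesian_product)
  also have "\<dots> = (\<Sum>e\<in>edge_proj G ` tet_edges. \<Sum>z | z \<in> tet_edges \<and> edge_proj G z = e.
      (case z of (T, \<epsilon>) \<Rightarrow> y (edge_proj G (T, \<epsilon>)) * F T \<epsilon>))"
    by (rule sum.image_gen) simp
  also have "\<dots> = (\<Sum>e\<in>edges G. y e * (\<Sum>(T, \<epsilon>) | (T, \<epsilon>) \<in> tet_edges \<and> edge_proj G (T, \<epsilon>) = e. F T \<epsilon>))"
  proof -
    have "{(T, \<epsilon>). (T, \<epsilon>) \<in> tet_edges \<and> edge_proj G (T, \<epsilon>) = e} =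
        {z. z \<in> tet_edges \<and> edge_proj G z = e}" for e by auto
    then show ?thesis unfolding edges_eq sum_distrib_left by (auto intro!: sum.cong)
  qed
  finally show ?thesis by simp
qed

lemma ricci_curvature_eq_ext:
  assumes "hyper_ideal_metric G l"
  shows "ricci_curvature G l e = ext_ricci_curvature G l e"
proof -
  have "dihedral_angle (tet_lengths G l T) \<epsilon> = ext_dihedral_angle (tet_lengths G l T) \<epsilon>"
    if "(T, \<epsilon>) \<in> tet_edges" for T \<epsilon>
    using assms that by (intro dihedral_angle_eq_ext) (auto simp: hyper_ideal_metric_def tet_edges_def)
  then show ?thesis unfolding ricci_curvature_def ext_ricci_curvature_def
    by (intro arg_cong[of _ _ "\<lambda>x. 2 * pi - x"] sum.cong) auto
qed

text \<open>As the curvature of \<open>l0\<close> vanishes, that of \<open>l\<close> is minus a sum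
  of angle differences, and each tetrahedron contributes its own monotonicity. The least of the
  finitely many constants works for all.\<close>

lemma ext_ricci_curvature_strongly_monotone:
  fixes G :: "('t::finite) gluing"
  assumes l0: "zero_curvature_metric G l0" and R: "R > 0"
  shows "\<exists>k>0. \<forall>l. pos_on_edges G l \<and> (\<forall>e\<in>edges G. \<bar>l e - l0 e\<bar> \<le> R) \<longrightarrow>
    (\<Sum>e\<in>edges G. (l e - l0 e) * ext_ricci_curvature G l e) \<le> - k * (\<Sum>e\<in>edges G. (l e - l0 e)\<^sup>2)"
proof -
  have hi: "hyper_ideal_metric G l0" using l0 by (simp add: zero_curvature_metric_def)
  then have "tet_lengths G l0 T \<in> hyper_ideal_lengths" for T by (simp add: hyper_ideal_metric_def)
  then have "\<forall>T. \<exists>k>0. \<forall>l. (\<forall>\<epsilon>. card \<epsilon> = 2 \<longrightarrow> l \<epsilon> > 0 \<and> \<bar>l \<epsilon> - tet_lengths G l0 T \<epsilon>\<bar> \<le> R) \<longrightarrow>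
    k * (\<Sum>\<epsilon> | card \<epsilon> = 2. (l \<epsilon> - tet_lengths G l0 T \<epsilon>)\<^sup>2) \<le>
    (\<Sum>\<epsilon> | card \<epsilon> = 2. (l \<epsilon> - tet_lengths G l0 T \<epsilon>) *
      (ext_dihedral_angle l \<epsilon> - ext_dihedral_angle (tet_lengths G l0 T) \<epsilon>))"
    by (intro allI ext_dihedral_angle_strongly_monotone R)
  from choice[OF this] obtain k where k: "\<And>T. k T > 0"
    and mono: "\<And>T l. (\<forall>\<epsilon>. card \<epsilon> = 2 \<longrightarrow> l \<epsilon> > 0 \<and> \<bar>l \<epsilon> - tet_lengths G l0 T \<epsilon>\<bar> \<le> R) \<Longrightarrow>
    k T * (\<Sum>\<epsilon> | card \<epsilon> = 2. (l \<epsilon> - tet_lengths G l0 T \<epsilon>)\<^sup>2) \<le>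
    (\<Sum>\<epsilon> | card \<epsilon> = 2. (l \<epsilon> - tet_lengths G l0 T \<epsilon>) *
      (ext_dihedral_angle l \<epsilon> - ext_dihedral_angle (tet_lengths G l0 T) \<epsilon>))"
    by blast
  define m where "m = Min (range k)"
  have m: "m > 0" "\<And>T. m \<le> k T" unfolding m_def using k by (auto intro: Min_le)
  have "(\<Sum>e\<in>edges G. (l e - l0 e) * ext_ricci_curvature G l e) \<le> - m * (\<Sum>e\<in>edges G. (l e - l0 e)\<^sup>2)"
    if l: "pos_on_edges G l" "\<forall>e\<in>edges G. \<bar>l e - l0 e\<bar> \<le> R" for l
  proof -
    define y where "y = (\<lambda>e. l e - l0 e)"
    have E: "edge_proj G (T, \<epsilon>) \<in> edges G" if "card \<epsilon> = 2" for T \<epsilon>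
      using that by (auto simp: edges_eq tet_edges_def)
    have zero: "ext_ricci_curvature G l0 e = 0" if "e \<in> edges G" for e
      using l0 that ricci_curvature_eq_ext[OF hi] by (simp add: zero_curvature_metric_def)
    have "(\<Sum>e\<in>edges G. y e * ext_ricci_curvature G l e) =
        (\<Sum>e\<in>edges G. y e * (ext_ricci_curvature G l e - ext_ricci_curvature G l0 e))"
      using zero by (intro sum.cong) auto
    also have "\<dots> = - (\<Sum>e\<in>edges G. y e * (\<Sum>(T, \<epsilon>) | (T, \<epsilon>) \<in> tet_edges \<and> edge_proj G (T, \<epsilon>) = e.
        ext_dihedral_angle (tet_lengths G l T) \<epsilon> - ext_dihedral_angle (tet_lengths G l0 T) \<epsilon>))"
      by (simp add: ext_ricci_curvature_def sum_subtractf split_beta right_diff_distrib)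
    also have "\<dots> = - (\<Sum>T\<in>UNIV. \<Sum>\<epsilon> | card \<epsilon> = 2. y (edge_proj G (T, \<epsilon>)) *
        (ext_dihedral_angle (tet_lengths G l T) \<epsilon> - ext_dihedral_angle (tet_lengths G l0 T) \<epsilon>))"
      unfolding sum_edges ..
    also have "\<dots> \<le> - (\<Sum>T\<in>UNIV. m * (\<Sum>\<epsilon> | card \<epsilon> = 2. (y (edge_proj G (T, \<epsilon>)))\<^sup>2))"
    proof (intro le_imp_neg_le sum_mono)
      fix T :: 't
      have "m * (\<Sum>\<epsilon> | card \<epsilon> = 2. (y (edge_proj G (T, \<epsilon>)))\<^sup>2) \<le>
          k T * (\<Sum>\<epsilon> | card \<epsilon> = 2. (y (edge_proj G (T, \<epsilon>)))\<^sup>2)"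
        by (intro mult_right_mono m sum_nonneg) simp
      also have "\<dots> \<le> (\<Sum>\<epsilon> | card \<epsilon> = 2. y (edge_proj G (T, \<epsilon>)) *
        (ext_dihedral_angle (tet_lengths G l T) \<epsilon> - ext_dihedral_angle (tet_lengths G l0 T) \<epsilon>))"
        using mono[of "tet_lengths G l T" T] l E by (simp add: tet_lengths_def y_def pos_on_edges_def)
      finally show "m * (\<Sum>\<epsilon> | card \<epsilon> = 2. (y (edge_proj G (T, \<epsilon>)))\<^sup>2) \<le> \<dots>" .
    qed
    also have "\<dots> = - m * (\<Sum>z\<in>tet_edges. (y (edge_proj G z))\<^sup>2)"
      unfolding tet_edges_eq by (simp add: sum.cartesian_product split_beta flip: sum_distrib_left)
    also have "\<dots> \<le> - m * (\<Sum>e\<in>edges G. (y e)\<^sup>2)"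
    proof -
      \<comment> \<open>Every class has at least one representative among the edges of the
        tetrahedra.\<close>
      have "(\<Sum>e\<in>edges G. (y e)\<^sup>2) \<le> (\<Sum>z\<in>tet_edges. (y (edge_proj G z))\<^sup>2)"
        unfolding edges_eq using sum_image_le[of tet_edges "\<lambda>e. (y e)\<^sup>2" "edge_proj G"] by (simp add: o_def)
      then show ?thesis using m by simp
    qed
    finally show ?thesis by (simp add: y_def)
  qed
  then show ?thesis using m(1) by (intro exI[of _ m]) auto
qed

section \<open>Convergence of the flow\<close>

text \<open>The generalised Kullback-Leibler divergence of \<open>y\<close> from \<open>x\<close>.
  Its derivative in \<open>x\<close> is \<open>1 - y / x\<close>, which absorbs the factor
  \<open>l\<close> of the flow.\<close>

definition entropy :: "real \<Rightarrow> real \<Rightarrow> real" where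
  "entropy x y = x - y - y * ln (x / y)"

lemma entropy_nonneg:
  assumes "x > 0" "y > 0"
  shows "entropy x y \<ge> 0"
proof -
  have "y * ln (x / y) \<le> y * (x / y - 1)"
    using assms by (intro mult_left_mono ln_le_minus_one) auto
  also have "\<dots> = x - y" using assms by (simp add: right_diff_distrib)
  finally show ?thesis by (simp add: entropy_def)
qed

lemma entropy_le:
  assumes "x > 0" "y > 0"
  shows "entropy x y \<le> (x - y)\<^sup>2 / x"
proof -
  have "y * ln (y / x) \<le> y * (y / x - 1)"
    using assms by (intro mult_left_mono ln_le_minus_one) auto
  moreover have "ln (y / x) = - ln (x / y)" using assms by (simp add: ln_div)
  ultimately have "entropy x y \<le> x - y + y * (y / x - 1)" by (simp add: entropy_def)
  also have "\<dots> = (x - y)\<^sup>2 / x" using assms by (simp add: field_simps power2_eq_square)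
  finally show ?thesis .
qed

text \<open>Together with \<open>entropy_bounds_below\<close>, this shows that a bound on the
  divergence keeps \<open>x\<close> in a compact interval of positive numbers.\<close>

lemma entropy_bounds_above:
  assumes "x > 0" "y > 0"
  shows "x \<le> 2 * entropy x y + 2 * y"
proof -
  have "ln (x / y) = ln (x / y / 2) + ln 2" using assms by (simp add: ln_div ln_mult)
  also have "ln (x / y / 2) \<le> x / y / 2 - 1" using assms by (intro ln_le_minus_one) simp
  also have "ln (2::real) \<le> 1" using ln_le_minus_one[of 2] by simp
  finally have "ln (x / y) \<le> x / y / 2" by simp
  then have "y * ln (x / y) \<le> y * (x / y / 2)" using assms by (intro mult_left_mono) auto
  then show ?thesis using assms by (simp add: entropy_def)
qed

lemma entropy_bounds_below:
  assumes "x > 0" "y > 0"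
  shows "y * exp (- (entropy x y + y) / y) \<le> x"
proof -
  have "- (entropy x y + y) \<le> y * ln (x / y)" using assms by (simp add: entropy_def)
  then have "- (entropy x y + y) / y \<le> ln (x / y)" using assms by (simp add: field_simps)
  then have "exp (- (entropy x y + y) / y) \<le> exp (ln (x / y))" by (simp only: exp_le_cancel_iff)
  then show ?thesis using assms by (simp add: field_simps)
qed

text \<open>Apply \<open>ln u \<le> u - 1\<close> at \<open>u = sqrt (x / y)\<close>.\<close>

lemma square_le_entropy:
  assumes "0 < x" "x \<le> B" "0 < y" "y \<le> B"
  shows "(x - y)\<^sup>2 \<le> 4 * B * entropy x y"
proof -
  define a b where "a = sqrt x" and "b = sqrt y"
  have ab: "a > 0" "b > 0" "x = a\<^sup>2" "y = b\<^sup>2" using assms by (simp_all add: a_def b_def)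
  have "ln (x / y) = 2 * ln (a / b)" using ab by (simp add: ln_div ln_realpow)
  moreover have "ln (a / b) \<le> a / b - 1" using ab by (intro ln_le_minus_one) simp
  ultimately have "y * ln (x / y) \<le> y * (2 * (a / b - 1))"
    using assms by (intro mult_left_mono) auto
  also have "\<dots> = 2 * a * b - 2 * b\<^sup>2" using ab by (simp add: field_simps power2_eq_square)
  finally have "(a - b)\<^sup>2 \<le> entropy x y" by (simp add: entropy_def ab power2_eq_square algebra_simps)
  have "(x - y)\<^sup>2 = (a + b)\<^sup>2 * (a - b)\<^sup>2" by (simp add: ab power2_eq_square algebra_simps)
  also have "\<dots> \<le> (4 * B) * entropy x y"
  proof (rule mult_mono)
    have "(a + b)\<^sup>2 + (a - b)\<^sup>2 = 2 * x + 2 * y" by (simp add: ab power2_eq_square algebra_simps)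
    then have "(a + b)\<^sup>2 \<le> 2 * x + 2 * y" using zero_le_power2[of "a - b"] by linarith
    then show "(a + b)\<^sup>2 \<le> 4 * B" using assms by linarith
  qed (use assms \<open>(a - b)\<^sup>2 \<le> entropy x y\<close> in auto)
  finally show ?thesis .
qed

lemma nonincreasing_on_half_line:
  fixes V :: "real \<Rightarrow> real"
  assumes D: "\<And>t. t \<ge> 0 \<Longrightarrow> (V has_real_derivative D t) (at t within {0..})"
    and np: "\<And>t. t \<ge> 0 \<Longrightarrow> D t \<le> 0" and t: "t \<ge> 0"
  shows "V t \<le> V 0"
proof (rule DERIV_nonpos_imp_decreasing_open[OF t])
  fix s assume s: "0 < s" "s < t"
  then have "at s within {0..} = at s" by (intro at_within_interior) auto
  then show "\<exists>y. (V has_real_derivative y) (at s) \<and> y \<le> 0"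
    using D[of s] np[of s] s by auto
next
  have "continuous_on {0..} V"
    unfolding continuous_on_eq_continuous_within using D by (auto intro: DERIV_continuous)
  then show "continuous_on {0..t} V" by (rule continuous_on_subset) auto
qed

text \<open>
  Along the flow, the sum of \<open>entropy (l t e) (l0 e)\<close> over the edges has the derivative
  \<open>\<Sum>e. (l t e - l0 e) * K e\<close>.
\<close>

lemma flow_converges_exp_zero_curvature:
  fixes G :: "('t::finite) gluing"
  assumes zc: "zero_curvature_metric G l0" and flow: "ext_ricci_flow G l1 l"
  shows "flow_converges_exp G l l0"
proof -
  let ?E = "edges G"
  have l0_pos: "l0 e > 0" if "e \<in> ?E" for e
    using zc that by (simp add: zero_curvature_metric_def hyper_ideal_metric_def pos_on_edges_def)
  have pos: "pos_on_edges G (l t)" if "t \<ge> 0" for t using flow that by (simp add: ext_ricci_flow_def)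
  then have l_pos: "l t e > 0" if "t \<ge> 0" "e \<in> ?E" for t e using that by (simp add: pos_on_edges_def)
  have dl: "((\<lambda>s. l s e) has_real_derivative ext_ricci_curvature G (l t) e * l t e) (at t within {0..})"
    if "t \<ge> 0" "e \<in> ?E" for t e using flow that by (simp add: ext_ricci_flow_def)
  define V where "V = (\<lambda>t. \<Sum>e\<in>?E. entropy (l t e) (l0 e))"
  define S where "S = (\<lambda>t. \<Sum>e\<in>?E. (l t e - l0 e)\<^sup>2)"
  define D where "D = (\<lambda>t. \<Sum>e\<in>?E. (l t e - l0 e) * ext_ricci_curvature G (l t) e)"
  have S0: "S t \<ge> 0" for t by (simp add: S_def sum_nonneg)
  have V_deriv: "(V has_real_derivative D t) (at t within {0..})" if t: "t \<ge> 0" for t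
    unfolding V_def D_def
  proof (rule DERIV_sum)
    fix e assume e: "e \<in> ?E"
    note p = l_pos[OF t e] l0_pos[OF e]
    have "((\<lambda>s. ln (l s e / l0 e)) has_real_derivative ext_ricci_curvature G (l t) e) (at t within {0..})"
      using p by (auto intro!: derivative_eq_intros dl[OF t e] simp: field_simps)
    from DERIV_diff[OF DERIV_diff[OF dl[OF t e] DERIV_const] DERIV_cmult[OF this]]
    show "((\<lambda>s. entropy (l s e) (l0 e)) has_real_derivative
        (l t e - l0 e) * ext_ricci_curvature G (l t) e) (at t within {0..})"
      unfolding entropy_def by (rule DERIV_cong) (simp add: algebra_simps)
  qed
  have bound: "\<bar>l t e - l0 e\<bar> \<le> (\<Sum>e\<in>?E. \<bar>l t e - l0 e\<bar>) + 1" if "e \<in> ?E" for t e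
    using member_le_sum[of e ?E "\<lambda>e. \<bar>l t e - l0 e\<bar>"] that by simp
  \<comment> \<open>The radius, and with it \<open>k\<close>, may depend on \<open>t\<close> here,
    as only the sign of \<open>D t\<close> is wanted.\<close>
  have D_nonpos: "D t \<le> 0" if t: "t \<ge> 0" for t
  proof -
    have "(\<Sum>e\<in>?E. \<bar>l t e - l0 e\<bar>) + 1 > 0" by (intro add_nonneg_pos sum_nonneg) auto
    from ext_ricci_curvature_strongly_monotone[OF zc this] obtain k where "k > 0"
      and "pos_on_edges G (l t) \<and> (\<forall>e\<in>?E. \<bar>l t e - l0 e\<bar> \<le> (\<Sum>e\<in>?E. \<bar>l t e - l0 e\<bar>) + 1) \<longrightarrow>
        D t \<le> - k * S t" unfolding D_def S_def by blast
    then have "D t \<le> - k * S t" using pos[OF t] bound by blast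
    also have "\<dots> \<le> 0" using \<open>k > 0\<close> S0 by simp
    finally show ?thesis .
  qed
  have V_le: "V t \<le> V 0" if "t \<ge> 0" for t
    using V_deriv D_nonpos that by (rule nonincreasing_on_half_line)
  have ent: "entropy (l t e) (l0 e) \<le> V 0" if t: "t \<ge> 0" and e: "e \<in> ?E" for t e
  proof -
    have "entropy (l t e) (l0 e) \<le> V t" unfolding V_def
      using e l_pos[OF t] l0_pos by (intro member_le_sum[of e ?E "\<lambda>e. entropy (l t e) (l0 e)"] entropy_nonneg) auto
    then show ?thesis using V_le[OF t] by linarith
  qed
  have V0: "V t \<ge> 0" if "t \<ge> 0" for t
    unfolding V_def using l_pos[OF that] l0_pos by (intro sum_nonneg entropy_nonneg)
  \<comment> \<open>A common bound for \<open>l t e\<close> and \<open>l0 e\<close>, hence for their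
    distance; the added 1 guarantees a positive radius.\<close>
  define B where "B = 2 * V 0 + 2 * (\<Sum>e\<in>?E. l0 e) + 1"
  have l0_sum: "l0 e \<le> (\<Sum>e\<in>?E. l0 e)" if "e \<in> ?E" for e
    using that l0_pos by (intro member_le_sum) (auto intro: less_imp_le)
  have sum0: "(\<Sum>e\<in>?E. l0 e) \<ge> 0" using l0_pos by (intro sum_nonneg) (auto intro: less_imp_le)
  have B: "B > 0" using V0[of 0] sum0 by (simp add: B_def)
  have l_le: "l t e \<le> B" if "t \<ge> 0" "e \<in> ?E" for t e
    using entropy_bounds_above[OF l_pos[OF that] l0_pos] ent[OF that] l0_sum[OF that(2)] that(2)
    unfolding B_def by fastforce
  have l0_le: "l0 e \<le> B" if "e \<in> ?E" for e
    using l0_sum[OF that] V0[of 0] sum0 by (simp add: B_def)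
  have "\<exists>m>0. \<forall>t\<ge>0. \<forall>e\<in>?E. m \<le> l t e"
  proof -
    define f where "f = (\<lambda>e. l0 e * exp (- (V 0 + l0 e) / l0 e))"
    define m where "m = Min (insert 1 (f ` ?E))"
    have "m > 0" unfolding m_def using l0_pos by (subst Min_gr_iff) (auto simp: f_def)
    moreover have "m \<le> l t e" if t: "t \<ge> 0" and e: "e \<in> ?E" for t e
    proof -
      have "m \<le> f e" unfolding m_def using e by (intro Min_le) auto
      also have "\<dots> \<le> l0 e * exp (- (entropy (l t e) (l0 e) + l0 e) / l0 e)"
        unfolding f_def using l0_pos[OF e] ent[OF t e] by (simp add: divide_right_mono)
      also have "\<dots> \<le> l t e" by (rule entropy_bounds_below[OF l_pos[OF t e] l0_pos[OF e]])
      finally show ?thesis .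
    qed
    ultimately show ?thesis by blast
  qed
  then obtain m where m: "m > 0" "\<And>t e. t \<ge> 0 \<Longrightarrow> e \<in> ?E \<Longrightarrow> m \<le> l t e" by blast
  from ext_ricci_curvature_strongly_monotone[OF zc B] obtain k where k: "k > 0"
    and mono: "\<And>l'. pos_on_edges G l' \<Longrightarrow> (\<forall>e\<in>?E. \<bar>l' e - l0 e\<bar> \<le> B) \<Longrightarrow>
      (\<Sum>e\<in>?E. (l' e - l0 e) * ext_ricci_curvature G l' e) \<le> - k * (\<Sum>e\<in>?E. (l' e - l0 e)\<^sup>2)"
    by blast
  have D_le: "D t \<le> - (k * m) * V t" if t: "t \<ge> 0" for t
  proof -
    have "\<forall>e\<in>?E. \<bar>l t e - l0 e\<bar> \<le> B"
      using l_le[OF t] l0_le l_pos[OF t] l0_pos by (force simp: abs_le_iff)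
    from mono[OF pos[OF t] this] have "D t \<le> - k * S t" by (simp add: D_def S_def)
    also have "\<dots> \<le> - k * (m * V t)"
    proof -
      have "V t \<le> (\<Sum>e\<in>?E. (l t e - l0 e)\<^sup>2 / m)" unfolding V_def
      proof (rule sum_mono)
        fix e assume e: "e \<in> ?E"
        have "entropy (l t e) (l0 e) \<le> (l t e - l0 e)\<^sup>2 / l t e"
          by (rule entropy_le[OF l_pos[OF t e] l0_pos[OF e]])
        also have "\<dots> \<le> (l t e - l0 e)\<^sup>2 / m"
          using m(1) m(2)[OF t e] by (intro divide_left_mono) auto
        finally show "entropy (l t e) (l0 e) \<le> (l t e - l0 e)\<^sup>2 / m" .
      qed
      also have "\<dots> = S t / m" by (simp add: S_def sum_divide_distrib)
      finally have "m * V t \<le> S t" using m(1) by (simp add: field_simps)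
      then show ?thesis using k by simp
    qed
    finally show ?thesis by simp
  qed
  define r where "r = k * m"
  have r: "r > 0" using k m by (simp add: r_def)
  have V_exp: "V t \<le> V 0 * exp (- r * t)" if t: "t \<ge> 0" for t
  proof -
    have "(\<lambda>t. V t * exp (r * t)) t \<le> (\<lambda>t. V t * exp (r * t)) 0"
    proof (rule nonincreasing_on_half_line[where D = "\<lambda>t. (D t + r * V t) * exp (r * t)", OF _ _ t])
      show "((\<lambda>t. V t * exp (r * t)) has_real_derivative (D t + r * V t) * exp (r * t)) (at t within {0..})"
        if "t \<ge> 0" for t
        by (auto intro!: derivative_eq_intros V_deriv[OF that] simp: algebra_simps)
      show "(D t + r * V t) * exp (r * t) \<le> 0" if "t \<ge> 0" for t
        using D_le[OF that] by (simp add: mult_le_0_iff r_def)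
    qed
    then show ?thesis by (simp add: exp_minus field_simps)
  qed
  \<comment> \<open>The added 1 keeps \<open>A\<close> positive even if the flow starts at
    \<open>l0\<close>, where \<open>V 0 = 0\<close>.\<close>
  define A where "A = sqrt (4 * B * V 0) + 1"
  have A: "A > 0" using B V0[of 0] by (simp add: A_def add_nonneg_pos)
  \<comment> \<open>\<open>V\<close> controls squared distances, so taking the square root halves
    the rate.\<close>
  have conv: "L2_set (\<lambda>e. l t e - l0 e) ?E \<le> A * exp (- (r / 2) * t)" if t: "t \<ge> 0" for t
  proof -
    have "S t \<le> (\<Sum>e\<in>?E. 4 * B * entropy (l t e) (l0 e))" unfolding S_def
      by (intro sum_mono square_le_entropy l_pos l0_pos l_le l0_le t)
    also have "\<dots> = 4 * B * V t" by (simp add: V_def sum_distrib_left)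
    also have "\<dots> \<le> 4 * B * (V 0 * exp (- r * t))" using V_exp[OF t] B by simp
    finally have "sqrt (S t) \<le> sqrt (4 * B * V 0 * exp (- r * t))" by (simp add: mult.assoc)
    also have "\<dots> = sqrt (4 * B * V 0) * sqrt (exp (- r * t))" by (rule real_sqrt_mult)
    also have "sqrt (exp (- r * t)) = exp (- (r / 2) * t)"
    proof (rule real_sqrt_unique)
      show "(exp (- (r / 2) * t))\<^sup>2 = exp (- r * t)" by (simp add: power2_eq_square flip: exp_add)
    qed simp
    also have "sqrt (4 * B * V 0) * exp (- (r / 2) * t) \<le> A * exp (- (r / 2) * t)"
      by (intro mult_right_mono) (simp_all add: A_def)
    finally show ?thesis by (simp add: L2_set_def S_def)
  qed
  have "((\<lambda>t. l t e) \<longlongrightarrow> l0 e) at_top" if e: "e \<in> ?E" for e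
  proof -
    have "((\<lambda>t. l t e - l0 e) \<longlongrightarrow> 0) at_top"
    proof (rule Lim_null_comparison)
      show "\<forall>\<^sub>F t in at_top. norm (l t e - l0 e) \<le> A * exp (- (r / 2) * t)"
        using eventually_ge_at_top[of 0]
      proof eventually_elim
        case (elim t)
        have "\<bar>l t e - l0 e\<bar> \<le> L2_set (\<lambda>e. \<bar>l t e - l0 e\<bar>) ?E"
          using member_le_L2_set[of ?E e "\<lambda>e. \<bar>l t e - l0 e\<bar>"] e by simp
        also have "\<dots> = L2_set (\<lambda>e. l t e - l0 e) ?E" by (simp add: L2_set_def)
        finally show ?case using conv[OF elim] by simp
      qed
      have "((\<lambda>t. exp (- (r / 2) * t)) \<longlongrightarrow> 0) at_top"
        using r by (intro filterlim_compose[OF exp_at_bot] filterlim_tendsto_neg_mult_at_bot[OF tendsto_const _ filterlim_ident]) simp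
      from tendsto_mult_left[OF this, of A] show "((\<lambda>t. A * exp (- (r / 2) * t)) \<longlongrightarrow> 0) at_top" by simp
    qed
    from tendsto_add[OF this tendsto_const, of "l0 e"] show ?thesis by simp
  qed
  then show ?thesis
    unfolding flow_converges_exp_def flow_converges_def using A r conv
    by (intro conjI exI[of _ A] exI[of _ "r / 2"]) auto
qed

section \<open>Continuity and boundedness of the curvature, existence of the flow, and its
  limits\<close>

lemma tendsto_angle:
  assumes "(a \<longlongrightarrow> a0) F" "(b \<longlongrightarrow> b0) F" "(c \<longlongrightarrow> c0) F" "(d \<longlongrightarrow> d0) F" "(e \<longlongrightarrow> e0) F" "(f \<longlongrightarrow> f0) F"
  shows "((\<lambda>x. angle (a x) (b x) (c x) (d x) (e x) (f x)) \<longlongrightarrow> angle a0 b0 c0 d0 e0 f0) F"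
proof -
  let ?g = "\<lambda>p::real6. angle (fst p) (fst (snd p)) (fst (snd (snd p))) (fst (snd (snd (snd p))))
    (fst (snd (snd (snd (snd p))))) (snd (snd (snd (snd (snd p)))))"
  have "continuous_on UNIV ?g" by (intro continuous_on_angle continuous_intros)
  moreover have "((\<lambda>x. (a x, b x, c x, d x, e x, f x)) \<longlongrightarrow> (a0, b0, c0, d0, e0, f0)) F"
    by (intro tendsto_Pair assms)
  ultimately have "((\<lambda>x. ?g (a x, b x, c x, d x, e x, f x)) \<longlongrightarrow> ?g (a0, b0, c0, d0, e0, f0)) F"
    by (rule continuous_on_tendsto_compose) auto
  then show ?thesis by simp
qed

lemma tendsto_ext_ricci_curvature:
  fixes G :: "('t::finite) gluing"
  assumes "\<And>e. e \<in> edges G \<Longrightarrow> ((\<lambda>x. l x e) \<longlongrightarrow> l0 e) F"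
  shows "((\<lambda>x. ext_ricci_curvature G (l x) e) \<longlongrightarrow> ext_ricci_curvature G l0 e) F"
proof -
  have *: "((\<lambda>x. ext_dihedral_angle (tet_lengths G (l x) T) \<epsilon>) \<longlongrightarrow> ext_dihedral_angle (tet_lengths G l0 T) \<epsilon>) F"
    if card: "card \<epsilon> = 2" for T \<epsilon>
  proof -
    obtain i j where \<epsilon>: "\<epsilon> = {i, j}" "i \<noteq> j" using card by (meson card_2_iff)
    from UNIV_4_complete[OF this(2)] obtain k h where u: "{i, j, k, h} = UNIV" .
    have *: "((\<lambda>x. tet_lengths G (l x) T {v, w}) \<longlongrightarrow> tet_lengths G l0 T {v, w}) F" if "v \<noteq> w" for v w
    proof -
      have "(T, {v, w}) \<in> tet_edges" using that by (simp add: tet_edges_def)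
      then have "edge_proj G (T, {v, w}) \<in> edges G" unfolding edges_eq by (rule imageI)
      then show ?thesis unfolding tet_lengths_def by (rule assms)
    qed
    show ?thesis
      unfolding \<epsilon>(1) ext_dihedral_angle_eq_angle[OF u]
      by (rule tendsto_angle; rule *; rule UNIV_4_distinct[OF u])
  qed
  show ?thesis unfolding ext_ricci_curvature_def
  proof (intro tendsto_diff tendsto_const tendsto_sum)
    fix z assume z: "z \<in> {(T, \<epsilon>). (T, \<epsilon>) \<in> tet_edges \<and> edge_proj G (T, \<epsilon>) = e}"
    obtain T \<epsilon> where zT: "z = (T, \<epsilon>)" by (cases z)
    with z have "card \<epsilon> = 2" by (simp add: tet_edges_def)
    from *[OF this, of T] show "((\<lambda>x. case z of (T, \<epsilon>) \<Rightarrow> ext_dihedral_angle (tet_lengths G (l x) T) \<epsilon>) \<longlongrightarrow>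
        (case z of (T, \<epsilon>) \<Rightarrow> ext_dihedral_angle (tet_lengths G l0 T) \<epsilon>)) F"
      by (simp only: zT prod.case)
  qed
qed

lemma ext_ricci_curvature_bounded:
  fixes G :: "('t::finite) gluing"
  shows "\<bar>ext_ricci_curvature G l e\<bar> \<le> 2 * pi + pi * real (card (tet_edges :: ('t \<times> 4 set) set))"
proof -
  let ?A = "{(T, \<epsilon>). (T, \<epsilon>) \<in> tet_edges \<and> edge_proj G (T, \<epsilon>) = e}"
  have "0 \<le> (case z of (T, \<epsilon>) \<Rightarrow> ext_dihedral_angle (tet_lengths G l T) \<epsilon>) \<and>
      (case z of (T, \<epsilon>) \<Rightarrow> ext_dihedral_angle (tet_lengths G l T) \<epsilon>) \<le> pi" if "z \<in> ?A" for z
  proof -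
    obtain T \<epsilon> where z1: "z = (T, \<epsilon>)" by (cases z)
    then have z: "z = (T, \<epsilon>)" "card \<epsilon> = 2" using that by (simp_all add: tet_edges_def)
    obtain i j where \<epsilon>: "\<epsilon> = {i, j}" "i \<noteq> j" using z(2) by (meson card_2_iff)
    from UNIV_4_complete[OF this(2)] obtain k h where u: "{i, j, k, h} = UNIV" .
    show ?thesis unfolding z(1) \<epsilon>(1) prod.case ext_dihedral_angle_eq[OF u]
      by (auto intro!: arccos_lbound arccos_ubound)
  qed
  then have "0 \<le> (\<Sum>(T, \<epsilon>)\<in>?A. ext_dihedral_angle (tet_lengths G l T) \<epsilon>)"
    and "(\<Sum>(T, \<epsilon>)\<in>?A. ext_dihedral_angle (tet_lengths G l T) \<epsilon>) \<le> real (card ?A) * pi"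
    by (auto intro!: sum_nonneg sum_bounded_above)
  moreover have "real (card ?A) * pi \<le> real (card (tet_edges :: ('t \<times> 4 set) set)) * pi"
    by (intro mult_right_mono of_nat_mono card_mono) auto
  moreover have "pi > 0" by simp
  ultimately show ?thesis unfolding ext_ricci_curvature_def by (simp only: abs_le_iff mult.commute[of pi], linarith)
qed

lemma ext_ricci_flow_exists:
  fixes G :: "('t::finite) gluing"
  assumes "pos_on_edges G l0"
  shows "\<exists>l. ext_ricci_flow G l0 l"
proof -
  \<comment> \<open>The index type consists of all sets of edges of tetrahedra and is finite;
    components outside \<open>edges G\<close> are carried along without influencing the
    others.\<close>
  define f :: "real ^ (('t \<times> 4 set) set) \<Rightarrow> real ^ (('t \<times> 4 set) set)" where
    "f = (\<lambda>u. \<chi> e. ext_ricci_curvature G (\<lambda>e. exp (u $ e)) e)"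
  define M where "M = 2 * pi + pi * real (card (tet_edges :: ('t \<times> 4 set) set))"
  have "continuous_on UNIV f"
    unfolding f_def continuous_on_def
    by (intro ballI tendsto_vec_lambda tendsto_ext_ricci_curvature tendsto_intros)
  moreover have "norm (f u) \<le> real CARD(('t \<times> 4 set) set) * M" for u
  proof -
    have "norm (f u) \<le> (\<Sum>e\<in>UNIV. \<bar>f u $ e\<bar>)" by (rule norm_le_l1_cart)
    also have "\<dots> \<le> real CARD(('t \<times> 4 set) set) * M"
      by (intro sum_bounded_above) (simp add: f_def M_def ext_ricci_curvature_bounded)
    finally show ?thesis .
  qed
  ultimately obtain u where u0: "u 0 = (\<chi> e. ln (l0 e))"
    and u: "\<And>t. t \<ge> 0 \<Longrightarrow> (u has_vector_derivative f (u t)) (at t within {0..})"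
    using peano_global[of f _ "\<chi> e. ln (l0 e)"] by blast
  define l where "l = (\<lambda>t e. exp (u t $ e))"
  have "ext_ricci_flow G l0 l"
    unfolding ext_ricci_flow_def
  proof (intro conjI ballI allI impI)
    show "l 0 e = l0 e" if "e \<in> edges G" for e
      using assms that by (simp add: l_def u0 pos_on_edges_def)
    show "pos_on_edges G (l t)" for t by (simp add: pos_on_edges_def l_def)
    fix t e assume t: "(t::real) \<ge> 0"
    have "((\<lambda>t. u t $ e) has_vector_derivative f (u t) $ e) (at t within {0..})"
      by (rule bounded_linear.has_vector_derivative[OF bounded_linear_vec_nth u[OF t]])
    then have "((\<lambda>t. u t $ e) has_real_derivative ext_ricci_curvature G (l t) e) (at t within {0..})"
      by (simp add: has_real_derivative_iff_has_vector_derivative f_def l_def)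
    then show "((\<lambda>s. l s e) has_real_derivative ext_ricci_curvature G (l t) e * l t e) (at t within {0..})"
      unfolding l_def by (auto intro!: derivative_eq_intros)
  qed
  then show ?thesis by blast
qed

text \<open>The increments of \<open>g\<close> over unit intervals tend to 0, and by the mean value
  theorem they are values of \<open>g'\<close> at points tending to infinity.\<close>

lemma convergent_derivative_zero:
  fixes g :: "real \<Rightarrow> real"
  assumes g: "\<And>t. t \<ge> 0 \<Longrightarrow> (g has_real_derivative g' t) (at t within {0..})"
    and L: "(g \<longlongrightarrow> L) at_top" and D: "(g' \<longlongrightarrow> D) at_top"
  shows "D = 0"
proof -
  \<comment> \<open>The intervals start at \<open>n + 1\<close>, away from 0, where the derivative
    is only one-sided.\<close>
  have "\<exists>z. real n + 1 < z \<and> g (real n + 2) - g (real n + 1) = g' z" for n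
  proof -
    have "(g has_real_derivative g' x) (at x)" if "x \<ge> real n + 1" for x
    proof -
      have "at x within {0..} = at x" using that by (intro at_within_interior) auto
      then show ?thesis using g[of x] that by simp
    qed
    then show ?thesis using MVT2[of "real n + 1" "real n + 2" g g'] by auto
  qed
  then obtain z where z: "\<And>n. real n + 1 < z n" "\<And>n. g (real n + 2) - g (real n + 1) = g' (z n)"
    by metis
  have top: "filterlim (\<lambda>n. real n + c) at_top sequentially" for c
    using filterlim_tendsto_add_at_top[OF tendsto_const[of c] filterlim_real_sequentially]
    by (simp add: add.commute)
  have "filterlim z at_top sequentially"
    by (rule filterlim_at_top_mono[OF top[of 1]]) (use less_imp_le[OF z(1)] in simp)
  then have "(\<lambda>n. g' (z n)) \<longlonglongrightarrow> D" by (rule filterlim_compose[OF D])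
  moreover have "(\<lambda>n. g (real n + 2) - g (real n + 1)) \<longlonglongrightarrow> L - L"
    by (intro tendsto_diff filterlim_compose[OF L] top)
  ultimately have "D = L - L" unfolding z(2) by (rule LIMSEQ_unique)
  then show ?thesis by simp
qed

text \<open>The speed converges to the curvature of the limit times a positive length, and it must
  converge to 0.\<close>

lemma zero_curvature_of_flow_limit:
  fixes G :: "('t::finite) gluing"
  assumes flow: "ext_ricci_flow G l0 l" and hi: "hyper_ideal_metric G l_inf"
    and conv: "flow_converges G l l_inf"
  shows "zero_curvature_metric G l_inf"
proof -
  have lim: "((\<lambda>t. l t e) \<longlongrightarrow> l_inf e) at_top" if "e \<in> edges G" for e
    using conv that by (simp add: flow_converges_def)
  have "ext_ricci_curvature G l_inf e = 0" if e: "e \<in> edges G" for e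
  proof -
    have "ext_ricci_curvature G l_inf e * l_inf e = 0"
    proof (rule convergent_derivative_zero)
      show "((\<lambda>t. l t e) has_real_derivative ext_ricci_curvature G (l t) e * l t e) (at t within {0..})"
        if "t \<ge> 0" for t using flow e that by (simp add: ext_ricci_flow_def)
      show "((\<lambda>t. ext_ricci_curvature G (l t) e * l t e) \<longlongrightarrow> ext_ricci_curvature G l_inf e * l_inf e) at_top"
        by (intro tendsto_mult tendsto_ext_ricci_curvature lim e)
    qed (rule lim[OF e])
    moreover have "l_inf e > 0" using hi e by (simp add: hyper_ideal_metric_def pos_on_edges_def)
    ultimately show ?thesis by simp
  qed
  then show ?thesis using hi ricci_curvature_eq_ext[OF hi] by (simp add: zero_curvature_metric_def)
qed

theorem theorem1p6:
  fixes G :: "('t::finite) gluing"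
  assumes "closed_pseudo_manifold G"
  shows "((\<exists>l. zero_curvature_metric G l) \<longleftrightarrow>
          (\<exists>l0 l l_inf. pos_on_edges G l0 \<and> ext_ricci_flow G l0 l \<and>
             hyper_ideal_metric G l_inf \<and> flow_converges G l l_inf)) \<and>
         ((\<exists>l. zero_curvature_metric G l) \<longrightarrow>
          (\<forall>l0. pos_on_edges G l0 \<longrightarrow>
             (\<exists>l. ext_ricci_flow G l0 l) \<and>
             (\<forall>l. ext_ricci_flow G l0 l \<longrightarrow>
                (\<exists>l_inf. hyper_ideal_metric G l_inf \<and> flow_converges_exp G l l_inf))))"
proof -
  have limit: "hyper_ideal_metric G l' \<and> flow_converges_exp G l l'"
    if "zero_curvature_metric G l'" "ext_ricci_flow G l0 l" for l' l0 l
    using that flow_converges_exp_zero_curvature by (simp add: zero_curvature_metric_def)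
  \<comment> \<open>The zero-curvature metric itself serves as the initial data.\<close>
  have "\<exists>l0 l l_inf. pos_on_edges G l0 \<and> ext_ricci_flow G l0 l \<and>
      hyper_ideal_metric G l_inf \<and> flow_converges G l l_inf" if l': "zero_curvature_metric G l'" for l'
  proof -
    have p: "pos_on_edges G l'"
      using l' by (simp add: zero_curvature_metric_def hyper_ideal_metric_def)
    then obtain l where "ext_ricci_flow G l' l" using ext_ricci_flow_exists by blast
    with limit[OF l' this] p show ?thesis unfolding flow_converges_exp_def by blast
  qed
  then show ?thesis
    using limit ext_ricci_flow_exists zero_curvature_of_flow_limit by blast
qed

end
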